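(* The Hermitian Tomei manifold $M^{4}_{HT}$ does not admit any almost complex (and hence, any symplectic) structure. In particular, there is no embedding of $M^{4}_{HT}$ into the coadjoint orbit $O_\Lambda$ with non-degenerate restriction of the canonical symplectic form on $O_\Lambda$.
   Context: Fix a generic (pairwise distinct) real spectrum $\Lambda=(\lambda_1,\lambda_2,\lambda_3)$. $M^{4}_{HT}$ is the set of all Hermitian tridiagonal $3\times3$ matrices $$\begin{pmatrix}a_1&b_1&0\\ \bar b_1&a_2&b_2\\ 0&\bar b_2&a_3\end{pmatrix},\qquad a_i\in\mathbb R,\ b_j\in\mathbb C,$$ with spectrum $\Lambda$; it is a smooth compact manifold of real dimension 4. $O_\Lambda$ is the set of all Hermitian $3\times3$ matrices with spectrum $\Lambda$, viewed as a coadjoint orbit of the unitary group $U(3)$ (diffeomorphic to $U(3)/T^3$), with its canonical (Kirillov–Kostant–Souriau) symplectic form. *)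

theory Defs
  imports "HOL-Analysis.Analysis"
begin

section \<open>Smooth maps and submanifolds of Euclidean space\<close>

text \<open>Manifolds are smooth submanifolds \<open>M\<close> of a Euclidean space, given as point sets with the
  induced smooth structure.  The definitions below are the standard ones for such \<open>M\<close>; that a
  given set is a submanifold is not part of them.\<close>

fun C_k_on :: "nat \<Rightarrow> 'a::real_normed_vector set \<Rightarrow> ('a \<Rightarrow> 'b::real_normed_vector) \<Rightarrow> bool" where
  "C_k_on 0 U f \<longleftrightarrow> continuous_on U f"
| "C_k_on (Suc k) U f \<longleftrightarrow>
     (\<forall>x\<in>U. f differentiable (at x)) \<and> (\<forall>v. C_k_on k U (\<lambda>x. frechet_derivative f (at x) v))"

text \<open>Used for open \<open>U\<close> in a finite-dimensional space only.\<close>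

definition smooth_on :: "'a::real_normed_vector set \<Rightarrow> ('a \<Rightarrow> 'b::real_normed_vector) \<Rightarrow> bool" where
  "smooth_on U f \<longleftrightarrow> (\<forall>k. C_k_on k U f)"

text \<open>\<open>\<gamma>\<close> is a smooth curve in \<open>M\<close>, defined near \<open>0\<close>, with \<open>\<gamma>(0) = x\<close> and \<open>\<gamma>'(0) = v\<close>.\<close>

definition smooth_curve_at ::
    "'a::euclidean_space set \<Rightarrow> 'a \<Rightarrow> 'a \<Rightarrow> (real \<Rightarrow> 'a) \<Rightarrow> bool" where
  "smooth_curve_at M x v \<gamma> \<longleftrightarrow>
     (\<exists>\<epsilon>>0. smooth_on {-\<epsilon><..<\<epsilon>} \<gamma> \<and> \<gamma> ` {-\<epsilon><..<\<epsilon>} \<subseteq> M) \<and>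
     \<gamma> 0 = x \<and> (\<gamma> has_vector_derivative v) (at 0)"

definition tangent_space :: "'a::euclidean_space set \<Rightarrow> 'a \<Rightarrow> 'a set" where
  "tangent_space M x = {v. \<exists>\<gamma>. smooth_curve_at M x v \<gamma>}"

definition smooth_map ::
    "'a::euclidean_space set \<Rightarrow> 'b::euclidean_space set \<Rightarrow> ('a \<Rightarrow> 'b) \<Rightarrow> bool" where
  "smooth_map M N f \<longleftrightarrow> f ` M \<subseteq> N \<and>
     (\<forall>x\<in>M. \<exists>U F. open U \<and> x \<in> U \<and> smooth_on U F \<and> (\<forall>y\<in>M \<inter> U. F y = f y))"

text \<open>The differential \<open>df\<^sub>x : T\<^sub>xM \<rightarrow> T\<^sub>f\<^sub>(\<^sub>x\<^sub>)N\<close>; for a smooth map \<open>f\<close> the velocity \<open>w\<close> of the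
  image curve depends only on \<open>v\<close>.\<close>

definition differential ::
    "'a::euclidean_space set \<Rightarrow> ('a \<Rightarrow> 'b::euclidean_space) \<Rightarrow> 'a \<Rightarrow> 'a \<Rightarrow> 'b" where
  "differential M f x v =
     (THE w. \<exists>\<gamma>. smooth_curve_at M x v \<gamma> \<and> ((f \<circ> \<gamma>) has_vector_derivative w) (at 0))"

definition smooth_embedding ::
    "'a::euclidean_space set \<Rightarrow> 'b::euclidean_space set \<Rightarrow> ('a \<Rightarrow> 'b) \<Rightarrow> bool" where
  "smooth_embedding M N f \<longleftrightarrow> smooth_map M N f \<and>
     (\<forall>x\<in>M. inj_on (differential M f x) (tangent_space M x)) \<and>
     (\<exists>g. homeomorphism M (f ` M) f g)"


section \<open>Almost complex and symplectic structures\<close>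

text \<open>Tensor fields on \<open>M\<close> are functions of which only the values at points of \<open>M\<close> and on tangent
  vectors of \<open>M\<close> matter.  Such a field is smooth iff it is locally the restriction of a smooth
  tensor field of the ambient space; this includes its (bi)linearity on each \<open>T\<^sub>xM\<close>.\<close>

definition almost_complex_structure ::
    "'a::euclidean_space set \<Rightarrow> ('a \<Rightarrow> 'a \<Rightarrow> 'a) \<Rightarrow> bool" where
  "almost_complex_structure M J \<longleftrightarrow>
     (\<forall>x\<in>M. \<forall>v\<in>tangent_space M x. J x v \<in> tangent_space M x \<and> J x (J x v) = - v) \<and>
     (\<forall>x\<in>M. \<exists>U. \<exists>K :: 'a \<Rightarrow> 'a \<Rightarrow>\<^sub>L 'a. open U \<and> x \<in> U \<and> smooth_on U K \<and>
        (\<forall>y\<in>M \<inter> U. \<forall>v\<in>tangent_space M y. blinfun_apply (K y) v = J y v))"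

definition alternating_on ::
    "'a::euclidean_space set \<Rightarrow> ('a \<Rightarrow> 'a \<Rightarrow>\<^sub>L 'a \<Rightarrow>\<^sub>L real) \<Rightarrow> bool" where
  "alternating_on U \<Omega> \<longleftrightarrow> (\<forall>y\<in>U. \<forall>v. blinfun_apply (blinfun_apply (\<Omega> y) v) v = 0)"

text \<open>The exterior derivative of a 2-form \<open>\<Omega>\<close> on an open set of the ambient space.\<close>

definition ext_deriv ::
    "('a::euclidean_space \<Rightarrow> 'a \<Rightarrow>\<^sub>L 'a \<Rightarrow>\<^sub>L real) \<Rightarrow> 'a \<Rightarrow> 'a \<Rightarrow> 'a \<Rightarrow> 'a \<Rightarrow> real" where
  "ext_deriv \<Omega> x u v w =
     (let D = frechet_derivative \<Omega> (at x);
          B = (\<lambda>a b c. blinfun_apply (blinfun_apply (D a) b) c)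
      in B u v w - B v u w + B w u v)"

text \<open>Exterior derivative commutes with restriction to \<open>M\<close>, so a 2-form on \<open>M\<close> with local
  extensions \<open>\<Omega>\<close> is closed iff every \<open>d\<Omega>\<close> vanishes on tangent vectors of \<open>M\<close>, which does not
  depend on the choice of \<open>\<Omega>\<close>.\<close>

definition closed_two_form ::
    "'a::euclidean_space set \<Rightarrow> ('a \<Rightarrow> 'a \<Rightarrow> 'a \<Rightarrow> real) \<Rightarrow> bool" where
  "closed_two_form M \<omega> \<longleftrightarrow>
     (\<forall>x\<in>M. \<exists>U. \<exists>\<Omega> :: 'a \<Rightarrow> 'a \<Rightarrow>\<^sub>L 'a \<Rightarrow>\<^sub>L real.
        open U \<and> x \<in> U \<and> smooth_on U \<Omega> \<and> alternating_on U \<Omega> \<and>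
        (\<forall>y\<in>M \<inter> U. \<forall>u\<in>tangent_space M y. \<forall>v\<in>tangent_space M y.
           blinfun_apply (blinfun_apply (\<Omega> y) u) v = \<omega> y u v) \<and>
        (\<forall>y\<in>M \<inter> U. \<forall>u\<in>tangent_space M y. \<forall>v\<in>tangent_space M y. \<forall>w\<in>tangent_space M y.
           ext_deriv \<Omega> y u v w = 0))"

definition nondegenerate_two_form ::
    "'a::euclidean_space set \<Rightarrow> ('a \<Rightarrow> 'a \<Rightarrow> 'a \<Rightarrow> real) \<Rightarrow> bool" where
  "nondegenerate_two_form M \<omega> \<longleftrightarrow>
     (\<forall>x\<in>M. \<forall>u\<in>tangent_space M x. (\<forall>v\<in>tangent_space M x. \<omega> x u v = 0) \<longrightarrow> u = 0)"

definition symplectic_structure ::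
    "'a::euclidean_space set \<Rightarrow> ('a \<Rightarrow> 'a \<Rightarrow> 'a \<Rightarrow> real) \<Rightarrow> bool" where
  "symplectic_structure M \<omega> \<longleftrightarrow> closed_two_form M \<omega> \<and> nondegenerate_two_form M \<omega>"

definition pullback_form ::
    "'a::euclidean_space set \<Rightarrow> ('a \<Rightarrow> 'b::euclidean_space) \<Rightarrow> ('b \<Rightarrow> 'b \<Rightarrow> 'b \<Rightarrow> real) \<Rightarrow>
     'a \<Rightarrow> 'a \<Rightarrow> 'a \<Rightarrow> real" where
  "pullback_form M f \<omega> x u v = \<omega> (f x) (differential M f x u) (differential M f x v)"


section \<open>Isospectral sets of Hermitian matrices\<close>

definition mat_adjoint :: "complex^'n^'n \<Rightarrow> complex^'n^'n" where
  "mat_adjoint A = (\<chi> i j. cnj (A $ j $ i))"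

definition hermitian :: "complex^'n^'n \<Rightarrow> bool" where
  "hermitian A \<longleftrightarrow> mat_adjoint A = A"

definition eigenvalues :: "complex^'n^'n \<Rightarrow> complex set" where
  "eigenvalues A = {\<mu>. \<exists>v. v \<noteq> 0 \<and> A *v v = \<mu> *s v}"

text \<open>The three prescribed values will be pairwise distinct, so that all multiplicities are one and
  the spectrum is determined by the set of eigenvalues.\<close>

definition has_spectrum :: "complex^3^3 \<Rightarrow> real \<Rightarrow> real \<Rightarrow> real \<Rightarrow> bool" where
  "has_spectrum A l1 l2 l3 \<longleftrightarrow>
     eigenvalues A = {complex_of_real l1, complex_of_real l2, complex_of_real l3}"

definition hermitian_tridiagonal :: "complex^3^3 \<Rightarrow> bool" where
  "hermitian_tridiagonal A \<longleftrightarrow>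
     (\<exists>(a1::real) (a2::real) (a3::real) (b1::complex) (b2::complex).
        A = vector [vector [of_real a1, b1,         0],
                    vector [cnj b1,     of_real a2, b2],
                    vector [0,          cnj b2,     of_real a3]])"

definition hermitian_tomei :: "real \<Rightarrow> real \<Rightarrow> real \<Rightarrow> (complex^3^3) set" where
  "hermitian_tomei l1 l2 l3 = {A. hermitian_tridiagonal A \<and> has_spectrum A l1 l2 l3}"

definition hermitian_orbit :: "real \<Rightarrow> real \<Rightarrow> real \<Rightarrow> (complex^3^3) set" where
  "hermitian_orbit l1 l2 l3 = {X. hermitian X \<and> has_spectrum X l1 l2 l3}"

definition commutator :: "complex^'n^'n \<Rightarrow> complex^'n^'n \<Rightarrow> complex^'n^'n" where
  "commutator A B = A ** B - B ** A"

text \<open>The Lie algebra of the unitary group.\<close>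

definition skew_hermitian :: "complex^'n^'n \<Rightarrow> bool" where
  "skew_hermitian A \<longleftrightarrow> mat_adjoint A = - A"

text \<open>The Kirillov--Kostant--Souriau form.  Hermitian matrices \<open>X\<close> are identified with elements of
  the dual of the Lie algebra of skew-Hermitian matrices by \<open>\<langle>X, A\<rangle> = \<i> tr(X A) = - Im (tr(X A))\<close>;
  the coadjoint action becomes conjugation, the tangent space at \<open>X\<close> consists of the commutators
  \<open>[A, X]\<close>, and \<open>\<omega>\<^sub>X([A, X], [B, X]) = \<langle>X, [A, B]\<rangle>\<close> independently of the choice of \<open>A\<close> and \<open>B\<close>.\<close>

definition kks_form :: "complex^'n^'n \<Rightarrow> complex^'n^'n \<Rightarrow> complex^'n^'n \<Rightarrow> real" where
  "kks_form X U V =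
     (THE c. \<exists>A B. skew_hermitian A \<and> skew_hermitian B \<and>
        U = commutator A X \<and> V = commutator B X \<and>
        c = - Im (trace (X ** commutator A B)))"

end

theory Submission
  imports Defs "HOL-Homology.Homology"
begin

text \<open>Each of the three structures yields a continuous nondegenerate alternating form \<open>\<omega>\<close> on the
  tangent spaces: \<open>\<langle>J u, v\<rangle> - \<langle>u, J v\<rangle>\<close>, the symplectic form itself, or the pulled back
  Kirillov--Kostant--Souriau form.  For \<open>l1 < l2 < l3\<close> the 3-sphere \<open>a\<^sub>1 = a\<^sub>3 = l2\<close> cuts the manifold into two
  pieces, each a product of two 2-spheres without a ball.  In an oriented frame the self-dual part of
  \<open>\<omega>\<close> is a nowhere vanishing map to \<open>\<real> \<times> \<complex>\<close>, and on the separating sphere it lifts through the Hopf map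
  to a map \<open>S\<^sup>3 \<rightarrow> S\<^sup>3\<close>.  A side of the cut is a bidisc with collapsed boundary circles along which a
  global frame rotates twice; this makes the lift homotopic to an even map.  The symmetry that
  reverses the diagonal interchanges the sides and turns the frame along the separating sphere by an
  odd isometry of \<open>S\<^sup>3\<close>.  Since both sides give lifts of even type, the identity of \<open>S\<^sup>3\<close> would be
  homotopic to an even map, which a degree argument excludes.\<close>

section \<open>Maps of the 3-sphere to itself\<close>

text \<open>Behind the argument stands a congruence: the manifold has Euler characteristic 6 and
  signature 0, while an almost complex structure on a closed 4-manifold forces the sum of the two to
  be divisible by 4. Characteristic classes are replaced by the parity of self-maps of the 3-sphere.
  A lift through the Hopf map is unique up to homotopy, because the 3-sphere is simply connected, so
  its parity depends on the form alone. On a side this parity is even because the frame rotates by a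
  square, which takes the same value at u and -u. The odd contribution arises from comparing frames:
  in quaternions the symmetry is a two-sided multiplication, whose left factor acts trivially on
  self-dual forms and whose right factor depends linearly on the point of the separating sphere. The
  working notion is "homotopic to an even map" instead of "of even degree": it passes through
  products, inverses and compositions without any computation, and a degree enters only once, for
  the identity.\<close>

type_synonym c2 = "complex \<times> complex"

abbreviation S3 :: "c2 set" where "S3 \<equiv> sphere 0 1"

text \<open>The pair \<open>(p, q)\<close> is the quaternion p + jq. With j on the left, right
  multiplication by \<open>(u, 0)\<close> is scalar multiplication along the Hopf fibres, while left
  multiplication is complex linear, so unit quaternions act from the left as SU(2).\<close>

definition qmul :: "c2 \<Rightarrow> c2 \<Rightarrow> c2"  (infixl "\<otimes>\<^sub>q" 70) where
  "x \<otimes>\<^sub>q y = (fst x * fst y - cnj (snd x) * snd y, snd x * fst y + cnj (fst x) * snd y)"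

definition qcnj :: "c2 \<Rightarrow> c2" where
  "qcnj x = (cnj (fst x), - snd x)"

lemma norm_c2_sq: "(norm (x::c2))\<^sup>2 = (cmod (fst x))\<^sup>2 + (cmod (snd x))\<^sup>2"
  by (simp add: norm_prod_def)

lemma mem_S3_iff: "x \<in> S3 \<longleftrightarrow> (cmod (fst x))\<^sup>2 + (cmod (snd x))\<^sup>2 = 1"
  by (auto simp: norm_prod_def)

lemma cmod_sq: "(cmod z)\<^sup>2 = (Re z)\<^sup>2 + (Im z)\<^sup>2"
  by (rule cmod_power2)

lemma norm_qmul: "norm (x \<otimes>\<^sub>q y) = norm x * norm y"
proof -
  have "(norm (x \<otimes>\<^sub>q y))\<^sup>2 = (norm x * norm y)\<^sup>2"
    unfolding power_mult_distrib norm_c2_sq qmul_def cmod_sq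
    by (simp add: algebra_simps power2_eq_square)
  then show ?thesis by (simp add: power2_eq_iff_nonneg)
qed

lemma norm_qcnj [simp]: "norm (qcnj x) = norm x"
  by (simp add: norm_prod_def qcnj_def)

lemma qmul_assoc: "x \<otimes>\<^sub>q y \<otimes>\<^sub>q z = x \<otimes>\<^sub>q (y \<otimes>\<^sub>q z)"
  by (simp add: qmul_def algebra_simps)

lemma qmul_one [simp]: "x \<otimes>\<^sub>q (1,0) = x" "(1,0) \<otimes>\<^sub>q x = x"
  by (simp_all add: qmul_def)

lemma qmul_qcnj:
  assumes "x \<in> S3"
  shows "x \<otimes>\<^sub>q qcnj x = (1,0)" "qcnj x \<otimes>\<^sub>q x = (1,0)"
proof -
  have "complex_of_real ((cmod (fst x))\<^sup>2 + (cmod (snd x))\<^sup>2) = 1"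
    using assms unfolding mem_S3_iff by simp
  then have "fst x * cnj (fst x) + snd x * cnj (snd x) = 1"
    by (simp only: of_real_add complex_norm_square)
  then show "x \<otimes>\<^sub>q qcnj x = (1,0)" "qcnj x \<otimes>\<^sub>q x = (1,0)"
    by (simp_all add: qmul_def qcnj_def mult.commute)
qed

lemma qmul_minus [simp]: "(-x) \<otimes>\<^sub>q y = - (x \<otimes>\<^sub>q y)" "x \<otimes>\<^sub>q (-y) = - (x \<otimes>\<^sub>q y)"
  by (simp_all add: qmul_def)

lemma qmul_S3: "x \<in> S3 \<Longrightarrow> y \<in> S3 \<Longrightarrow> x \<otimes>\<^sub>q y \<in> S3"
  by (simp add: norm_qmul)

lemma qcnj_S3: "x \<in> S3 \<Longrightarrow> qcnj x \<in> S3"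
  by simp

lemma continuous_on_qmul [continuous_intros]:
  "continuous_on S f \<Longrightarrow> continuous_on S g \<Longrightarrow> continuous_on S (\<lambda>x. f x \<otimes>\<^sub>q g x)"
  unfolding qmul_def by (intro continuous_intros)

lemma continuous_on_qcnj [continuous_intros]:
  "continuous_on S f \<Longrightarrow> continuous_on S (\<lambda>x. qcnj (f x))"
  unfolding qcnj_def by (intro continuous_intros)

section \<open>Homotopy calculus for self-maps of the 3-sphere\<close>

abbreviation heq :: "(c2 \<Rightarrow> c2) \<Rightarrow> (c2 \<Rightarrow> c2) \<Rightarrow> bool"  (infix "\<simeq>" 50) where
  "f \<simeq> g \<equiv> homotopic_with_canon (\<lambda>_. True) S3 S3 f g"

lemma heqI:
  assumes "continuous_on ({0..1::real} \<times> S3) h"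
    and "\<And>t x. t \<in> {0..1} \<Longrightarrow> x \<in> S3 \<Longrightarrow> h (t, x) \<in> S3"
    and "\<And>x. x \<in> S3 \<Longrightarrow> h (0, x) = f x" "\<And>x. x \<in> S3 \<Longrightarrow> h (1, x) = g x"
  shows "f \<simeq> g"
proof -
  have "(\<lambda>x. h (0, x)) \<simeq> (\<lambda>x. h (1, x))"
    unfolding homotopic_with_def
    using assms(1,2) by (intro exI[of _ h]) (auto simp: image_subset_iff Pi_iff)
  then show ?thesis
    by (rule homotopic_with_eq) (use assms(3,4) in auto)
qed

lemma heqE:
  assumes "f \<simeq> g"
  obtains h where "continuous_on ({0..1::real} \<times> S3) h"
    and "\<And>t x. t \<in> {0..1} \<Longrightarrow> x \<in> S3 \<Longrightarrow> h (t, x) \<in> S3"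
    and "\<And>x. h (0, x) = f x" "\<And>x. h (1, x) = g x"
proof -
  from assms obtain h where "continuous_on ({0..1::real} \<times> S3) h" "h \<in> ({0..1::real} \<times> S3) \<rightarrow> S3"
     "\<And>x. h (0, x) = f x" "\<And>x. h (1, x) = g x"
    unfolding homotopic_with_def by (auto simp: image_subset_iff Pi_iff)
  then show thesis by (intro that[of h]) auto
qed

lemma heq_cong: "f \<simeq> g \<Longrightarrow> (\<And>x. x \<in> S3 \<Longrightarrow> f x = f' x) \<Longrightarrow> (\<And>x. x \<in> S3 \<Longrightarrow> g x = g' x) \<Longrightarrow> f' \<simeq> g'"
  by (erule homotopic_with_eq) (simp_all only: topspace_euclidean_subtopology)

lemma heq_refl: "continuous_on S3 f \<Longrightarrow> (\<And>x. x \<in> S3 \<Longrightarrow> f x \<in> S3) \<Longrightarrow> f \<simeq> f"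
  by (auto simp: homotopic_with_refl)

lemma heq_sym: "f \<simeq> g \<Longrightarrow> g \<simeq> f"
  by (rule homotopic_with_symD)

lemma heq_trans: "f \<simeq> g \<Longrightarrow> g \<simeq> h \<Longrightarrow> f \<simeq> h"
  by (rule homotopic_with_trans)

lemma heq_continuous: "f \<simeq> g \<Longrightarrow> continuous_on S3 f" "f \<simeq> g \<Longrightarrow> continuous_on S3 g"
  using homotopic_with_imp_continuous by blast+

lemma heq_S3: assumes "f \<simeq> g" "x \<in> S3" shows "f x \<in> S3" "g x \<in> S3"
  using homotopic_with_imp_subset1[OF assms(1)] homotopic_with_imp_subset2[OF assms(1)] assms(2) by blast+

lemma heq_qmul:
  assumes "f \<simeq> f'" "g \<simeq> g'"
  shows "(\<lambda>x. f x \<otimes>\<^sub>q g x) \<simeq> (\<lambda>x. f' x \<otimes>\<^sub>q g' x)"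
proof -
  obtain h where h: "continuous_on ({0..1::real} \<times> S3) h"
    "\<And>t x. t \<in> {0..1} \<Longrightarrow> x \<in> S3 \<Longrightarrow> h (t, x) \<in> S3" "\<And>x. h (0, x) = f x" "\<And>x. h (1, x) = f' x"
    using heqE[OF assms(1)] by blast
  obtain k where k: "continuous_on ({0..1::real} \<times> S3) k"
    "\<And>t x. t \<in> {0..1} \<Longrightarrow> x \<in> S3 \<Longrightarrow> k (t, x) \<in> S3" "\<And>x. k (0, x) = g x" "\<And>x. k (1, x) = g' x"
    using heqE[OF assms(2)] by blast
  show ?thesis
    by (rule heqI[of "\<lambda>z. h z \<otimes>\<^sub>q k z"]) (use h k in \<open>auto intro!: continuous_intros simp: norm_qmul\<close>)
qed

lemma heq_qcnj:
  assumes "f \<simeq> f'"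
  shows "(\<lambda>x. qcnj (f x)) \<simeq> (\<lambda>x. qcnj (f' x))"
proof -
  obtain h where h: "continuous_on ({0..1::real} \<times> S3) h"
    "\<And>t x. t \<in> {0..1} \<Longrightarrow> x \<in> S3 \<Longrightarrow> h (t, x) \<in> S3" "\<And>x. h (0, x) = f x" "\<And>x. h (1, x) = f' x"
    using heqE[OF assms(1)] by blast
  show ?thesis
    by (rule heqI[of "\<lambda>z. qcnj (h z)"]) (use h in \<open>auto intro!: continuous_intros\<close>)
qed

lemma heq_compose:
  assumes "f \<simeq> f'" "continuous_on S3 g" "\<And>x. x \<in> S3 \<Longrightarrow> g x \<in> S3"
  shows "(\<lambda>x. g (f x)) \<simeq> (\<lambda>x. g (f' x))" "(\<lambda>x. f (g x)) \<simeq> (\<lambda>x. f' (g x))"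
proof -
  show "(\<lambda>x. g (f x)) \<simeq> (\<lambda>x. g (f' x))"
    using homotopic_with_compose_continuous_left[OF assms(1), of g S3] assms(2,3)
    by (auto simp: o_def)
  show "(\<lambda>x. f (g x)) \<simeq> (\<lambda>x. f' (g x))"
    using homotopic_with_compose_continuous_right[OF assms(1), of S3 g] assms(2,3)
    by (auto simp: o_def)
qed

lemma heq_normalize:
  assumes "continuous_on ({0..1::real} \<times> S3) h"
    and "\<And>t x. t \<in> {0..1} \<Longrightarrow> x \<in> S3 \<Longrightarrow> h (t, x) \<noteq> 0"
    and "\<And>x. x \<in> S3 \<Longrightarrow> h (0, x) = f x" "\<And>x. x \<in> S3 \<Longrightarrow> h (1, x) = g x"
  shows "(\<lambda>x. f x /\<^sub>R norm (f x)) \<simeq> (\<lambda>x. g x /\<^sub>R norm (g x))"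
  by (rule heqI[of "\<lambda>z. h z /\<^sub>R norm (h z)"])
    (use assms in \<open>force intro!: continuous_intros simp: assms(3,4)\<close>)+

lemma heq_line:
  assumes "continuous_on S3 f" "continuous_on S3 g" "\<And>x. x \<in> S3 \<Longrightarrow> f x \<in> S3" "\<And>x. x \<in> S3 \<Longrightarrow> g x \<in> S3"
    and "\<And>t x. t \<in> {0..1} \<Longrightarrow> x \<in> S3 \<Longrightarrow> (1-t) *\<^sub>R f x + t *\<^sub>R g x \<noteq> 0"
  shows "f \<simeq> g"
proof -
  have *: "continuous_on ({0..1::real} \<times> S3) (\<lambda>z. f (snd z))" "continuous_on ({0..1::real} \<times> S3) (\<lambda>z. g (snd z))"
    by (auto intro!: continuous_on_compose2[OF assms(1)] continuous_on_compose2[OF assms(2)] continuous_intros)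
  have "(\<lambda>x. f x /\<^sub>R norm (f x)) \<simeq> (\<lambda>x. g x /\<^sub>R norm (g x))"
    by (rule heq_normalize[of "\<lambda>z. (1 - fst z) *\<^sub>R f (snd z) + fst z *\<^sub>R g (snd z)"])
      (use assms in \<open>auto intro!: continuous_intros *\<close>)
  then show ?thesis by (rule heq_cong) (use assms in auto)
qed

text \<open>A segment between two unit vectors passes through 0 only at its midpoint, and only if
  they are antipodal; otherwise it can be normalized.\<close>

lemma heq_close:
  assumes "continuous_on S3 f" "continuous_on S3 g" "\<And>x. x \<in> S3 \<Longrightarrow> f x \<in> S3" "\<And>x. x \<in> S3 \<Longrightarrow> g x \<in> S3"
    and "\<And>x. x \<in> S3 \<Longrightarrow> g x \<noteq> - f x"
  shows "f \<simeq> g"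
proof (rule heq_line[OF assms(1-4)], assumption, assumption)
  fix t x assume t: "t \<in> {0..1::real}" and x: "x \<in> S3"
  show "(1-t) *\<^sub>R f x + t *\<^sub>R g x \<noteq> 0"
  proof
    assume "(1-t) *\<^sub>R f x + t *\<^sub>R g x = 0"
    then have e: "(1-t) *\<^sub>R f x = - (t *\<^sub>R g x)" by (simp add: eq_neg_iff_add_eq_0)
    then have "norm ((1-t) *\<^sub>R f x) = norm (t *\<^sub>R g x)" by simp
    then have "1 - t = t" using t assms(3)[OF x] assms(4)[OF x] by simp
    then have "t = 1/2" by simp
    with e have "(1/2::real) *\<^sub>R f x = (1/2::real) *\<^sub>R (- g x)" by simp
    then have "f x = - g x" unfolding scaleR_cancel_left by simp
    with assms(5)[OF x] show False by simp
  qed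
qed

section \<open>Normal form of even maps along the equator\<close>

lemma one_S3: "(1,0) \<in> S3" by (simp add: mem_S3_iff del: mem_sphere_0)

lemma uminus_S3: "x \<in> S3 \<Longrightarrow> - x \<in> S3" by simp

text \<open>Averaging a polynomial approximation over x and -x keeps the error below 1/2 because
  \<open>e\<close> is even, and this bound keeps the segment from \<open>e x\<close> to the
  polynomial away from 0. The gain is differentiability: a smooth image of the 2-dimensional equator
  cannot fill the 3-sphere.\<close>

lemma even_map_approx:
  assumes e: "continuous_on S3 e" "\<And>x. x \<in> S3 \<Longrightarrow> e x \<in> S3" "\<And>x. x \<in> S3 \<Longrightarrow> e (-x) = e x"
  obtains e' w where "e \<simeq> e'" "\<And>x. e' (-x) = e' x" "w \<in> S3"
    "\<And>x. x \<in> S3 \<Longrightarrow> Im (snd x) = 0 \<Longrightarrow> e' x \<noteq> w"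
proof -
  obtain p where p: "polynomial_function p" "\<And>x. x \<in> S3 \<Longrightarrow> norm (e x - p x) < 1/2"
    using Stone_Weierstrass_polynomial_function[of S3 e "1/2"] e(1) by auto
  define q where "q x = (1/2) *\<^sub>R (p x + p (-x))" for x
  have "polynomial_function (p \<circ> (\<lambda>x. - x))"
    by (rule polynomial_function_compose) (auto intro!: p polynomial_function_minus)
  then have q: "polynomial_function q"
    unfolding q_def o_def by (intro polynomial_function_cmul polynomial_function_add p)
  have close: "norm (e x - q x) < 1/2" if x: "x \<in> S3" for x
  proof -
    have "e x - q x = (1/2) *\<^sub>R ((e x - p x) + (e (-x) - p (-x)))"
      using e(3)[OF x] by (simp add: q_def algebra_simps flip: scaleR_add_left)
    then have "norm (e x - q x) \<le> (norm (e x - p x) + norm (e (-x) - p (-x))) / 2"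
      by (simp add: norm_triangle_ineq)
    also have "\<dots> < 1/2" using p(2)[OF x] p(2)[OF uminus_S3[OF x]] by simp
    finally show ?thesis .
  qed
  have line: "(1-t) *\<^sub>R e x + t *\<^sub>R q x \<noteq> 0" if "t \<in> {0..1}" "x \<in> S3" for t x
  proof
    assume "(1-t) *\<^sub>R e x + t *\<^sub>R q x = 0"
    then have "e x = t *\<^sub>R (e x - q x)" by (simp add: algebra_simps)
    then have "norm (e x) = t * norm (e x - q x)" using that by (metis abs_of_nonneg atLeastAtMost_iff norm_scaleR)
    also have "\<dots> \<le> 1 * norm (e x - q x)" using that by (intro mult_right_mono) auto
    finally show False using close[OF that(2)] e(2)[OF that(2)] by simp
  qed
  have qnz: "q x \<noteq> 0" if "x \<in> S3" for x using line[of 1 x] that by simp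
  define e' where "e' x = q x /\<^sub>R norm (q x)" for x
  have "(\<lambda>x. e x /\<^sub>R norm (e x)) \<simeq> (\<lambda>x. q x /\<^sub>R norm (q x))"
  proof (rule heq_normalize[of "\<lambda>z. (1 - fst z) *\<^sub>R e (snd z) + fst z *\<^sub>R q (snd z)"])
    show "continuous_on ({0..1} \<times> S3) (\<lambda>z. (1 - fst z) *\<^sub>R e (snd z) + fst z *\<^sub>R q (snd z))"
      by (intro continuous_intros continuous_on_compose2[OF e(1)]
          continuous_on_compose2[OF continuous_on_polymonial_function[OF q, of UNIV]]) auto
  qed (use line in auto)
  then have 1: "e \<simeq> e'"
    by (rule heq_cong) (use e(2) in \<open>auto simp: e'_def\<close>)
  \<comment> \<open>\<open>Q\<close> extends q homogeneously of degree one, so a nonzero point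
    missed by the image of the cone \<open>T\<close> gives a direction missed on the equator.
    \<open>T\<close> lies in a hyperplane and avoids the origin, where \<open>Q\<close> need not be
    differentiable.\<close>
  define T where "T = {x::c2. Im (snd x) = 0} - {0}"
  define Q where "Q x = norm x *\<^sub>R q (x /\<^sub>R norm x)" for x
  have "{x::c2. Im (snd x) = 0} = {x. (0, \<i>) \<bullet> x = 0}"
    by (auto simp: inner_complex_def)
  then have "negligible {x::c2. Im (snd x) = 0}"
    using negligible_hyperplane[of "(0,\<i>)" 0] by (simp add: zero_prod_def)
  then have "negligible T" unfolding T_def by (rule negligible_subset) auto
  moreover have "Q differentiable_on T"
    unfolding differentiable_on_def
  proof
    fix x assume "x \<in> T"
    then have x: "x \<noteq> 0" by (simp add: T_def)
    have "(\<lambda>x::c2. x /\<^sub>R norm x) differentiable at x"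
      using x by (intro derivative_intros) auto
    then have "(q \<circ> (\<lambda>x. x /\<^sub>R norm x)) differentiable at x"
      by (rule differentiable_chain_at) (rule differentiable_at_polynomial_function[OF q])
    then have "(\<lambda>x. q (x /\<^sub>R norm x)) differentiable at x" by (simp add: o_def)
    then have "Q differentiable at x"
      unfolding Q_def using x by (intro differentiable_scaleR differentiable_norm_at) auto
    then show "Q differentiable at x within T" by (rule differentiable_at_withinI)
  qed
  ultimately have "negligible (Q ` T)"
    by (intro negligible_differentiable_image_negligible) auto
  then have "negligible (insert 0 (Q ` T))" by simp
  then have "insert 0 (Q ` T) \<noteq> UNIV" using non_negligible_UNIV by metis
  then obtain v where v: "v \<noteq> 0" "v \<notin> Q ` T" by auto
  define w where "w = v /\<^sub>R norm v"
  have "e' x \<noteq> w" if x: "x \<in> S3" "Im (snd x) = 0" for x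
  proof
    assume "e' x = w"
    define l where "l = norm v / norm (q x)"
    have l: "l > 0" using v qnz[OF x(1)] by (simp add: l_def)
    have "v = l *\<^sub>R q x"
      using \<open>e' x = w\<close> v(1) unfolding e'_def w_def l_def
      by (metis divide_inverse norm_eq_zero right_inverse scaleR_one scaleR_scaleR)
    moreover have "norm (l *\<^sub>R x) = l" using l x by simp
    ultimately have "v = Q (l *\<^sub>R x)" using l by (simp add: Q_def)
    moreover have "l *\<^sub>R x \<in> T" using x l by (auto simp: T_def)
    ultimately show False using v(2) by blast
  qed
  moreover have "e' (-x) = e' x" for x by (simp add: e'_def q_def add.commute)
  moreover have "w \<in> S3" using v by (simp add: w_def)
  ultimately show thesis using 1 that by blast
qed

text \<open>Some value \<open>w\<close> is omitted on the equator, so near it the map can be pushed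
  along segments towards \<open>-w\<close>. The cut-off depends on x only through
  \<open>\<bar>Im (snd x)\<bar>\<close>, which agrees at x and -x, so evenness survives.\<close>

lemma even_map_const_on_equator:
  assumes e: "continuous_on S3 e" "\<And>x. x \<in> S3 \<Longrightarrow> e x \<in> S3" "\<And>x. x \<in> S3 \<Longrightarrow> e (-x) = e x"
  obtains e' c where "e \<simeq> e'" "\<And>x. e' (-x) = e' x" "c \<in> S3"
    "\<And>x. x \<in> S3 \<Longrightarrow> Im (snd x) = 0 \<Longrightarrow> e' x = c"
proof -
  obtain d w where d: "e \<simeq> d" "\<And>x. d (-x) = d x" "w \<in> S3"
    "\<And>x. x \<in> S3 \<Longrightarrow> Im (snd x) = 0 \<Longrightarrow> d x \<noteq> w"
    using even_map_approx[OF e] by blast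
  note dcont = heq_continuous(2)[OF d(1)] and dS = heq_S3(2)[OF d(1)]
  \<comment> \<open>The preimage of \<open>w\<close> is compact and misses the equator, so it stays
    outside a band of width \<delta> around it; the cut-off \<open>s\<close> is supported in that
    band.\<close>
  define K where "K = S3 \<inter> d -` {w}"
  have "closed K"
    unfolding K_def by (rule continuous_closed_preimage[OF dcont]) auto
  then have "compact K"
    by (metis K_def bounded_sphere bounded_subset compact_eq_bounded_closed inf_le1)
  then have "closed ((\<lambda>x. \<bar>Im (snd x)\<bar>) ` K)"
    by (intro compact_imp_closed compact_continuous_image continuous_intros)
  moreover have "0 \<notin> (\<lambda>x. \<bar>Im (snd x)\<bar>) ` K"
    using d(4) by (auto simp: K_def)
  ultimately have "\<exists>\<delta>>0. \<forall>y\<in>(\<lambda>x. \<bar>Im (snd x)\<bar>) ` K. \<delta> \<le> dist 0 y"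
    by (rule separate_point_closed)
  then obtain \<delta> where \<delta>: "\<delta> > 0" "\<And>y. y \<in> (\<lambda>x. \<bar>Im (snd x)\<bar>) ` K \<Longrightarrow> \<delta> \<le> dist 0 y"
    by metis
  have dnw: "d x \<noteq> w" if "x \<in> S3" "\<bar>Im (snd x)\<bar> < \<delta>" for x
    using \<delta>(2)[OF imageI, of x] that by (auto simp: K_def)
  define s where "s x = max 0 (1 - \<bar>Im (snd x)\<bar> / \<delta>)" for x :: c2
  have s: "s x \<in> {0..1}" "s x \<noteq> 0 \<Longrightarrow> \<bar>Im (snd x)\<bar> < \<delta>" for x
    using \<delta>(1) by (auto simp: s_def max_def divide_less_eq split: if_splits)
  have scont: "continuous_on A s" for A
    unfolding s_def using \<delta>(1) by (intro continuous_intros) auto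
  define h where "h t x = (1 - t * s x) *\<^sub>R d x - (t * s x) *\<^sub>R w" for t x
  have hnz: "h t x \<noteq> 0" if "t \<in> {0..1}" "x \<in> S3" for t x
  proof
    assume h0: "h t x = 0"
    have ts: "t * s x \<in> {0..1}" using that s(1)[of x] by (auto intro: mult_le_one)
    from h0 have e: "(1 - t * s x) *\<^sub>R d x = (t * s x) *\<^sub>R w" by (simp add: h_def)
    then have "norm ((1 - t * s x) *\<^sub>R d x) = norm ((t * s x) *\<^sub>R w)" by simp
    then have "1 - t * s x = t * s x" using ts dS[OF that(2)] d(3) by simp
    then have half: "t * s x = 1/2" by simp
    with e have "d x = w" by simp
    moreover have "s x \<noteq> 0" using half by auto
    ultimately show False using dnw s(2) that(2) by blast
  qed
  define e' where "e' x = h 1 x /\<^sub>R norm (h 1 x)" for x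
  have "(\<lambda>x. h 0 x /\<^sub>R norm (h 0 x)) \<simeq> (\<lambda>x. h 1 x /\<^sub>R norm (h 1 x))"
  proof (rule heq_normalize[of "\<lambda>z. h (fst z) (snd z)"])
    show "continuous_on ({0..1} \<times> S3) (\<lambda>z. h (fst z) (snd z))"
      unfolding h_def
      by (intro continuous_intros continuous_on_compose2[OF dcont] continuous_on_compose2[OF scont[of UNIV]]) auto
  qed (use hnz in auto)
  then have "d \<simeq> e'"
    by (rule heq_cong) (use dS in \<open>auto simp: e'_def h_def\<close>)
  with d(1) have "e \<simeq> e'" by (rule heq_trans)
  moreover have "e' (-x) = e' x" for x
    by (simp add: e'_def h_def s_def d(2))
  moreover have "e' x = - w" if "x \<in> S3" "Im (snd x) = 0" for x
    using that d(3) by (simp add: e'_def h_def s_def)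
  moreover have "- w \<in> S3" using d(3) by simp
  ultimately show thesis using that by blast
qed

section \<open>Coordinates for the Brouwer degree\<close>

definition to_c2 :: "(nat \<Rightarrow> real) \<Rightarrow> c2" where
  "to_c2 u = (Complex (u 0) (u 1), Complex (u 2) (u 3))"

definition from_c2 :: "c2 \<Rightarrow> nat \<Rightarrow> real" where
  "from_c2 x i = (if i = 0 then Re (fst x) else if i = 1 then Im (fst x)
     else if i = 2 then Re (snd x) else if i = 3 then Im (snd x) else 0)"

lemma to_from_c2 [simp]: "to_c2 (from_c2 x) = x"
  by (simp add: to_c2_def from_c2_def complex_eq_iff prod_eq_iff)

lemma topspace_nsphere3: "u \<in> topspace (nsphere 3) \<longleftrightarrow> to_c2 u \<in> S3 \<and> from_c2 (to_c2 u) = u"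
proof -
  have "from_c2 (to_c2 u) = u \<longleftrightarrow> (\<forall>i>3. u i = 0)"
  proof
    assume "\<forall>i>3. u i = 0"
    then show "from_c2 (to_c2 u) = u"
      by (intro ext) (auto simp: from_c2_def to_c2_def not_less numeral_3_eq_3 numeral_2_eq_2 less_Suc_eq_le)
  next
    assume "from_c2 (to_c2 u) = u"
    then have "u i = from_c2 (to_c2 u) i" for i by simp
    then show "\<forall>i>3. u i = 0" by (simp add: from_c2_def)
  qed
  moreover have "(\<Sum>i\<le>3. (u i)\<^sup>2) = 1 \<longleftrightarrow> to_c2 u \<in> S3"
  proof -
    have "{..3::nat} = {0,1,2,3}" by auto
    then show ?thesis unfolding mem_S3_iff by (simp add: to_c2_def cmod_power2 algebra_simps)
  qed
  ultimately show ?thesis by (auto simp: nsphere)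
qed

lemma nsphere3: "nsphere 3 = top_of_set {u. to_c2 u \<in> S3 \<and> from_c2 (to_c2 u) = u}"
proof -
  have "topspace (nsphere 3) = {u. to_c2 u \<in> S3 \<and> from_c2 (to_c2 u) = u}"
    using topspace_nsphere3 by blast
  then show ?thesis
    by (simp add: nsphere euclidean_product_topology)
qed

lemma continuous_on_to_c2: "continuous_on A to_c2"
  unfolding to_c2_def Complex_eq by (intro continuous_intros continuous_on_subset[OF continuous_on_product_coordinates]) auto

lemma continuous_on_from_c2: "continuous_on A from_c2"
proof (rule continuous_on_coordinatewise_then_product)
  fix i show "continuous_on A (\<lambda>x. from_c2 x i)"
    unfolding from_c2_def by (cases "i = 0"; cases "i = 1"; cases "i = 2"; cases "i = 3") (auto intro!: continuous_intros)
qed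

text \<open>Once the even map is constant on the equator, the odd map \<open>x \<mapsto> x c e(x)\<^sup>-\<^sup>1\<close> restricts to the identity of the equator, so its degree is odd.\<close>

theorem id_not_heq_even:
  assumes e: "(\<lambda>x. x) \<simeq> e" "\<And>x. x \<in> S3 \<Longrightarrow> e (-x) = e x"
  shows False
proof -
  obtain d c where d: "e \<simeq> d" "\<And>x. d (-x) = d x" "c \<in> S3"
    "\<And>x. x \<in> S3 \<Longrightarrow> Im (snd x) = 0 \<Longrightarrow> d x = c"
    using even_map_const_on_equator[OF heq_continuous(2)[OF e(1)] heq_S3(2)[OF e(1)] e(2)] by blast
  define F where "F x = x \<otimes>\<^sub>q (c \<otimes>\<^sub>q qcnj (d x))" for x
  have c_refl: "(\<lambda>x. c) \<simeq> (\<lambda>x. c)" and id_refl: "(\<lambda>x. x) \<simeq> (\<lambda>x. x)"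
    using d(3) by (auto intro: heq_refl)
  \<comment> \<open>If the identity is homotopic to \<open>d\<close>, then \<open>F\<close> is
    homotopic to x c x^-1 and, after moving \<open>c\<close> to 1 along a path, to a constant: its
    degree is 0.\<close>
  have "(\<lambda>x. x) \<simeq> d" using e(1) d(1) by (rule heq_trans)
  then have "(\<lambda>x. qcnj x) \<simeq> (\<lambda>x. qcnj (d x))" by (rule heq_qcnj)
  then have 1: "(\<lambda>x. x \<otimes>\<^sub>q (c \<otimes>\<^sub>q qcnj x)) \<simeq> F"
    unfolding F_def by (intro heq_qmul id_refl c_refl)
  have "path_connected S3" by (rule path_connected_sphere) simp
  then obtain g where g: "path g" "path_image g \<subseteq> S3" "pathstart g = c" "pathfinish g = (1,0)"
    using d(3) one_S3 unfolding path_connected_def by blast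
  have "(\<lambda>x. c) \<simeq> (\<lambda>x. (1,0))"
  proof (rule heqI[of "\<lambda>z. g (fst z)"])
    show "continuous_on ({0..1} \<times> S3) (\<lambda>z. g (fst z))"
      using g(1) by (auto simp: path_def intro!: continuous_intros elim!: continuous_on_compose2)
  qed (use g in \<open>auto simp: pathstart_def pathfinish_def path_image_def image_subset_iff simp del: mem_sphere_0\<close>)
  then have "(\<lambda>x. x \<otimes>\<^sub>q (c \<otimes>\<^sub>q qcnj x)) \<simeq> (\<lambda>x. x \<otimes>\<^sub>q ((1,0) \<otimes>\<^sub>q qcnj x))"
    by (intro heq_qmul heq_qcnj id_refl)
  then have "(\<lambda>x. x \<otimes>\<^sub>q (c \<otimes>\<^sub>q qcnj x)) \<simeq> (\<lambda>x. (1,0))"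
    by (rule heq_cong) (auto simp: qmul_qcnj simp del: mem_sphere_0)
  then have F: "F \<simeq> (\<lambda>x. (1,0))" using heq_trans heq_sym 1 by blast
  define G where "G = from_c2 \<circ> F \<circ> to_c2"
  let ?N = "{u. to_c2 u \<in> S3 \<and> from_c2 (to_c2 u) = u}"
  have "homotopic_with_canon (\<lambda>_. True) ?N S3 (F \<circ> to_c2) ((\<lambda>x. (1,0)) \<circ> to_c2)"
    by (rule homotopic_with_compose_continuous_right[OF F continuous_on_to_c2]) auto
  then have "homotopic_with_canon (\<lambda>_. True) ?N ?N (from_c2 \<circ> (F \<circ> to_c2)) (from_c2 \<circ> ((\<lambda>x. (1,0)) \<circ> to_c2))"
    by (rule homotopic_with_compose_continuous_left[OF _ continuous_on_from_c2]) auto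
  then have hom: "homotopic_with (\<lambda>_. True) (nsphere 3) (nsphere 3) G (\<lambda>x. from_c2 (1,0))"
    unfolding nsphere3 G_def o_assoc by (simp add: o_def)
  then have deg0: "Brouwer_degree2 3 G = 0"
    by (rule Brouwer_degree2_nullhomotopic)
  \<comment> \<open>The last coordinate is \<open>Im (snd x)\<close>, so this is the equator on
    which \<open>d\<close> is constant.\<close>
  have equator: "topspace (nsphere 2) = {u \<in> topspace (nsphere 3). u 3 = 0}"
  proof -
    have "nsphere 2 = subtopology (nsphere 3) {x. x 3 = 0}"
      using subtopology_nsphere_equator[of 2] by simp
    then show ?thesis by (simp add: Collect_conj_eq)
  qed
  have Geq: "G u = u" if "u \<in> topspace (nsphere 2)" for u
  proof -
    have u: "to_c2 u \<in> S3" "from_c2 (to_c2 u) = u" "Im (snd (to_c2 u)) = 0"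
      using that unfolding equator by (auto simp: topspace_nsphere3 to_c2_def simp del: mem_sphere_0)
    have "F (to_c2 u) = to_c2 u"
      using d(4)[OF u(1,3)] qmul_qcnj[OF d(3)] by (simp add: F_def)
    then show ?thesis using u by (simp add: G_def)
  qed
  \<comment> \<open>The degree of an odd map that preserves the equator has the parity of the degree
    of its restriction; here the restriction is the identity, of degree 1.\<close>
  have "even (Brouwer_degree2 3 G - Brouwer_degree2 (3 - Suc 0) G)"
  proof (rule Borsuk_odd_mapping_degree_step)
    show "continuous_map (nsphere 3) (nsphere 3) G"
      using homotopic_with_imp_continuous_maps[OF hom] by blast
    fix u assume "u \<in> topspace (nsphere 3)"
    have *: "to_c2 (\<lambda>i. - u i) = - to_c2 u" by (simp add: to_c2_def complex_eq_iff)
    have **: "from_c2 (- x) = (\<lambda>i. - from_c2 x i)" for x by (simp add: from_c2_def fun_eq_iff)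
    show "(G \<circ> (\<lambda>x i. - x i)) u = ((\<lambda>x i. - x i) \<circ> G) u"
      by (simp add: G_def * ** F_def d(2) o_def)
  next
    show "G \<in> topspace (nsphere (3 - Suc 0)) \<rightarrow> topspace (nsphere (3 - Suc 0))"
      using Geq by auto
  qed
  moreover have "Brouwer_degree2 (3 - Suc 0) G = Brouwer_degree2 (3 - Suc 0) id"
    using Geq by (intro Brouwer_degree2_eq) simp
  ultimately show False using deg0 by simp
qed

text \<open>Stands in for having even degree. Being homotopic to an even map passes directly to
  quaternion products and inverses, to arbitrary maps composed on the outside and to odd maps
  composed on the inside.\<close>

definition even_type :: "(c2 \<Rightarrow> c2) \<Rightarrow> bool" where
  "even_type f \<longleftrightarrow> (\<exists>e. f \<simeq> e \<and> (\<forall>x\<in>S3. e (-x) = e x))"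

lemma even_typeI: "f \<simeq> e \<Longrightarrow> (\<And>x. x \<in> S3 \<Longrightarrow> e (-x) = e x) \<Longrightarrow> even_type f"
  unfolding even_type_def by blast

lemma even_typeE:
  assumes "even_type f" obtains e where "f \<simeq> e" "\<And>x. x \<in> S3 \<Longrightarrow> e (-x) = e x"
  using assms unfolding even_type_def by blast

lemma even_type_heq: "even_type g \<Longrightarrow> f \<simeq> g \<Longrightarrow> even_type f"
  unfolding even_type_def using heq_trans by blast

lemma even_type_cong: "even_type f \<Longrightarrow> (\<And>x. x \<in> S3 \<Longrightarrow> f x = g x) \<Longrightarrow> even_type g"
  unfolding even_type_def by (metis (no_types, lifting) heq_cong)

lemma even_type_continuous: "even_type f \<Longrightarrow> continuous_on S3 f"
  unfolding even_type_def using heq_continuous by blast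

lemma even_type_S3: "even_type f \<Longrightarrow> x \<in> S3 \<Longrightarrow> f x \<in> S3"
  unfolding even_type_def using heq_S3 by blast

lemma even_type_const: "c \<in> S3 \<Longrightarrow> even_type (\<lambda>x. c)"
  by (rule even_typeI[OF heq_refl]) auto

lemma even_type_qmul:
  assumes "even_type f" "even_type g"
  shows "even_type (\<lambda>x. f x \<otimes>\<^sub>q g x)"
proof -
  obtain e where e: "f \<simeq> e" "\<And>x. x \<in> S3 \<Longrightarrow> e (-x) = e x" using even_typeE[OF assms(1)] by blast
  obtain d where d: "g \<simeq> d" "\<And>x. x \<in> S3 \<Longrightarrow> d (-x) = d x" using even_typeE[OF assms(2)] by blast
  show ?thesis by (rule even_typeI[OF heq_qmul[OF e(1) d(1)]]) (simp add: e d del: mem_sphere_0)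
qed

lemma even_type_qcnj:
  assumes "even_type f" shows "even_type (\<lambda>x. qcnj (f x))"
proof -
  obtain e where e: "f \<simeq> e" "\<And>x. x \<in> S3 \<Longrightarrow> e (-x) = e x" using even_typeE[OF assms(1)] by blast
  show ?thesis by (rule even_typeI[OF heq_qcnj[OF e(1)]]) (simp add: e del: mem_sphere_0)
qed

lemma even_type_compose_left:
  assumes "even_type f" "continuous_on S3 g" "\<And>x. x \<in> S3 \<Longrightarrow> g x \<in> S3"
  shows "even_type (\<lambda>x. g (f x))"
proof -
  obtain e where e: "f \<simeq> e" "\<And>x. x \<in> S3 \<Longrightarrow> e (-x) = e x" using even_typeE[OF assms(1)] by blast
  show ?thesis by (rule even_typeI[OF heq_compose(1)[OF e(1) assms(2,3)]]) (simp_all add: e del: mem_sphere_0)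
qed

lemma even_type_compose_odd:
  assumes "even_type f" "continuous_on S3 g" "\<And>x. x \<in> S3 \<Longrightarrow> g x \<in> S3" "\<And>x. x \<in> S3 \<Longrightarrow> g (-x) = - g x"
  shows "even_type (\<lambda>x. f (g x))"
proof -
  obtain e where e: "f \<simeq> e" "\<And>x. x \<in> S3 \<Longrightarrow> e (-x) = e x" using even_typeE[OF assms(1)] by blast
  show ?thesis
  proof (rule even_typeI[OF heq_compose(2)[OF e(1) assms(2,3)]])
    fix x assume x: "x \<in> S3"
    show "e (g (- x)) = e (g x)" using e(2)[OF assms(3)[OF x]] assms(4)[OF x] by simp
  qed
qed

section \<open>Maps invariant under a sign change of one coordinate\<close>

abbreviation swap2 :: "c2 \<Rightarrow> c2" where "swap2 x \<equiv> (snd x, fst x)"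

lemma swap2_S3: "x \<in> S3 \<Longrightarrow> swap2 x \<in> S3"
  unfolding mem_S3_iff by simp

lemma continuous_on_swap2: "continuous_on A swap2"
  by (intro continuous_intros)

text \<open>Doubles the argument of the second coordinate and keeps its modulus: the quotient map of
  the 3-sphere by \<open>(p, q) \<mapsto> (p, -q)\<close>, whose target is again a 3-sphere.\<close>

definition sq2 :: "c2 \<Rightarrow> c2" where
  "sq2 x = (fst x, snd x * sgn (snd x))"

lemma continuous_on_mult_sgn: "continuous_on A (\<lambda>z::complex. z * sgn z)"
proof -
  have "isCont (\<lambda>z::complex. z * sgn z) z" for z
  proof (cases "z = 0")
    case True
    have "((\<lambda>z::complex. z * sgn z) \<longlongrightarrow> 0) (at 0)"
    proof (rule Lim_null_comparison)
      show "\<forall>\<^sub>F z in at 0. norm (z * sgn z :: complex) \<le> norm z"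
        by (intro always_eventually allI) (simp add: norm_mult norm_sgn)
    qed (auto intro!: tendsto_eq_intros)
    then show ?thesis using True by (simp add: isCont_def)
  qed (auto intro!: continuous_intros)
  then show ?thesis by (simp add: continuous_at_imp_continuous_on)
qed

lemma continuous_on_sq2: "continuous_on A sq2"
  unfolding sq2_def
  by (intro continuous_intros continuous_on_compose2[OF continuous_on_mult_sgn[of UNIV]]) auto

lemma norm_mult_sgn: "cmod (z * sgn z) = cmod z"
  by (simp add: norm_mult norm_sgn)

lemma sq2_S3: "x \<in> S3 \<Longrightarrow> sq2 x \<in> S3"
  unfolding mem_S3_iff sq2_def by (simp add: norm_mult_sgn)

text \<open>The degree-two map \<open>(p, q) \<mapsto> (q\<^sup>2, p)\<close> deforms to the quaternion squaring map, which is even.\<close>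

lemma even_type_sq2: "even_type sq2"
proof -
  \<comment> \<open>At time 0 this is the quaternion square of \<open>(q, p)\<close>, that is
    \<open>(q^2 - |p|^2, 2 Re q p)\<close>, with the second coordinate turned by -i. The turn places
    the two terms of the coefficient of p on the real and the imaginary axis, so that they cannot
    cancel each other.\<close>
  define h :: "real \<times> c2 \<Rightarrow> c2" where
    "h z = (let t = complex_of_real (fst z); p = fst (snd z); q = snd (snd z)
            in (q\<^sup>2 - (1 - t) * (of_real (cmod p))\<^sup>2, (t - 2 * \<i> * (1 - t) * of_real (Re q)) * p))" for z
  define e where "e x = h (0, x)" for x
  have hcont: "continuous_on A h" for A
    unfolding h_def Let_def by (intro continuous_intros)
  have hnz: "h (t, x) \<noteq> 0" if t: "t \<in> {0..1}" and x: "x \<in> S3" for t x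
  proof
    assume h0: "h (t, x) = 0"
    obtain p q where pq: "x = (p, q)" by (cases x)
    have 1: "q\<^sup>2 = (1 - of_real t) * (of_real (cmod p))\<^sup>2"
      and 2: "p = 0 \<or> of_real t - 2 * \<i> * (1 - of_real t) * of_real (Re q) = 0"
      using h0 by (auto simp: h_def pq Let_def zero_prod_def)
    show False
    proof (cases "p = 0")
      case True
      with 1 have "q = 0" by simp
      with True x pq show False by simp
    next
      case False
      then have "of_real t - 2 * \<i> * (1 - of_real t) * of_real (Re q) = 0" using 2 by blast
      then have "t = 0" "(1 - t) * Re q = 0" by (auto simp: complex_eq_iff)
      then have t0: "t = 0" "Re q = 0" by auto
      have "Re (q\<^sup>2) = (cmod p)\<^sup>2" using 1 t0 by (simp flip: of_real_power)
      then have "- (Im q)\<^sup>2 = (cmod p)\<^sup>2" using t0 by (simp add: power2_eq_square)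
      then have "(cmod p)\<^sup>2 \<le> 0" by (metis neg_le_0_iff_le zero_le_power2)
      then show False using False by simp
    qed
  qed
  have A: "(\<lambda>x. e x /\<^sub>R norm (e x)) \<simeq> (\<lambda>x. h (1, x) /\<^sub>R norm (h (1, x)))"
    by (rule heq_normalize[of h]) (use hnz hcont e_def in auto)
  have h1: "h (1, x) = ((snd x)\<^sup>2, fst x)" for x by (simp add: h_def)
  have B: "(\<lambda>x. h (1, x) /\<^sub>R norm (h (1, x))) \<simeq> (\<lambda>x. swap2 (sq2 x))"
  proof (rule heq_close)
    show "continuous_on S3 (\<lambda>x. h (1, x) /\<^sub>R norm (h (1, x)))"
      using heq_continuous(2)[OF A] .
    show "h (1, x) /\<^sub>R norm (h (1, x)) \<in> S3" if "x \<in> S3" for x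
      using heq_S3(2)[OF A that] .
    show "continuous_on S3 (\<lambda>x. swap2 (sq2 x))"
      by (intro continuous_intros continuous_on_sq2)
    show "swap2 (sq2 x) \<in> S3" if "x \<in> S3" for x
      using swap2_S3[OF sq2_S3[OF that]] .
    fix x :: c2 assume x: "x \<in> S3"
    show "swap2 (sq2 x) \<noteq> - (h (1, x) /\<^sub>R norm (h (1, x)))"
    proof
      assume eq: "swap2 (sq2 x) = - (h (1, x) /\<^sub>R norm (h (1, x)))"
      define c where "c = inverse (norm (h (1, x)))"
      have c: "c > 0" using hnz[of 1 x] x by (simp add: c_def)
      have p: "fst x = - (c *\<^sub>R fst x)" and q: "snd x * sgn (snd x) = - (c *\<^sub>R (snd x)\<^sup>2)"
        using eq by (auto simp: sq2_def h1 c_def prod_eq_iff)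
      from p have "(1 + c) *\<^sub>R fst x = 0"
        by (metis add.right_inverse scaleR_left.add scaleR_one add.commute neg_eq_iff_add_eq_0)
      then have p0: "fst x = 0" using c by simp
      have "snd x = 0"
      proof (rule ccontr)
        assume nz: "snd x \<noteq> 0"
        have "(snd x)\<^sup>2 * of_real (inverse (cmod (snd x)) + c) = 0"
          using q by (simp add: sgn_eq scaleR_conv_of_real field_simps power2_eq_square)
        then have "inverse (cmod (snd x)) + c = 0"
          using nz by (simp only: mult_eq_0_iff of_real_eq_0_iff power_eq_0_iff) simp
        then show False using c nz by (smt (verit) positive_imp_inverse_positive zero_less_norm_iff)
      qed
      then have "x = 0" using p0 by (simp add: prod_eq_iff)
      with x show False by simp
    qed
  qed
  have "even_type (\<lambda>x. swap2 (sq2 x))"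
  proof (rule even_typeI[OF heq_sym[OF heq_trans[OF A B]]])
    fix x show "e (- x) /\<^sub>R norm (e (- x)) = e x /\<^sub>R norm (e x)"
      by (simp add: e_def h_def Let_def)
  qed
  then have "even_type (\<lambda>x. swap2 (swap2 (sq2 x)))"
    by (rule even_type_compose_left) (use continuous_on_swap2 swap2_S3 in auto)
  then show ?thesis by simp
qed

text \<open>By invariance \<open>F\<close> factors through \<open>sq2\<close>, and whatever is
  composed after a map of even type is of even type.\<close>

lemma even_type_invariant_snd:
  assumes F: "continuous_on S3 F" "\<And>x. x \<in> S3 \<Longrightarrow> F x \<in> S3"
    and inv: "\<And>p q. (p, q) \<in> S3 \<Longrightarrow> F (p, -q) = F (p, q)"
  shows "even_type F"
proof -
  define G where "G y = F (fst y, csqrt (snd y * of_real (cmod (snd y))))" for y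
  have Gsq: "G (sq2 x) = F x" if x: "x \<in> S3" for x
  proof -
    obtain p q where pq: "x = (p, q)" by (cases x)
    have "q * sgn q * of_real (cmod (q * sgn q)) = q\<^sup>2"
      unfolding norm_mult_sgn by (simp add: sgn_eq power2_eq_square)
    moreover have "csqrt (q\<^sup>2) = q \<or> csqrt (q\<^sup>2) = - q"
      using power2_csqrt[of "q\<^sup>2"] by (metis power2_eq_iff)
    ultimately show ?thesis
      using inv[of p q] x by (auto simp: G_def sq2_def pq)
  qed
  have surj: "\<exists>x\<in>S3. sq2 x = y" if y: "y \<in> S3" for y
  proof -
    define q where "q = csqrt (snd y * of_real (cmod (snd y)))"
    have q2: "q\<^sup>2 = snd y * of_real (cmod (snd y))" by (simp add: q_def)
    then have "cmod (q\<^sup>2) = cmod (snd y * of_real (cmod (snd y)))" by simp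
    then have "(cmod q)\<^sup>2 = (cmod (snd y))\<^sup>2"
      by (simp add: norm_mult norm_power power2_eq_square)
    then have nq: "cmod q = cmod (snd y)" by simp
    have "q * sgn q = snd y"
    proof (cases "snd y = 0")
      case False
      then show ?thesis using q2 nq by (simp add: sgn_eq power2_eq_square)
    qed (use nq in auto)
    then have "sq2 (fst y, q) = y" by (simp add: sq2_def)
    moreover have "(fst y, q) \<in> S3" using y nq unfolding mem_S3_iff by simp
    ultimately show ?thesis by blast
  qed
  \<comment> \<open>\<open>csqrt\<close> jumps, so continuity is not read off the formula for
    \<open>G\<close>. Preimages of closed sets are images of compact sets under
    \<open>sq2\<close>.\<close>
  have "continuous_on S3 G"
    unfolding continuous_on_closed_vimage[OF closed_sphere]
  proof (intro allI impI)
    fix B :: "c2 set" assume B: "closed B"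
    have "G -` B \<inter> S3 = sq2 ` (S3 \<inter> F -` B)"
    proof (intro equalityI subsetI)
      fix y assume y: "y \<in> G -` B \<inter> S3"
      then obtain x where x: "x \<in> S3" "sq2 x = y" using surj by blast
      then have "F x \<in> B" using y Gsq[OF x(1)] by simp
      then show "y \<in> sq2 ` (S3 \<inter> F -` B)" using x by blast
    next
      fix y assume "y \<in> sq2 ` (S3 \<inter> F -` B)"
      then obtain x where x: "x \<in> S3" "F x \<in> B" "y = sq2 x" by blast
      then show "y \<in> G -` B \<inter> S3" using Gsq[OF x(1)] sq2_S3[OF x(1)] by simp
    qed
    moreover have "closed (S3 \<inter> F -` B)"
      by (rule continuous_closed_preimage[OF F(1) closed_sphere B])
    then have "compact (S3 \<inter> F -` B)"
      using bounded_subset[OF bounded_sphere inf_le1] compact_eq_bounded_closed by blast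
    ultimately show "closed (G -` B \<inter> S3)"
      by (simp add: compact_imp_closed compact_continuous_image continuous_on_sq2)
  qed
  moreover have "G y \<in> S3" if "y \<in> S3" for y using surj[OF that] Gsq F(2) by metis
  ultimately have "even_type (\<lambda>x. G (sq2 x))" by (intro even_type_compose_left[OF even_type_sq2])
  then show ?thesis by (rule even_type_cong) (rule Gsq)
qed

lemma even_type_invariant_fst:
  assumes F: "continuous_on S3 F" "\<And>x. x \<in> S3 \<Longrightarrow> F x \<in> S3"
    and inv: "\<And>p q. (p, q) \<in> S3 \<Longrightarrow> F (-p, q) = F (p, q)"
  shows "even_type F"
proof -
  have "even_type (\<lambda>x. F (swap2 x))"
  proof (rule even_type_invariant_snd)
    show "continuous_on S3 (\<lambda>x. F (swap2 x))"
      by (rule continuous_on_compose2[OF F(1) continuous_on_swap2]) (use swap2_S3 in auto)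
    show "F (swap2 x) \<in> S3" if "x \<in> S3" for x using F(2)[OF swap2_S3[OF that]] .
    show "F (swap2 (p, - q)) = F (swap2 (p, q))" if "(p, q) \<in> S3" for p q
      using inv[of q p] swap2_S3[OF that] by simp
  qed
  then have "even_type (\<lambda>x. F (swap2 (swap2 x)))"
    by (rule even_type_compose_odd) (use continuous_on_swap2 swap2_S3 in auto)
  then show ?thesis by simp
qed

section \<open>Lifting through the Hopf map\<close>

type_synonym j3 = "real \<times> complex"

definition hopf :: "c2 \<Rightarrow> j3" where
  "hopf x = ((cmod (fst x))\<^sup>2 - (cmod (snd x))\<^sup>2, 2 * cnj (fst x) * snd x)"

lemma norm_j3_sq: "(norm (j::j3))\<^sup>2 = (fst j)\<^sup>2 + (cmod (snd j))\<^sup>2"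
  by (simp add: norm_prod_def)

lemma norm_hopf: "norm (hopf x) = (norm x)\<^sup>2"
proof -
  have "(norm (hopf x))\<^sup>2 = ((norm x)\<^sup>2)\<^sup>2"
    unfolding norm_j3_sq norm_c2_sq hopf_def fst_conv snd_conv norm_mult
    by (simp add: power2_eq_square algebra_simps)
  then show ?thesis by (rule power2_eq_imp_eq) auto
qed

lemma norm_hopf_S3: "x \<in> S3 \<Longrightarrow> norm (hopf x) = 1"
  by (simp add: norm_hopf)

text \<open>Twice the orthogonal projection of \<open>\<complex>\<^sup>2\<close> to the complex line with Hopf image \<open>j\<close>.\<close>

definition line_proj :: "j3 \<Rightarrow> c2 \<Rightarrow> c2" where
  "line_proj j x = ((1 + of_real (fst j)) * fst x + cnj (snd j) * snd x,
                    snd j * fst x + (1 - of_real (fst j)) * snd x)"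

lemma inner_line_proj: "x \<bullet> line_proj j x = (norm x)\<^sup>2 + j \<bullet> hopf x"
  unfolding norm_c2_sq cmod_sq line_proj_def hopf_def
  by (simp add: inner_prod_def inner_complex_def algebra_simps power2_eq_square)

lemma hopf_line_proj:
  assumes "norm j = 1"
  shows "hopf (line_proj j x) = (2 * ((norm x)\<^sup>2 + j \<bullet> hopf x)) *\<^sub>R j"
proof -
  obtain X a b where j: "j = (X, Complex a b)" by (metis complex.exhaust prod.exhaust)
  obtain p1 p2 q1 q2 where x: "x = (Complex p1 p2, Complex q1 q2)"
    by (metis complex.exhaust prod.exhaust)
  have "(norm j)\<^sup>2 = 1" using assms by simp
  then have "X\<^sup>2 + (a\<^sup>2 + b\<^sup>2) = 1" unfolding norm_j3_sq cmod_sq j by simp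
  then have e: "b * b = 1 - X * X - a * a" by (simp add: power2_eq_square)
  have e2: "b * (b * z) = (1 - X * X - a * a) * z" for z by (simp add: e flip: mult.assoc)
  show ?thesis
    unfolding norm_c2_sq cmod_sq hopf_def line_proj_def
    by (simp add: j x prod_eq_iff complex_eq_iff inner_prod_def inner_complex_def power2_eq_square)
       (simp add: algebra_simps e e2)
qed

lemma continuous_on_line_proj [continuous_intros]:
  "continuous_on S f \<Longrightarrow> continuous_on S g \<Longrightarrow> continuous_on S (\<lambda>x. line_proj (f x) (g x))"
  unfolding line_proj_def by (intro continuous_intros)

lemma hopf_scaleR: "hopf (c *\<^sub>R x) = c\<^sup>2 *\<^sub>R hopf x"
  by (simp add: hopf_def power_mult_distrib power2_eq_square algebra_simps)

lemma inner_unit_gt: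
  fixes a b :: "'a::real_inner"
  assumes "norm a = 1" "norm b = 1" "a \<noteq> - b"
  shows "1 + a \<bullet> b > 0"
proof -
  have "0 < (norm (a + b))\<^sup>2" using assms(3) by (simp add: eq_neg_iff_add_eq_0)
  also have "\<dots> = 2 * (1 + a \<bullet> b)"
    using assms by (simp add: power2_norm_eq_inner inner_add inner_commute norm_eq_1)
  finally show ?thesis by simp
qed

definition lift_step :: "j3 \<Rightarrow> c2 \<Rightarrow> c2" where
  "lift_step j x = line_proj j x /\<^sub>R norm (line_proj j x)"

text \<open>The projection of x to the line over \<open>j\<close> vanishes only if x is orthogonal
  to that line, hence only if its Hopf image is antipodal to \<open>j\<close>. This is an explicit
  lift over short steps, and it fixes x when nothing moves.\<close>

lemma lift_step:
  assumes j: "norm j = 1" and x: "x \<in> S3" and ne: "j \<noteq> - hopf x"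
  shows "line_proj j x \<noteq> 0" "lift_step j x \<in> S3" "hopf (lift_step j x) = j"
    "hopf x = j \<Longrightarrow> lift_step j x = x"
proof -
  have pos: "1 + j \<bullet> hopf x > 0" using inner_unit_gt[OF j norm_hopf_S3[OF x] ne] .
  have ip: "x \<bullet> line_proj j x = 1 + j \<bullet> hopf x" using x by (simp add: inner_line_proj)
  show nz: "line_proj j x \<noteq> 0" using ip pos by auto
  show "lift_step j x \<in> S3" using nz by (simp add: lift_step_def)
  have h: "hopf (line_proj j x) = (2 * (1 + j \<bullet> hopf x)) *\<^sub>R j"
    using hopf_line_proj[OF j, of x] x by simp
  then have n: "(norm (line_proj j x))\<^sup>2 = 2 * (1 + j \<bullet> hopf x)"
    using norm_hopf[of "line_proj j x"] j pos by simp
  show "hopf (lift_step j x) = j"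
    unfolding lift_step_def hopf_scaleR h using n pos by (simp add: power_inverse)
  assume hx: "hopf x = j"
  have jj: "j \<bullet> j = 1" using j by (simp add: dot_square_norm)
  have "(norm (line_proj j x - 2 *\<^sub>R x))\<^sup>2 = (norm (line_proj j x))\<^sup>2 - 4 * (x \<bullet> line_proj j x) + 4 * (norm x)\<^sup>2"
    by (simp add: power2_norm_eq_inner inner_diff inner_commute algebra_simps)
  also have "\<dots> = 0" using n ip x hx jj by simp
  finally have "line_proj j x = 2 *\<^sub>R x" by simp
  then show "lift_step j x = x" using x by (simp add: lift_step_def)
qed

lemma hopf_surj:
  assumes "norm j = 1" obtains x where "x \<in> S3" "hopf x = j"
proof (cases "j = - hopf (1,0)")
  case True
  have "(0,1) \<in> S3" unfolding mem_S3_iff by simp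
  moreover have "hopf (0,1) = j" using True by (simp add: hopf_def)
  ultimately show ?thesis using that by blast
next
  case False
  then show ?thesis using lift_step[OF assms one_S3 False] that by blast
qed

text \<open>Time is cut into steps during which \<open>F\<close> never reaches an antipode, and
  \<open>lift_step\<close> is applied in each of them. The last conclusion, that stationary points
  keep their lift, serves to identify the start of a lifted homotopy.\<close>

lemma hopf_homotopy_lift:
  fixes F :: "real \<times> 'a::metric_space \<Rightarrow> j3"
  assumes S: "compact S" and F: "continuous_on ({0..1} \<times> S) F"
    and F1: "\<And>t x. t \<in> {0..1} \<Longrightarrow> x \<in> S \<Longrightarrow> norm (F (t, x)) = 1"
    and p: "continuous_on S p" "\<And>x. x \<in> S \<Longrightarrow> p x \<in> S3" "\<And>x. x \<in> S \<Longrightarrow> hopf (p x) = F (0, x)"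
  obtains q where "continuous_on S q" "\<And>x. x \<in> S \<Longrightarrow> q x \<in> S3" "\<And>x. x \<in> S \<Longrightarrow> hopf (q x) = F (1, x)"
    "\<And>x. x \<in> S \<Longrightarrow> (\<And>t. t \<in> {0..1} \<Longrightarrow> F (t, x) = F (0, x)) \<Longrightarrow> q x = p x"
proof -
  have "uniformly_continuous_on ({0..1} \<times> S) F"
    by (intro compact_uniformly_continuous F compact_Times S compact_Icc)
  \<comment> \<open>2 is the distance between antipodal points of the unit sphere.\<close>
  then obtain d where d: "d > 0" "\<And>z z'. z \<in> {0..1} \<times> S \<Longrightarrow> z' \<in> {0..1} \<times> S \<Longrightarrow> dist z' z < d \<Longrightarrow> dist (F z') (F z) < 2"
    unfolding uniformly_continuous_on_def by (metis zero_less_numeral)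
  obtain N :: nat where N: "N > 0" "inverse (real N) < d"
    using d(1) by (metis ex_inverse_of_nat_less)
  define R where "R k q \<longleftrightarrow> continuous_on S q \<and> (\<forall>x\<in>S. q x \<in> S3 \<and> hopf (q x) = F (real k / real N, x) \<and>
     ((\<forall>t\<in>{0..1}. F (t, x) = F (0, x)) \<longrightarrow> q x = p x))" for k q
  have "\<exists>q. R k q" if "k \<le> N" for k
    using that
  proof (induction k)
    case 0
    then show ?case using p by (auto simp: R_def intro!: exI[of _ p])
  next
    case (Suc k)
    then obtain q where q: "R k q" by auto
    define u where "u = real k / real N"
    define v where "v = real (Suc k) / real N"
    have uv: "u \<in> {0..1}" "v \<in> {0..1}" using Suc.prems N by (auto simp: u_def v_def field_simps)
    have dist: "dist v u < d"
      using N by (simp add: u_def v_def dist_real_def field_simps)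
    have Fuv: "F (v, x) \<noteq> - F (u, x)" if x: "x \<in> S" for x
    proof
      assume "F (v, x) = - F (u, x)"
      then have "dist (F (v, x)) (F (u, x)) = norm ((-2) *\<^sub>R F (u, x))"
        by (simp add: dist_norm algebra_simps scaleR_2)
      then have "dist (F (v, x)) (F (u, x)) = 2" using F1[OF uv(1) x] by simp
      moreover have "dist (F (v, x)) (F (u, x)) < 2"
        by (rule d(2)) (use uv x dist in \<open>auto simp: dist_Pair_Pair\<close>)
      ultimately show False by simp
    qed
    have qc: "continuous_on S q" and qS: "\<And>x. x \<in> S \<Longrightarrow> q x \<in> S3"
      and qh: "\<And>x. x \<in> S \<Longrightarrow> hopf (q x) = F (u, x)"
      and qp: "\<And>x. x \<in> S \<Longrightarrow> (\<forall>t\<in>{0..1}. F (t, x) = F (0, x)) \<Longrightarrow> q x = p x"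
      using q unfolding R_def u_def by blast+
    define r where "r x = lift_step (F (v, x)) (q x)" for x
    have step: "line_proj (F (v, x)) (q x) \<noteq> 0" "r x \<in> S3" "hopf (r x) = F (v, x)"
      "F (u, x) = F (v, x) \<Longrightarrow> r x = q x" if x: "x \<in> S" for x
      using lift_step[OF F1[OF uv(2) x] qS[OF x]] Fuv[OF x] qh[OF x] unfolding r_def by auto
    have Fv: "continuous_on S (\<lambda>x. F (v, x))"
      by (rule continuous_on_compose2[OF F]) (use uv in \<open>auto intro!: continuous_intros\<close>)
    have "continuous_on S r"
      unfolding r_def lift_step_def by (intro continuous_intros Fv qc) (use step in auto)
    moreover have "r x = p x" if "x \<in> S" "\<forall>t\<in>{0..1}. F (t, x) = F (0, x)" for x
    proof -
      have "F (u, x) = F (v, x)" using that(2) uv by metis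
      then show ?thesis using step(4)[OF that(1)] qp[OF that] by simp
    qed
    ultimately have "R (Suc k) r"
      unfolding R_def v_def[symmetric] using step(2,3) by blast
    then show ?case by blast
  qed
  then obtain q where "R N q" by blast
  moreover have "real N / real N = 1" using N by simp
  ultimately show thesis unfolding R_def by (intro that[of q]) metis+
qed

section \<open>Lifts of nowhere vanishing maps and their uniqueness up to homotopy\<close>

definition lifts :: "(c2 \<Rightarrow> j3) \<Rightarrow> (c2 \<Rightarrow> c2) \<Rightarrow> bool" where
  "lifts f p \<longleftrightarrow> continuous_on S3 p \<and> (\<forall>x\<in>S3. p x \<in> S3 \<and> hopf (p x) = sgn (f x))"

text \<open>\<open>hopf_homotopy_lift\<close> returns only a lift at time 1. Applied over the
  compact base \<open>{0..1} \<times> S3\<close> to the slowed homotopy \<open>F (s * t, x)\<close>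
  it returns the whole homotopy of lifts; for t = 0 nothing moves, so this homotopy starts at
  \<open>p\<close>.\<close>

lemma lifts_homotopy:
  fixes F :: "real \<times> c2 \<Rightarrow> j3"
  assumes F: "continuous_on ({0..1} \<times> S3) F" "\<And>t x. t \<in> {0..1} \<Longrightarrow> x \<in> S3 \<Longrightarrow> F (t, x) \<noteq> 0"
    and p: "lifts (\<lambda>x. F (0, x)) p"
  obtains q where "p \<simeq> q" "lifts (\<lambda>x. F (1, x)) q"
proof -
  define G where "G = (\<lambda>(s::real, t::real, x::c2). sgn (F (s * t, x)))"
  have mult: "s * t \<in> {0..1}" if "s \<in> {0..1}" "t \<in> {0..1}" for s t :: real
    using that by (auto intro: mult_le_one)
  have Gc: "continuous_on ({0..1} \<times> ({0..1} \<times> S3)) G"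
    unfolding G_def case_prod_beta
    by (intro continuous_intros continuous_on_compose2[OF F(1)]) (use mult F(2) in auto)
  have G1: "norm (G (s, z)) = 1" if "s \<in> {0..1}" "z \<in> {0..1} \<times> S3" for s z
    using that mult F(2) by (auto simp: G_def norm_sgn)
  have pc: "continuous_on S3 p" and pS: "\<And>x. x \<in> S3 \<Longrightarrow> p x \<in> S3"
    and ph: "\<And>x. x \<in> S3 \<Longrightarrow> hopf (p x) = sgn (F (0, x))"
    using p by (auto simp: lifts_def simp del: mem_sphere_0)
  have pc2: "continuous_on ({0..1::real} \<times> S3) (\<lambda>z. p (snd z))"
    by (rule continuous_on_compose2[OF pc]) (auto intro: continuous_intros)
  have cpt: "compact ({0..1::real} \<times> S3)" by (intro compact_Times) auto
  have p2: "p (snd z) \<in> S3" "hopf (p (snd z)) = G (0, z)" if "z \<in> {0..1::real} \<times> S3" for z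
    using that pS ph by (auto simp: G_def case_prod_beta simp del: mem_sphere_0)
  obtain q where q: "continuous_on ({0..1::real} \<times> S3) q"
    "\<And>z. z \<in> {0..1} \<times> S3 \<Longrightarrow> q z \<in> S3" "\<And>z. z \<in> {0..1} \<times> S3 \<Longrightarrow> hopf (q z) = G (1, z)"
    "\<And>z. z \<in> {0..1} \<times> S3 \<Longrightarrow> (\<And>t. t \<in> {0..1} \<Longrightarrow> G (t, z) = G (0, z)) \<Longrightarrow> q z = p (snd z)"
    using hopf_homotopy_lift[OF cpt Gc G1 pc2 p2] by blast
  have q0: "q (0, x) = p x" if "x \<in> S3" for x
    using q(4)[of "(0, x)"] that by (simp add: G_def del: mem_sphere_0)
  have "p \<simeq> (\<lambda>x. q (1, x))"
    by (rule heqI[of q]) (use q q0 in \<open>auto simp del: mem_sphere_0\<close>)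
  moreover have "lifts (\<lambda>x. F (1, x)) (\<lambda>x. q (1, x))"
    unfolding lifts_def using q(2,3) heq_continuous(2)[OF calculation]
    by (auto simp: G_def simp del: mem_sphere_0)
  ultimately show thesis using that by blast
qed

lemma hopf_qmul_circle:
  "cmod u = 1 \<Longrightarrow> hopf (x \<otimes>\<^sub>q (u, 0)) = hopf x"
proof -
  assume "cmod u = 1"
  then have "cnj u * u = 1" by (metis complex_norm_square mult.commute of_real_1 one_power2)
  then have "cnj u * (u * z) = z" for z by (simp flip: mult.assoc)
  then show ?thesis using \<open>cmod u = 1\<close>
    by (simp add: hopf_def qmul_def norm_mult algebra_simps)
qed

text \<open>Twice the squared modulus of the determinant of x and y is
  \<open>|x|^2 |y|^2 - hopf x \<bullet> hopf y\<close>, so equal Hopf images force linear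
  dependence. The determinant is the second coordinate of
  \<open>qcnj x \<otimes>\<^sub>q y\<close>.\<close>

lemma hopf_eq_imp:
  assumes "x \<in> S3" "y \<in> S3" "hopf x = hopf y"
  shows "snd (qcnj x \<otimes>\<^sub>q y) = 0"
proof -
  let ?d = "fst x * snd y - snd x * fst y"
  have "2 * (cmod ?d)\<^sup>2 = (norm x)\<^sup>2 * (norm y)\<^sup>2 - hopf x \<bullet> hopf y"
    unfolding norm_c2_sq cmod_sq hopf_def
    by (simp add: inner_prod_def inner_complex_def algebra_simps power2_eq_square)
  also have "\<dots> = 0" using assms norm_hopf_S3[of y] by (simp add: dot_square_norm)
  finally have "?d = 0" by simp
  then show ?thesis by (simp add: qmul_def qcnj_def algebra_simps)
qed

text \<open>Since the 3-sphere is simply connected, \<open>u\<close> has a continuous logarithm; it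
  is purely imaginary and can be shrunk to 0.\<close>

lemma circle_map_heq_const:
  assumes u: "continuous_on S3 u" "\<And>x. x \<in> S3 \<Longrightarrow> cmod (u x) = 1"
  shows "(\<lambda>x. (u x, 0)) \<simeq> (\<lambda>x. (1, 0))"
proof -
  have "DIM(c2) = 4" by simp
  then have "simply_connected S3" by (intro simply_connected_sphere) simp
  moreover have "locally path_connected S3" by (rule locally_path_connected_sphere)
  ultimately obtain g where g: "continuous_on S3 g" "\<And>x. x \<in> S3 \<Longrightarrow> u x = exp (g x)"
    using continuous_logarithm_on_simply_connected[OF u(1)] u(2) by (metis norm_zero zero_neq_one)
  have re: "Re (g x) = 0" if "x \<in> S3" for x
    using u(2)[OF that] g(2)[OF that] by simp
  show ?thesis
  proof (rule heqI[of "\<lambda>z. (exp ((1 - of_real (fst z)) * g (snd z)), 0)"])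
    show "continuous_on ({0..1} \<times> S3) (\<lambda>z. (exp ((1 - complex_of_real (fst z)) * g (snd z)), 0::complex))"
      by (intro continuous_intros continuous_on_compose2[OF g(1)]) auto
    show "(exp ((1 - complex_of_real (fst (t, x))) * g (snd (t, x))), 0) \<in> S3" if "t \<in> {0..1}" "x \<in> S3" for t x
      unfolding mem_S3_iff using re[OF that(2)] by simp
  qed (use g in auto)
qed

text \<open>Two lifts differ by right multiplication with a circle-valued map, which is
  null-homotopic. Hence one lift of even type makes all lifts of even type.\<close>

lemma lifts_unique:
  assumes "lifts f p" "lifts f q"
  shows "p \<simeq> q"
proof -
  have pc: "continuous_on S3 p" "continuous_on S3 q" and pS: "p x \<in> S3" "q x \<in> S3"
    and h: "hopf (p x) = hopf (q x)" if "x \<in> S3" for x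
    using assms that by (auto simp: lifts_def simp del: mem_sphere_0)
  then have pc: "continuous_on S3 p" "continuous_on S3 q" using one_S3 by blast+
  define u where "u x = fst (qcnj (p x) \<otimes>\<^sub>q q x)" for x
  have eq: "qcnj (p x) \<otimes>\<^sub>q q x = (u x, 0)" if "x \<in> S3" for x
    using hopf_eq_imp[OF pS[OF that] h[OF that]] by (simp add: u_def prod_eq_iff)
  have n: "norm (qcnj (p x) \<otimes>\<^sub>q q x) = 1" if "x \<in> S3" for x using pS[OF that] by (simp add: norm_qmul)
  have "(\<lambda>x. (u x, 0)) \<simeq> (\<lambda>x. (1, 0))"
  proof (rule circle_map_heq_const)
    show "continuous_on S3 u" unfolding u_def by (intro continuous_intros pc)
    show "cmod (u x) = 1" if "x \<in> S3" for x using n[OF that] unfolding eq[OF that] by (simp add: norm_prod_def)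
  qed
  moreover have "p \<simeq> p" by (rule heq_refl) (use pc pS in auto)
  ultimately have "(\<lambda>x. p x \<otimes>\<^sub>q (u x, 0)) \<simeq> (\<lambda>x. p x \<otimes>\<^sub>q (1, 0))" by (intro heq_qmul)
  then have "q \<simeq> p"
  proof (rule heq_cong)
    show "p x \<otimes>\<^sub>q (u x, 0) = q x" if "x \<in> S3" for x
      unfolding eq[OF that, symmetric] using qmul_qcnj(1)[OF pS(1)[OF that]] by (simp flip: qmul_assoc)
  qed simp
  then show ?thesis by (rule heq_sym)
qed

definition even_lift :: "(c2 \<Rightarrow> j3) \<Rightarrow> bool" where
  "even_lift f \<longleftrightarrow> (\<exists>p. lifts f p \<and> even_type p)"

lemma even_lift_all: "even_lift f \<Longrightarrow> lifts f p \<Longrightarrow> even_type p"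
  unfolding even_lift_def using lifts_unique even_type_heq by blast

lemma even_lift_homotopy:
  fixes F :: "real \<times> c2 \<Rightarrow> j3"
  assumes F: "continuous_on ({0..1} \<times> S3) F" "\<And>t x. t \<in> {0..1} \<Longrightarrow> x \<in> S3 \<Longrightarrow> F (t, x) \<noteq> 0"
    and ev: "even_lift (\<lambda>x. F (0, x))"
  shows "even_lift (\<lambda>x. F (1, x))"
proof -
  obtain p where p: "lifts (\<lambda>x. F (0, x)) p" "even_type p" using ev by (auto simp: even_lift_def)
  obtain q where "p \<simeq> q" "lifts (\<lambda>x. F (1, x)) q" using lifts_homotopy[OF F p(1)] by blast
  then show ?thesis unfolding even_lift_def using even_type_heq[OF p(2) heq_sym] by blast
qed

section \<open>Lifts of maps that are equivariant on two solid tori\<close>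

definition rot :: "complex \<Rightarrow> c2 \<Rightarrow> c2" where "rot s x = (fst x, s * snd x)"

definition tw :: "complex \<Rightarrow> j3 \<Rightarrow> j3" where "tw s j = (fst j, s * snd j)"

lemma hopf_rot: "cmod s = 1 \<Longrightarrow> hopf (rot s x) = tw s (hopf x)"
  by (simp add: hopf_def rot_def tw_def norm_mult algebra_simps)

lemma rot_S3: "cmod s = 1 \<Longrightarrow> x \<in> S3 \<Longrightarrow> rot s x \<in> S3"
  unfolding mem_S3_iff by (simp add: rot_def norm_mult)

lemma norm_tw: "cmod s = 1 \<Longrightarrow> norm (tw s j) = norm j"
  by (simp add: tw_def norm_prod_def norm_mult)

lemma continuous_on_rot [continuous_intros]:
  "continuous_on S f \<Longrightarrow> continuous_on S g \<Longrightarrow> continuous_on S (\<lambda>x. rot (f x) (g x))"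
  unfolding rot_def by (intro continuous_intros)

lemma hopf_eq_one: "x \<in> S3 \<Longrightarrow> hopf x = (1,0) \<Longrightarrow> snd x = 0"
  unfolding mem_S3_iff by (auto simp: hopf_def)

lemma S3_snd0: "x \<in> S3 \<Longrightarrow> snd x = 0 \<Longrightarrow> cmod (fst x) = 1"
  by (simp add: norm_prod_def)

text \<open>The radial homotopy of the disc starts at a constant map, which has a lift, and ends at
  \<open>a\<close>.\<close>

lemma disc_lift:
  assumes a: "continuous_on (cball 0 1) (a :: complex \<Rightarrow> j3)" "\<And>y. y \<in> cball 0 1 \<Longrightarrow> norm (a y) = 1"
  obtains b where "continuous_on (cball 0 1) b" "\<And>y. y \<in> cball 0 1 \<Longrightarrow> b y \<in> S3"
    "\<And>y. y \<in> cball 0 1 \<Longrightarrow> hopf (b y) = a y"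
proof -
  have "norm (a 0) = 1" using a(2)[of 0] by simp
  then obtain x where x: "x \<in> S3" "hopf x = a 0" by (rule hopf_surj)
  have scale: "t *\<^sub>R y \<in> cball 0 1" if "t \<in> {0..1}" "y \<in> cball 0 1" for t :: real and y :: complex
    using that by (auto simp: mult_le_one)
  have c: "continuous_on ({0..1} \<times> cball 0 1) (\<lambda>z. a (fst z *\<^sub>R snd z))"
    by (rule continuous_on_compose2[OF a(1)]) (use scale in \<open>auto intro!: continuous_intros\<close>)
  have n: "norm (a (fst (t, y) *\<^sub>R snd (t, y))) = 1" if "t \<in> {0..1}" "y \<in> cball 0 1" for t :: real and y
    using a(2)[OF scale[OF that]] by simp
  obtain b where "continuous_on (cball 0 1) b" "\<And>y. y \<in> cball 0 1 \<Longrightarrow> b y \<in> S3"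
    "\<And>y. y \<in> cball 0 1 \<Longrightarrow> hopf (b y) = a (fst (1::real, y) *\<^sub>R snd (1::real, y))"
    by (rule hopf_homotopy_lift[OF compact_cball c n, of "\<lambda>_. x"])
      (use x in \<open>auto simp del: mem_sphere_0\<close>)
  then show thesis using that by simp
qed

text \<open>The loop \<open>t(-y)/t(y)\<close> has winding number zero, hence a logarithm, and half of its odd part is
  subtracted from the phase.\<close>

lemma disc_adjust:
  assumes a: "continuous_on (cball 0 1) a" "\<And>y. y \<in> cball 0 1 \<Longrightarrow> a y \<in> S3"
    "\<And>y. cmod y = 1 \<Longrightarrow> snd (a y) = 0"
  obtains b where "continuous_on (cball 0 1) b" "\<And>y. y \<in> cball 0 1 \<Longrightarrow> b y \<in> S3"
    "\<And>y. y \<in> cball 0 1 \<Longrightarrow> hopf (b y) = hopf (a y)"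
    "\<And>y. cmod y = 1 \<Longrightarrow> snd (b y) = 0" "\<And>y. cmod y = 1 \<Longrightarrow> (fst (b (-y)))\<^sup>2 = (fst (b y))\<^sup>2"
proof -
  define t where "t y = fst (a y)" for y
  have t1: "cmod (t y) = 1" if "cmod y = 1" for y
    unfolding t_def by (rule S3_snd0) (use a(2)[of y] a(3)[OF that] that in auto)
  have tc: "continuous_on (sphere 0 1) t"
    unfolding t_def by (intro continuous_intros continuous_on_subset[OF a(1)]) auto
  \<comment> \<open>Half a turn of the argument joins the constant 1 to the loop
    \<open>t (-y) / t y\<close>.\<close>
  define h where "h z = t (exp (\<i> * of_real (pi * fst z)) * snd z) * cnj (t (snd z))" for z :: "real \<times> complex"
  have "continuous_on ({0..1} \<times> sphere 0 1) h"
    unfolding h_def by (intro continuous_intros continuous_on_compose2[OF tc]) (auto simp: norm_mult)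
  moreover have "cmod (h (s, y)) = 1" if "cmod y = 1" for s y
    using that by (simp add: h_def norm_mult t1)
  ultimately have "homotopic_with_canon (\<lambda>_. True) (sphere 0 1) (sphere 0 1) (\<lambda>y. h (0, y)) (\<lambda>y. h (1, y))"
    unfolding homotopic_with_def by (intro exI[of _ h]) (auto simp: image_subset_iff Pi_iff)
  then have "homotopic_with_canon (\<lambda>_. True) (sphere 0 1) (sphere 0 1) (\<lambda>y. t (-y) * cnj (t y)) (\<lambda>y. 1)"
    by (rule homotopic_with_symD[OF homotopic_with_eq])
      (auto simp: h_def t1 simp flip: complex_norm_square)
  then have "\<exists>g. continuous_on (sphere 0 1) g \<and> (\<forall>y\<in>sphere 0 1. t (-y) * cnj (t y) = exp (\<i> * of_real (g y)))"
    by (intro inessential_eq_continuous_logarithm_circle[THEN iffD1] exI)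
  then obtain g where g: "continuous_on (sphere 0 1) g"
    "\<And>y. cmod y = 1 \<Longrightarrow> t (-y) * cnj (t y) = exp (\<i> * of_real (g y))"
    by auto
  \<comment> \<open>The values of the loop at y and -y are inverse to each other, so
    \<open>g y + g (-y)\<close> is a multiple of 2 pi and \<open>t (-y) / t y\<close> is exp(i
    \<phi>) up to sign. This sign may occur, which is why only the square of the first coordinate is
    made even. As \<phi> is odd, the factor exp(i \<phi> / 2) splits the defect equally between y
    and -y.\<close>
  define \<phi> where "\<phi> y = (g y - g (-y)) / 2" for y
  have "continuous_on (sphere 0 1) \<phi>"
    unfolding \<phi>_def by (intro continuous_intros g(1) continuous_on_compose2[OF g(1)]) auto
  then obtain \<Phi> where \<Phi>: "continuous_on UNIV \<Phi>" "\<And>y. y \<in> sphere 0 1 \<Longrightarrow> \<Phi> y = \<phi> y"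
    using Tietze_unbounded[of "sphere 0 1" \<phi> UNIV] by auto
  define u where "u y = exp (\<i> * of_real (\<Phi> y / 2))" for y
  have u1: "cmod (u y) = 1" for y by (simp add: u_def)
  have uc: "continuous_on A u" for A
    unfolding u_def by (intro continuous_intros continuous_on_subset[OF \<Phi>(1)]) auto
  define b where "b y = a y \<otimes>\<^sub>q (u y, 0)" for y
  have fb: "fst (b y) = t y * u y" "snd (b y) = 0" if "cmod y = 1" for y
    using a(3)[OF that] by (simp_all add: b_def qmul_def t_def)
  show thesis
  proof (rule that[of b])
    show "continuous_on (cball 0 1) b" unfolding b_def by (intro continuous_intros a(1) uc)
    show "b y \<in> S3" if "y \<in> cball 0 1" for y
      unfolding b_def by (rule qmul_S3[OF a(2)[OF that]]) (simp add: mem_S3_iff u1 del: mem_sphere_0)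
    show "hopf (b y) = hopf (a y)" for y by (simp add: b_def hopf_qmul_circle u1)
    fix y :: complex assume y: "cmod y = 1"
    show "snd (b y) = 0" using fb[OF y] by simp
    have tt: "cnj (t y) * t y = 1" using t1[OF y] by (metis complex_norm_square mult.commute of_real_1 one_power2)
    have tt': "cnj (t (-y)) * t (-y) = 1" using t1[of "-y"] y by (metis complex_norm_square mult.commute of_real_1 one_power2 norm_minus_cancel)
    define r where "r = exp (\<i> * of_real (g y))"
    have r: "t (-y) * cnj (t y) = r" "t y * cnj (t (-y)) = exp (\<i> * of_real (g (-y)))"
      using g(2)[OF y] g(2)[of "-y"] y by (auto simp: r_def)
    have ty: "t (-y) = r * t y" using r(1) tt by (metis mult.assoc mult.right_neutral)
    have "r * exp (\<i> * of_real (g (-y))) = 1"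
      unfolding r(1)[symmetric] r(2)[symmetric] using tt tt' by (metis mult.assoc mult.commute mult.left_neutral)
    then have 1: "exp (\<i> * of_real (g (-y))) * r = 1" by (simp add: mult.commute)
    have uu: "(u z)\<^sup>2 = exp (\<i> * of_real (\<Phi> z))" for z
      by (simp add: u_def power2_eq_square flip: exp_add)
    have "\<phi> (-y) = - \<phi> y" unfolding \<phi>_def minus_minus by (metis minus_diff_eq minus_divide_left)
    then have \<Phi>': "\<Phi> y = \<phi> y" "\<Phi> (-y) = - \<phi> y" using \<Phi>(2) y by auto
    have "r\<^sup>2 = exp (\<i> * of_real (g y)) * exp (- (\<i> * of_real (g (-y))))"
      using 1 by (simp add: r_def power2_eq_square exp_minus field_simps)
    also have "\<dots> = exp (\<i> * of_real (2 * \<phi> y))"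
    proof -
      have "2 * \<phi> y = g y - g (-y)" by (simp add: \<phi>_def)
      then show ?thesis by (simp only:) (simp add: algebra_simps flip: exp_add)
    qed
    finally have "r\<^sup>2 * (u (-y))\<^sup>2 = (u y)\<^sup>2"
      by (simp add: uu \<Phi>' algebra_simps flip: exp_add)
    moreover have "fst (b (-y)) = r * t y * u (-y)" "fst (b y) = t y * u y"
      using fb[of y] fb[of "-y"] y ty by simp_all
    ultimately show "(fst (b (-y)))\<^sup>2 = (fst (b y))\<^sup>2"
      by (simp add: power_mult_distrib algebra_simps)
  qed
qed

lemma snd0_eq: "snd x = 0 \<Longrightarrow> x = (fst x, 0)" by (simp add: prod_eq_iff)

lemma conj_circle:
  assumes "snd a = 0" "a \<in> S3"
  shows "a \<otimes>\<^sub>q x \<otimes>\<^sub>q qcnj a = (fst x, cnj ((fst a)\<^sup>2) * snd x)"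
proof -
  have "fst a * cnj (fst a) = 1"
    using assms unfolding mem_S3_iff by (metis complex_norm_square norm_zero of_real_1 add.right_neutral
        power_zero_numeral)
  then have "fst a * (cnj (fst a) * z) = z" for z by (simp flip: mult.assoc)
  then show ?thesis using assms(1)
    by (simp add: qmul_def qcnj_def power2_eq_square algebra_simps)
qed

text \<open>On the torus \<open>\<bar>p\<bar> = \<bar>q\<bar>\<close> the map is constant, so \<open>f\<close> is given by a map of a disc on each of the
  two solid tori.  A lift of \<open>f\<close> is the product of a map invariant under \<open>p \<mapsto> -p\<close>, a map invariant
  under \<open>q \<mapsto> -q\<close> and a null-homotopic map.\<close>

lemma even_lift_normalized:
  fixes f :: "c2 \<Rightarrow> j3" and s :: "complex \<Rightarrow> complex"
  assumes f: "continuous_on S3 f" "\<And>x. x \<in> S3 \<Longrightarrow> norm (f x) = 1"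
    and torus: "\<And>p q. (p, q) \<in> S3 \<Longrightarrow> cmod p = cmod q \<Longrightarrow> f (p, q) = (1, 0)"
    and s: "continuous_on (sphere 0 1) s" "\<And>u. cmod u = 1 \<Longrightarrow> cmod (s u) = 1" "\<And>u. s (-u) = s u"
    and tw1: "\<And>u p q. (p, q) \<in> S3 \<Longrightarrow> cmod u = 1 \<Longrightarrow> cmod q \<le> cmod p \<Longrightarrow> f (u * p, q) = tw (s u) (f (p, q))"
    and tw2: "\<And>u p q. (p, q) \<in> S3 \<Longrightarrow> cmod u = 1 \<Longrightarrow> cmod p \<le> cmod q \<Longrightarrow> f (p, u * q) = tw (s u) (f (p, q))"
  shows "even_lift f"
proof -
  define nr :: "c2 \<Rightarrow> c2" where "nr x = x /\<^sub>R norm x" for x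
  have nrS: "nr x \<in> S3" if "x \<noteq> 0" for x using that by (simp add: nr_def)
  have nr_scale: "nr (c *\<^sub>R v) = v" if "c > 0" "norm v = 1" for c v using that by (simp add: nr_def)
  have nz: "(1, y) \<noteq> (0::c2)" "(y, 1) \<noteq> (0::c2)" for y by (simp_all add: zero_prod_def)
  have nrc: "continuous_on (-{0}) nr" unfolding nr_def by (intro continuous_intros) auto
  have c1: "continuous_on (cball 0 1) (\<lambda>y. f (nr (1, y)))" and c2: "continuous_on (cball 0 1) (\<lambda>y. f (nr (y, 1)))"
    using nrS nz by (auto simp del: mem_sphere_0 intro!: continuous_on_compose2[OF f(1)]
        continuous_on_compose2[OF nrc] continuous_intros)
  obtain a0 where a0: "continuous_on (cball 0 1) a0" "\<And>y. y \<in> cball 0 1 \<Longrightarrow> a0 y \<in> S3"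
    "\<And>y. y \<in> cball 0 1 \<Longrightarrow> hopf (a0 y) = f (nr (1, y))"
    using disc_lift[OF c1] f(2)[OF nrS[OF nz(1)]] by blast
  obtain b0 where b0: "continuous_on (cball 0 1) b0" "\<And>y. y \<in> cball 0 1 \<Longrightarrow> b0 y \<in> S3"
    "\<And>y. y \<in> cball 0 1 \<Longrightarrow> hopf (b0 y) = f (nr (y, 1))"
    using disc_lift[OF c2] f(2)[OF nrS[OF nz(2)]] by blast
  have f1: "f (nr (1, y)) = (1, 0)" "f (nr (y, 1)) = (1, 0)" if "cmod y = 1" for y
    using torus nrS[OF nz(1), of y] nrS[OF nz(2), of y] that by (simp_all add: nr_def del: mem_sphere_0)
  have ab0: "snd (a0 y) = 0" "snd (b0 y) = 0" if "cmod y = 1" for y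
    using hopf_eq_one[OF a0(2)] hopf_eq_one[OF b0(2)] a0(3)[of y] b0(3)[of y] f1[OF that] that by auto
  \<comment> \<open>Conjugation by \<open>a (sgn q)\<close> will occur in \<open>F2\<close> and
    depends only on the square of its first coordinate, so after this adjustment it is the same for
    q and -q.\<close>
  obtain a where a: "continuous_on (cball 0 1) a" "\<And>y. y \<in> cball 0 1 \<Longrightarrow> a y \<in> S3"
    "\<And>y. y \<in> cball 0 1 \<Longrightarrow> hopf (a y) = hopf (a0 y)"
    "\<And>y. cmod y = 1 \<Longrightarrow> snd (a y) = 0" "\<And>y. cmod y = 1 \<Longrightarrow> (fst (a (-y)))\<^sup>2 = (fst (a y))\<^sup>2"
    using disc_adjust[OF a0(1,2) ab0(1)] by blast
  note b = b0(1,2) ab0(2)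
  define P where "P = {x \<in> S3. cmod (snd x) \<le> cmod (fst x)}"
  define Q where "Q = {x \<in> S3. cmod (fst x) \<le> cmod (snd x)}"
  have closed: "closed P" "closed Q"
    unfolding P_def Q_def Collect_conj_eq Collect_mem_eq
    by (intro closed_Int closed_sphere closed_Collect_le continuous_intros)+
  have PQ: "P \<union> Q = S3" by (auto simp: P_def Q_def simp del: mem_sphere_0)
  have Pnz: "fst x \<noteq> 0" if "x \<in> P" for x using that one_S3 by (auto simp: P_def norm_prod_def)
  have Qnz: "snd x \<noteq> 0" if "x \<in> Q" for x using that one_S3 by (auto simp: Q_def norm_prod_def)
  \<comment> \<open>On \<open>P\<close> the map is the twist of its values at positive p, so
    \<open>rot (s (sgn p)) (a y)\<close> lifts it. Dividing by \<open>a y\<close> makes the factor 1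
    on the torus, and \<open>s (-u) = s u\<close> makes it invariant under
    \<open>p \<mapsto> -p\<close>.\<close>
  define F1 where "F1 x = rot (s (sgn (fst x))) (a (snd x / of_real (cmod (fst x)))) \<otimes>\<^sub>q
      qcnj (a (snd x / of_real (cmod (fst x))))" for x
  \<comment> \<open>The conjugation is there because on \<open>Q\<close> the factor
    \<open>a (sgn q)\<close> of \<open>C\<close> stands between \<open>F2\<close> and the value of
    \<open>b0\<close> that is to be cancelled.\<close>
  define F2 where "F2 x = rot (s (sgn (snd x))) (b0 (fst x / of_real (cmod (snd x)))) \<otimes>\<^sub>q
      (a (sgn (snd x)) \<otimes>\<^sub>q qcnj (b0 (fst x / of_real (cmod (snd x)))) \<otimes>\<^sub>q qcnj (a (sgn (snd x))))" for x
  define G1 where "G1 x = (if x \<in> P then F1 x else (1, 0))" for x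
  define G2 where "G2 x = (if x \<in> Q then F2 x else (1, 0))" for x
  define M where "M x = max (cmod (fst x)) (cmod (snd x))" for x :: c2
  \<comment> \<open>For t = 1 this is \<open>a y \<otimes>\<^sub>q b0 (sgn p)\<close> on
    \<open>P\<close> and \<open>a (sgn q) \<otimes>\<^sub>q b0 y\<close> on \<open>Q\<close>. Both
    maps are defined on whole discs, so scaling their arguments by t contracts it to a constant; the
    maximum \<open>M\<close> keeps the arguments in the disc.\<close>
  define C where "C t x = a (of_real t * snd x / of_real (M x)) \<otimes>\<^sub>q b0 (of_real t * fst x / of_real (M x))" for t x
  have sgn1: "cmod (sgn z) = 1" if "z \<noteq> 0" for z :: complex using that by (simp add: norm_sgn)
  have Pcb: "cmod (snd x / of_real (cmod (fst x))) \<le> 1" if "x \<in> P" for x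
    using that Pnz[OF that] by (simp add: P_def norm_divide)
  have Qcb: "cmod (fst x / of_real (cmod (snd x))) \<le> 1" if "x \<in> Q" for x
    using that Qnz[OF that] by (simp add: Q_def norm_divide)
  have s1: "cmod (s (sgn z)) = 1" if "z \<noteq> 0" for z using s(2) sgn1[OF that] by blast
  have F1S: "F1 x \<in> S3" if "x \<in> P" for x
    unfolding F1_def using Pcb[OF that] s1[OF Pnz[OF that]] by (intro qmul_S3 rot_S3 qcnj_S3 a(2)) auto
  have aS: "a (sgn z) \<in> S3" if "z \<noteq> 0" for z
    using a(2)[of "sgn z"] sgn1[OF that] by simp
  have F2S: "F2 x \<in> S3" if "x \<in> Q" for x
    unfolding F2_def using Qcb[OF that] s1[OF Qnz[OF that]] aS[OF Qnz[OF that]]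
    by (intro qmul_S3 rot_S3 qcnj_S3 b(2)) auto
  have F1c: "continuous_on P F1"
    unfolding F1_def
    by (intro continuous_intros continuous_on_compose2[OF a(1)] continuous_on_compose2[OF s(1)])
      (use Pnz Pcb sgn1 in auto)
  have F2c: "continuous_on Q F2"
    unfolding F2_def
    by (intro continuous_intros continuous_on_compose2[OF a(1)] continuous_on_compose2[OF b(1)] continuous_on_compose2[OF s(1)])
      (use Qnz Qcb sgn1 in auto)
  have torus_a: "snd (a y) = 0" "snd (b0 y) = 0" if "cmod y = 1" for y using a(4) b(3) that by auto
  have T: "cmod (snd x / of_real (cmod (fst x))) = 1" "cmod (fst x / of_real (cmod (snd x))) = 1"
    if "x \<in> P" "x \<in> Q" for x
    using that Pnz[OF that(1)] by (auto simp: P_def Q_def norm_divide)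
  have F1T: "F1 x = (1, 0)" if "x \<in> P" "x \<in> Q" for x
  proof -
    let ?y = "snd x / of_real (cmod (fst x))"
    have "rot z (a ?y) = a ?y" for z using torus_a(1)[OF T(1)[OF that]] by (simp add: rot_def prod_eq_iff)
    then show ?thesis unfolding F1_def using qmul_qcnj(1)[OF a(2), of ?y] Pcb[OF that(1)] by simp
  qed
  have F2T: "F2 x = (1, 0)" if "x \<in> P" "x \<in> Q" for x
  proof -
    let ?y = "fst x / of_real (cmod (snd x))"
    have z: "snd (b0 ?y) = 0" "snd (a (sgn (snd x))) = 0"
      using torus_a(2)[OF T(2)[OF that]] a(4)[OF sgn1[OF Qnz[OF that(2)]]] by auto
    then have r: "rot z (b0 ?y) = b0 ?y" for z by (simp add: rot_def prod_eq_iff)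
    have "a (sgn (snd x)) \<otimes>\<^sub>q qcnj (b0 ?y) \<otimes>\<^sub>q qcnj (a (sgn (snd x))) = qcnj (b0 ?y)"
      unfolding conj_circle[OF z(2) aS[OF Qnz[OF that(2)]]] using z(1) by (simp add: qcnj_def)
    then show ?thesis unfolding F2_def r using qmul_qcnj(1)[OF b(2), of ?y] Qcb[OF that(2)] by simp
  qed
  have G1c: "continuous_on S3 G1"
  proof -
    have "continuous_on (P \<union> Q) G1"
      unfolding G1_def
      by (rule continuous_on_cases[OF closed F1c continuous_on_const]) (use F1T PQ in auto)
    then show ?thesis by (simp add: PQ)
  qed
  have G2c: "continuous_on S3 G2"
  proof -
    have "continuous_on (Q \<union> P) G2"
      unfolding G2_def
      by (rule continuous_on_cases[OF closed(2,1) F2c continuous_on_const]) (use F2T PQ in auto)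
    then show ?thesis using PQ by (simp add: Un_commute)
  qed
  have G1S: "G1 x \<in> S3" for x using F1S one_S3 by (simp add: G1_def del: mem_sphere_0)
  have G2S: "G2 x \<in> S3" for x using F2S one_S3 by (simp add: G2_def del: mem_sphere_0)
  have memP: "(-p, q) \<in> P \<longleftrightarrow> (p, q) \<in> P" for p q
    unfolding P_def mem_Collect_eq mem_S3_iff by simp
  have memQ: "(p, -q) \<in> Q \<longleftrightarrow> (p, q) \<in> Q" for p q
    unfolding Q_def mem_Collect_eq mem_S3_iff by simp
  have ev1: "even_type G1"
  proof (rule even_type_invariant_fst[OF G1c G1S])
    fix p q :: complex
    show "G1 (-p, q) = G1 (p, q)" by (simp add: G1_def memP F1_def sgn_minus s(3))
  qed
  have ev2: "even_type G2"
  proof (rule even_type_invariant_snd[OF G2c G2S])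
    fix p q :: complex
    show "G2 (p, -q) = G2 (p, q)"
    proof (cases "(p, q) \<in> Q")
      case True
      then have q: "cmod (sgn q) = 1" "q \<noteq> 0" using sgn1 Qnz by force+
      have "a (- sgn q) \<otimes>\<^sub>q x \<otimes>\<^sub>q qcnj (a (- sgn q)) = a (sgn q) \<otimes>\<^sub>q x \<otimes>\<^sub>q qcnj (a (sgn q))" for x
        using conj_circle[of "a (sgn q)" x] conj_circle[of "a (- sgn q)" x] a(4)[of "sgn q"] a(4)[of "- sgn q"] a(5)[of "sgn q"]
          aS[of q] aS[of "-q"] q by (simp add: sgn_minus del: mem_sphere_0)
      then show ?thesis by (simp add: G2_def memQ F2_def sgn_minus s(3))
    next
      case False
      then show ?thesis using memQ by (simp add: G2_def)
    qed
  qed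
  have Mpos: "M x > 0" if "x \<in> S3" for x
  proof -
    have "fst x \<noteq> 0 \<or> snd x \<noteq> 0" using that by (cases x) (auto simp: norm_prod_def)
    then show ?thesis by (auto simp: M_def less_max_iff_disj)
  qed
  have Ccb: "cmod (of_real t * snd x / of_real (M x)) \<le> 1" "cmod (of_real t * fst x / of_real (M x)) \<le> 1"
    if "t \<in> {0..1}" "x \<in> S3" for t x
  proof -
    have "cmod (fst x) \<le> M x" "cmod (snd x) \<le> M x" by (auto simp: M_def)
    then have "t * cmod (fst x) \<le> 1 * M x" "t * cmod (snd x) \<le> 1 * M x"
      using that Mpos[OF that(2)] by (intro mult_mono; simp)+
    then show "cmod (of_real t * snd x / of_real (M x)) \<le> 1" "cmod (of_real t * fst x / of_real (M x)) \<le> 1"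
      using that(1) Mpos[OF that(2)] by (auto simp: norm_divide norm_mult divide_le_eq)
  qed
  have CS: "C t x \<in> S3" if "t \<in> {0..1}" "x \<in> S3" for t x
    unfolding C_def using Ccb[OF that] by (intro qmul_S3 a(2) b(2)) auto
  have "(\<lambda>x. C 1 x) \<simeq> (\<lambda>x. C 0 x)"
  proof (rule heq_sym[OF heqI[of "\<lambda>z. C (fst z) (snd z)"]])
    have Mc: "continuous_on A M" for A
      unfolding M_def by (intro continuous_intros)
    have Mc': "continuous_on ({0..1::real} \<times> S3) (\<lambda>z. complex_of_real (M (snd z)))"
      by (intro continuous_intros continuous_on_compose2[OF Mc[of UNIV]]) auto
    have nz: "\<forall>z\<in>{0..1::real} \<times> S3. complex_of_real (M (snd z)) \<noteq> 0"
    proof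
      fix z assume "z \<in> {0..1::real} \<times> S3"
      then show "complex_of_real (M (snd z)) \<noteq> 0" using Mpos[of "snd z"] by auto
    qed
    have 1: "continuous_on ({0..1} \<times> S3) (\<lambda>z. of_real (fst z) * snd (snd z) / of_real (M (snd z)))"
      and 2: "continuous_on ({0..1} \<times> S3) (\<lambda>z. of_real (fst z) * fst (snd z) / of_real (M (snd z)))"
      by (intro continuous_intros Mc' nz)+
    show "continuous_on ({0..1} \<times> S3) (\<lambda>z. C (fst z) (snd z))"
      unfolding C_def
      by (intro continuous_on_qmul continuous_on_compose2[OF a(1) 1] continuous_on_compose2[OF b(1) 2])
        (use Ccb in \<open>auto simp del: mem_sphere_0\<close>)
  qed (use CS in \<open>auto simp del: mem_sphere_0\<close>)
  then have "(\<lambda>x. C 1 x) \<simeq> (\<lambda>x. a 0 \<otimes>\<^sub>q b0 0)" by (rule heq_cong) (auto simp: C_def)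
  moreover have "a 0 \<otimes>\<^sub>q b0 0 \<in> S3" using a(2)[of 0] b(2)[of 0] qmul_S3 by simp
  ultimately have ev3: "even_type (\<lambda>x. C 1 x)" using even_type_heq even_type_const by blast
  define \<psi> where "\<psi> x = G1 x \<otimes>\<^sub>q G2 x \<otimes>\<^sub>q C 1 x" for x
  have ev: "even_type \<psi>" unfolding \<psi>_def by (intro even_type_qmul ev1 ev2 ev3)
  have "hopf (\<psi> x) = f x" if x: "x \<in> S3" for x
  proof (cases "x \<in> P")
    case True
    obtain p q where pq: "x = (p, q)" by (cases x)
    have p0: "p \<noteq> 0" and le: "cmod q \<le> cmod p" using Pnz[OF True] True by (auto simp: pq P_def)
    let ?y = "q / of_real (cmod p)"
    have y: "?y \<in> cball 0 1" using Pcb[OF True] by (simp add: pq)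
    have G2: "G2 x = (1, 0)" using F2T[OF True] by (simp add: G2_def)
    have M: "M x = cmod p" using le by (simp add: M_def pq)
    have "\<psi> x = rot (s (sgn p)) (a ?y) \<otimes>\<^sub>q (qcnj (a ?y) \<otimes>\<^sub>q a ?y) \<otimes>\<^sub>q b0 (p / of_real (cmod p))"
      unfolding \<psi>_def G2 G1_def using True by (simp add: F1_def C_def M) (simp add: pq qmul_assoc)
    also have "\<dots> = rot (s (sgn p)) (a ?y) \<otimes>\<^sub>q b0 (sgn p)"
      using qmul_qcnj(2)[OF a(2)[OF y]] by (simp add: sgn_eq)
    finally have psi: "\<psi> x = rot (s (sgn p)) (a ?y) \<otimes>\<^sub>q b0 (sgn p)" .
    \<comment> \<open>Over the boundary circle the values of \<open>b0\<close> lie in the fibre of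
      \<open>(1, 0)\<close>, and right multiplication by them leaves Hopf images unchanged.\<close>
    have bs: "snd (b0 (sgn p)) = 0" "b0 (sgn p) \<in> S3" using b(3)[OF sgn1[OF p0]] b(2)[of "sgn p"] sgn1[OF p0] by auto
    have cm: "cmod (fst (b0 (sgn p))) = 1" using S3_snd0 bs by blast
    have "hopf (\<psi> x) = hopf (rot (s (sgn p)) (a ?y))"
      unfolding psi by (subst snd0_eq[OF bs(1)]) (rule hopf_qmul_circle[OF cm])
    also have "\<dots> = tw (s (sgn p)) (f (nr (1, ?y)))"
      using hopf_rot[OF s1[OF p0]] a(3)[OF y] a0(3)[OF y] by simp
    also have "nr (1, ?y) = (of_real (cmod p), q)"
    proof -
      have e: "(1::complex, ?y) = (inverse (cmod p)) *\<^sub>R (of_real (cmod p), q)"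
        using p0 by (simp add: scaleR_conv_of_real field_simps)
      moreover have "norm (of_real (cmod p) :: complex, q) = 1" using x by (simp add: pq norm_prod_def)
      ultimately show ?thesis unfolding e using p0 by (intro nr_scale) auto
    qed
    also have "tw (s (sgn p)) (f (of_real (cmod p), q)) = f (sgn p * of_real (cmod p), q)"
      by (rule tw1[symmetric]) (use x le sgn1[OF p0] in \<open>auto simp: pq norm_prod_def\<close>)
    also have "\<dots> = f x" using p0 by (simp add: pq sgn_eq)
    finally show ?thesis .
  next
    case False
    then have Q: "x \<in> Q" using x PQ by blast
    obtain p q where pq: "x = (p, q)" by (cases x)
    have q0: "q \<noteq> 0" and le: "cmod p \<le> cmod q" using Qnz[OF Q] Q by (auto simp: pq Q_def)
    let ?y = "p / of_real (cmod q)"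
    have y: "?y \<in> cball 0 1" using Qcb[OF Q] by (simp add: pq)
    have G1: "G1 x = (1, 0)" using False by (simp add: G1_def)
    have M: "M x = cmod q" using le by (simp add: M_def pq)
    have as: "a (sgn q) \<in> S3" using aS[OF q0] .
    have "\<psi> x = rot (s (sgn q)) (b0 ?y) \<otimes>\<^sub>q (a (sgn q) \<otimes>\<^sub>q (qcnj (b0 ?y) \<otimes>\<^sub>q (qcnj (a (sgn q)) \<otimes>\<^sub>q a (sgn q)) \<otimes>\<^sub>q b0 ?y))"
      unfolding \<psi>_def G1 G2_def using Q by (simp add: F2_def C_def M) (simp add: pq qmul_assoc sgn_eq)
    also have "\<dots> = rot (s (sgn q)) (b0 ?y) \<otimes>\<^sub>q a (sgn q)"
      using qmul_qcnj(2)[OF as] qmul_qcnj(2)[OF b(2)[OF y]] by simp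
    finally have psi: "\<psi> x = rot (s (sgn q)) (b0 ?y) \<otimes>\<^sub>q a (sgn q)" .
    have bs: "snd (a (sgn q)) = 0" using a(4)[OF sgn1[OF q0]] .
    have cm: "cmod (fst (a (sgn q))) = 1" using S3_snd0 bs as by blast
    have "hopf (\<psi> x) = hopf (rot (s (sgn q)) (b0 ?y))"
      unfolding psi by (subst snd0_eq[OF bs(1)]) (rule hopf_qmul_circle[OF cm])
    also have "\<dots> = tw (s (sgn q)) (f (nr (?y, 1)))"
      using hopf_rot[OF s1[OF q0]] b0(3)[OF y] by simp
    also have "nr (?y, 1) = (p, of_real (cmod q))"
    proof -
      have e: "(?y, 1::complex) = (inverse (cmod q)) *\<^sub>R (p, of_real (cmod q))"
        using q0 by (simp add: scaleR_conv_of_real field_simps)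
      moreover have "norm (p, of_real (cmod q) :: complex) = 1" using x by (simp add: pq norm_prod_def)
      ultimately show ?thesis unfolding e using q0 by (intro nr_scale) auto
    qed
    also have "tw (s (sgn q)) (f (p, of_real (cmod q))) = f (p, sgn q * of_real (cmod q))"
      by (rule tw2[symmetric]) (use x le sgn1[OF q0] in \<open>auto simp: pq norm_prod_def\<close>)
    also have "\<dots> = f x" using q0 by (simp add: pq sgn_eq)
    finally show ?thesis .
  qed
  moreover have "sgn (f x) = f x" if "x \<in> S3" for x using f(2)[OF that] by (simp add: sgn_div_norm)
  ultimately have "lifts f \<psi>"
    unfolding lifts_def using even_type_continuous[OF ev] even_type_S3[OF ev] by simp
  then show ?thesis using ev by (auto simp: even_lift_def)
qed

lemma tw_scaleR: "tw s (c *\<^sub>R a) = c *\<^sub>R tw s a"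
  by (simp add: tw_def)

lemma sgn_tw: "cmod s = 1 \<Longrightarrow> sgn (tw s a) = tw s (sgn a)"
  by (simp add: sgn_div_norm norm_tw tw_scaleR)

lemma even_lift_sgn: "even_lift (\<lambda>x. sgn (f x)) = even_lift f"
proof -
  have "sgn (sgn v) = sgn v" for v :: j3 by (cases "v = 0") (simp_all add: sgn_div_norm)
  then show ?thesis by (simp add: even_lift_def lifts_def)
qed

lemma even_lift_cong: "even_lift f \<Longrightarrow> (\<And>x. x \<in> S3 \<Longrightarrow> f x = g x) \<Longrightarrow> even_lift g"
  unfolding even_lift_def lifts_def by (metis (no_types, lifting))

text \<open>Near the torus the map stays away from \<open>(-1, 0)\<close>, so it can be deformed to
  equal \<open>(1, 0)\<close> on the torus. The cut-off depends only on
  \<open>\<bar>cmod p - cmod q\<bar>\<close> and the twists fix \<open>(1, 0)\<close>, hence the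
  equivariance is kept.\<close>

lemma even_lift_twisted_pos:
  fixes f :: "c2 \<Rightarrow> j3" and s :: "complex \<Rightarrow> complex"
  assumes f: "continuous_on S3 f" "\<And>x. x \<in> S3 \<Longrightarrow> norm (f x) = 1"
    and torus: "\<And>p q. (p, q) \<in> S3 \<Longrightarrow> cmod p = cmod q \<Longrightarrow> fst (f (p, q)) \<ge> 0"
    and s: "continuous_on (sphere 0 1) s" "\<And>u. cmod u = 1 \<Longrightarrow> cmod (s u) = 1" "\<And>u. s (-u) = s u"
    and tw1: "\<And>u p q. (p, q) \<in> S3 \<Longrightarrow> cmod u = 1 \<Longrightarrow> cmod q \<le> cmod p \<Longrightarrow> f (u * p, q) = tw (s u) (f (p, q))"
    and tw2: "\<And>u p q. (p, q) \<in> S3 \<Longrightarrow> cmod u = 1 \<Longrightarrow> cmod p \<le> cmod q \<Longrightarrow> f (p, u * q) = tw (s u) (f (p, q))"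
  shows "even_lift f"
proof -
  define r where "r x = \<bar>cmod (fst x) - cmod (snd x)\<bar>" for x :: c2
  \<comment> \<open>Any threshold strictly between -1 and 0 would do: on the torus
    \<open>fst (f x) \<ge> 0\<close>, while the segment from \<open>f x\<close> to
    \<open>(1, 0)\<close> meets 0 only for \<open>fst (f x) = -1\<close>.\<close>
  define K where "K = S3 \<inter> (\<lambda>x. fst (f x)) -` {..-1/2}"
  have rc: "continuous_on A r" for A unfolding r_def by (intro continuous_intros)
  have "closed K"
    unfolding K_def by (rule continuous_closed_preimage) (auto intro!: continuous_intros f(1))
  then have "compact K"
    using bounded_subset[OF bounded_sphere inf_le1] compact_eq_bounded_closed unfolding K_def by blast
  then have "closed (r ` K)" by (intro compact_imp_closed compact_continuous_image rc)
  moreover have "0 \<notin> r ` K"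
  proof
    assume "0 \<in> r ` K"
    then obtain x where x: "x \<in> S3" "fst (f x) \<le> -1/2" "r x = 0" by (auto simp: K_def simp del: mem_sphere_0)
    then show False using torus[of "fst x" "snd x"] by (simp add: r_def del: mem_sphere_0)
  qed
  ultimately have "\<exists>\<delta>>0. \<forall>y\<in>r ` K. \<delta> \<le> dist 0 y" by (rule separate_point_closed)
  then obtain \<delta> where \<delta>: "\<delta> > 0" "\<And>y. y \<in> r ` K \<Longrightarrow> \<delta> \<le> dist 0 y" by metis
  have gt: "fst (f x) > -1/2" if "x \<in> S3" "r x < \<delta>" for x
  proof (rule ccontr)
    assume "\<not> fst (f x) > -1/2"
    then have "x \<in> K" using that(1) by (simp add: K_def del: mem_sphere_0)
    then have "\<delta> \<le> dist 0 (r x)" using \<delta>(2) by blast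
    then show False using that(2) by (simp add: r_def)
  qed
  define ch where "ch x = max 0 (1 - r x / \<delta>)" for x
  have ch: "ch x \<in> {0..1}" "ch x \<noteq> 0 \<Longrightarrow> r x < \<delta>" for x
    using \<delta>(1) by (auto simp: ch_def r_def max_def divide_less_eq split: if_splits)
  have chc: "continuous_on A ch" for A
    unfolding ch_def using \<delta>(1) by (intro continuous_intros rc) auto
  define h where "h t x = (1 - t * ch x) *\<^sub>R f x + (t * ch x) *\<^sub>R (1, 0)" for t x
  have hnz: "h t x \<noteq> 0" if "t \<in> {0..1}" "x \<in> S3" for t x
  proof
    assume h0: "h t x = 0"
    have ts: "t * ch x \<in> {0..1}" using that ch(1)[of x] by (auto intro: mult_le_one)
    from h0 have e: "(1 - t * ch x) *\<^sub>R f x = - ((t * ch x) *\<^sub>R (1, 0))" unfolding h_def by (simp only: eq_neg_iff_add_eq_0)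
    then have "norm ((1 - t * ch x) *\<^sub>R f x) = norm ((t * ch x) *\<^sub>R (1::real, 0::complex))" by simp
    moreover have "norm (1::real, 0::complex) = 1" by (simp add: norm_prod_def)
    ultimately have "1 - t * ch x = t * ch x" using ts f(2)[OF that(2)] unfolding norm_scaleR by simp
    then have half: "t * ch x = 1/2" by simp
    then have "ch x \<noteq> 0" by auto
    then have "fst (f x) > -1/2" using gt ch(2) that(2) by blast
    moreover have "(1 - t * ch x) * fst (f x) = - (t * ch x)" using arg_cong[OF e, of fst] by simp
    then have "fst (f x) = -1" unfolding half by (simp add: field_simps)
    ultimately show False by simp
  qed
  have hc: "continuous_on ({0..1} \<times> S3) (\<lambda>z. h (fst z) (snd z))"
    unfolding h_def
    by (intro continuous_intros continuous_on_compose2[OF f(1)] continuous_on_compose2[OF chc[of UNIV]]) auto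
  have hc1: "continuous_on S3 (h 1)"
    unfolding h_def by (intro continuous_intros f(1) chc)
  have htw: "h 1 y = tw w (h 1 x)" if "f y = tw w (f x)" "r y = r x" for x y w
    using that by (simp add: h_def ch_def tw_def prod_eq_iff)
  have "even_lift (\<lambda>x. sgn (h 1 x))"
  proof (rule even_lift_normalized[OF _ _ _ s])
    show "continuous_on S3 (\<lambda>x. sgn (h 1 x))" using hnz by (intro continuous_intros hc1) auto
    show "norm (sgn (h 1 x)) = 1" if "x \<in> S3" for x using hnz[of 1 x] that by (simp add: norm_sgn del: mem_sphere_0)
    show "sgn (h 1 (p, q)) = (1, 0)" if "(p, q) \<in> S3" "cmod p = cmod q" for p q
      using that by (simp add: h_def ch_def r_def sgn_div_norm norm_prod_def)
    fix u p q assume u: "(p, q) \<in> S3" "cmod u = 1"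
    show "sgn (h 1 (u * p, q)) = tw (s u) (sgn (h 1 (p, q)))" if "cmod q \<le> cmod p"
      using htw[OF tw1[OF u that]] u by (simp add: r_def norm_mult sgn_tw s(2))
    show "sgn (h 1 (p, u * q)) = tw (s u) (sgn (h 1 (p, q)))" if "cmod p \<le> cmod q"
      using htw[OF tw2[OF u that]] u by (simp add: r_def norm_mult sgn_tw s(2))
  qed
  then have "even_lift (h 1)" by (simp only: even_lift_sgn)
  then have ev: "even_lift (\<lambda>x. h (1 - 0) x)" by simp
  define F where "F z = h (1 - fst z) (snd z)" for z :: "real \<times> c2"
  have "even_lift (\<lambda>x. F (1, x))"
  proof (rule even_lift_homotopy)
    show "continuous_on ({0..1} \<times> S3) F"
      unfolding F_def by (rule continuous_on_compose2[OF hc, where f = "\<lambda>z. (1 - fst z, snd z)", simplified])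
        (auto intro!: continuous_intros)
    show "F (t, x) \<noteq> 0" if "t \<in> {0..1}" "x \<in> S3" for t x using hnz[of "1 - t" x] that by (simp add: F_def del: mem_sphere_0)
    show "even_lift (\<lambda>x. F (0, x))" using ev by (simp add: F_def)
  qed
  then show ?thesis by (rule even_lift_cong) (simp add: F_def h_def zero_prod_def)
qed

lemma hopf_flip: "hopf ((0, 1) \<otimes>\<^sub>q x) = (- fst (hopf x), - cnj (snd (hopf x)))"
  by (simp add: hopf_def qmul_def)

text \<open>After normalization the first coordinate is constant on the torus. If it is negative,
  left multiplication of lifts by j turns the map into \<open>(- fst, - cnj snd)\<close>, which has
  the right sign and is twisted by the conjugate of \<open>s\<close>.\<close>

lemma even_lift_twisted:
  fixes f :: "c2 \<Rightarrow> j3" and s :: "complex \<Rightarrow> complex"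
  assumes f: "continuous_on S3 f" "\<And>x. x \<in> S3 \<Longrightarrow> f x \<noteq> 0"
    and s: "continuous_on (sphere 0 1) s" "\<And>u. cmod u = 1 \<Longrightarrow> cmod (s u) = 1" "\<And>u. s (-u) = s u"
    and tw1: "\<And>u p q. (p, q) \<in> S3 \<Longrightarrow> cmod u = 1 \<Longrightarrow> cmod q \<le> cmod p \<Longrightarrow> f (u * p, q) = tw (s u) (f (p, q))"
    and tw2: "\<And>u p q. (p, q) \<in> S3 \<Longrightarrow> cmod u = 1 \<Longrightarrow> cmod p \<le> cmod q \<Longrightarrow> f (p, u * q) = tw (s u) (f (p, q))"
  shows "even_lift f"
proof -
  define g where "g x = sgn (f x)" for x
  define r where "r = complex_of_real (inverse (sqrt 2))"
  have r1: "cmod r = inverse (sqrt 2)" unfolding r_def norm_of_real by simp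
  have r: "cmod r = inverse (sqrt 2)" "(r, r) \<in> S3"
    unfolding mem_S3_iff fst_conv snd_conv r1 by (simp_all add: power_inverse)
  have gc: "continuous_on S3 g" unfolding g_def by (intro continuous_intros f(1)) (use f(2) in auto)
  have g1: "norm (g x) = 1" if "x \<in> S3" for x using f(2)[OF that] by (simp add: g_def norm_sgn)
  have g_tw1: "g (u * p, q) = tw (s u) (g (p, q))" if "(p, q) \<in> S3" "cmod u = 1" "cmod q \<le> cmod p" for u p q
    unfolding g_def tw1[OF that] by (rule sgn_tw[OF s(2)[OF that(2)]])
  have g_tw2: "g (p, u * q) = tw (s u) (g (p, q))" if "(p, q) \<in> S3" "cmod u = 1" "cmod p \<le> cmod q" for u p q
    unfolding g_def tw2[OF that] by (rule sgn_tw[OF s(2)[OF that(2)]])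
  \<comment> \<open>On the torus both twist relations hold; together they connect any two of its
    points, and \<open>tw\<close> keeps the first coordinate.\<close>
  have const: "fst (g (p, q)) = fst (g (r, r))" if pq: "(p, q) \<in> S3" "cmod p = cmod q" for p q
  proof -
    have "2 * (cmod p)\<^sup>2 = 1" using pq unfolding mem_S3_iff by simp
    then have "(cmod p)\<^sup>2 = (inverse (sqrt 2))\<^sup>2" by (simp add: power_inverse)
    then have p: "cmod p = inverse (sqrt 2)" by (rule power2_eq_imp_eq) auto
    have "p / r * r = p" "q / r * r = q" using r by auto
    moreover have n: "cmod (p / r) = 1" "cmod (q / r) = 1" using p pq(2) r by (simp_all add: norm_divide)
    have "(p, r) \<in> S3" using p r unfolding mem_S3_iff by simp
    ultimately show ?thesis
      using g_tw1[OF r(2) n(1)] g_tw2[of p r "q / r"] n p r(1) by (simp add: tw_def del: mem_sphere_0)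
  qed
  have "even_lift g"
  proof (cases "fst (g (r, r)) \<ge> 0")
    case True
    show ?thesis
      by (rule even_lift_twisted_pos[OF gc g1 _ s g_tw1 g_tw2]) (use True const in \<open>auto simp del: mem_sphere_0\<close>)
  next
    case False
    define k where "k x = (- fst (g x), - cnj (snd (g x)))" for x
    have "even_lift k"
    proof (rule even_lift_twisted_pos[where s = "\<lambda>u. cnj (s u)"])
      show "continuous_on S3 k" unfolding k_def by (intro continuous_intros gc)
      show "norm (k x) = 1" if "x \<in> S3" for x using g1[OF that] by (simp add: k_def norm_prod_def)
      show "fst (k (p, q)) \<ge> 0" if "(p, q) \<in> S3" "cmod p = cmod q" for p q
        using const[OF that] False by (simp add: k_def)
      show "continuous_on (sphere 0 1) (\<lambda>u. cnj (s u))" by (intro continuous_intros s(1))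
    qed (use s g_tw1 g_tw2 in \<open>auto simp: k_def tw_def simp del: mem_sphere_0\<close>)
    then obtain p where p: "lifts k p" "even_type p" by (auto simp: even_lift_def)
    define J where "J = (0::complex, 1::complex)"
    have J: "J \<in> S3" unfolding mem_S3_iff by (simp add: J_def)
    have "even_type (\<lambda>x. J \<otimes>\<^sub>q p x)" by (intro even_type_qmul even_type_const J p(2))
    moreover have "lifts g (\<lambda>x. J \<otimes>\<^sub>q p x)"
      unfolding lifts_def
    proof (intro conjI ballI)
      show "continuous_on S3 (\<lambda>x. J \<otimes>\<^sub>q p x)" using p(1) by (auto simp: lifts_def intro!: continuous_intros)
      fix x assume x: "x \<in> S3"
      show "J \<otimes>\<^sub>q p x \<in> S3" using p(1) x J by (intro qmul_S3) (auto simp: lifts_def simp del: mem_sphere_0)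
      have "norm (k x) = 1" using g1[OF x] by (simp add: k_def norm_prod_def)
      then have "hopf (p x) = k x" using p(1) x by (simp add: lifts_def sgn_div_norm del: mem_sphere_0)
      then show "hopf (J \<otimes>\<^sub>q p x) = sgn (g x)"
        unfolding J_def hopf_flip using g1[OF x] by (simp add: k_def sgn_div_norm)
    qed
    ultimately show ?thesis by (auto simp: even_lift_def)
  qed
  then show ?thesis unfolding g_def by (simp only: even_lift_sgn)
qed

section \<open>Smooth maps and curves\<close>

lemma C_k_on_cong:
  assumes "open U" "\<And>x. x \<in> U \<Longrightarrow> f x = g x"
  shows "C_k_on k U f \<longleftrightarrow> C_k_on k U g"
  using assms(2)
proof (induction k arbitrary: f g)
  case 0
  then show ?case by (simp cong: continuous_on_cong)
next
  case (Suc k)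
  have ev: "eventually (\<lambda>y. f y = g y) (at x)" if "x \<in> U" for x
    using that assms(1) Suc.prems by (auto simp: eventually_at_topological)
  have d: "(f has_derivative D) (at x) \<longleftrightarrow> (g has_derivative D) (at x)" if "x \<in> U" for x D
    using has_derivative_transform_within_open[OF _ assms(1) that, of f D UNIV g]
      has_derivative_transform_within_open[OF _ assms(1) that, of g D UNIV f] Suc.prems by auto
  then have fd: "frechet_derivative f (at x) = frechet_derivative g (at x)"
    and diff: "f differentiable (at x) \<longleftrightarrow> g differentiable (at x)" if "x \<in> U" for x
    using that by (simp_all add: frechet_derivative_def differentiable_def)
  have "C_k_on k U (\<lambda>x. frechet_derivative f (at x) v) \<longleftrightarrow> C_k_on k U (\<lambda>x. frechet_derivative g (at x) v)" for v
    by (rule Suc.IH) (simp add: fd)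
  then show ?case unfolding C_k_on.simps using diff by blast
qed

text \<open>On an open set derivatives are unique, so any pointwise derivative may replace the
  chosen \<open>frechet_derivative\<close>.\<close>

lemma C_k_on_SucI:
  assumes "open U" "\<And>x. x \<in> U \<Longrightarrow> (f has_derivative f' x) (at x)"
    and "\<And>v. C_k_on k U (\<lambda>x. f' x v)"
  shows "C_k_on (Suc k) U f"
proof -
  have "frechet_derivative f (at x) = f' x" if "x \<in> U" for x
    using frechet_derivative_at[OF assms(2)[OF that]] by simp
  then have "C_k_on k U (\<lambda>x. frechet_derivative f (at x) v)" for v
    using C_k_on_cong[OF assms(1), of "\<lambda>x. frechet_derivative f (at x) v" "\<lambda>x. f' x v" k] assms(3) by simp
  then show ?thesis using assms(2) by (auto simp: differentiable_def)
qed

lemma C_k_on_SucD: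
  "C_k_on (Suc k) U f \<Longrightarrow> x \<in> U \<Longrightarrow> f differentiable (at x)"
  "C_k_on (Suc k) U f \<Longrightarrow> C_k_on k U (\<lambda>x. frechet_derivative f (at x) v)"
  by (simp_all only: C_k_on.simps(2))

lemma C_k_on_SucE:
  assumes "C_k_on (Suc k) U f"
  obtains f' where "\<And>x. x \<in> U \<Longrightarrow> (f has_derivative f' x) (at x)" "\<And>v. C_k_on k U (\<lambda>x. f' x v)"
proof (rule that)
  show "(f has_derivative frechet_derivative f (at x)) (at x)" if "x \<in> U" for x
    using C_k_on_SucD(1)[OF assms that] frechet_derivative_works by blast
  show "C_k_on k U (\<lambda>x. frechet_derivative f (at x) v)" for v
    by (rule C_k_on_SucD(2)[OF assms])
qed

lemma C_k_on_Suc_imp: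
  assumes "open U" shows "C_k_on (Suc k) U f \<Longrightarrow> C_k_on k U f"
proof (induction k arbitrary: f)
  case 0
  have "isCont f x" if "x \<in> U" for x
    by (rule differentiable_imp_continuous_within[OF C_k_on_SucD(1)[OF 0 that]])
  then show ?case unfolding C_k_on.simps by (simp add: continuous_at_imp_continuous_on)
next
  case (Suc k)
  show ?case
    unfolding C_k_on.simps(2)[of k]
    using C_k_on_SucD(1)[OF Suc.prems] Suc.IH[OF C_k_on_SucD(2)[OF Suc.prems]] by blast
qed

lemma C_k_on_subset: "C_k_on k U f \<Longrightarrow> V \<subseteq> U \<Longrightarrow> C_k_on k V f"
proof (induction k arbitrary: f)
  case (Suc k)
  then show ?case unfolding C_k_on.simps by blast
qed (auto intro: continuous_on_subset)

lemma C_k_on_const: "open U \<Longrightarrow> C_k_on k U (\<lambda>x. c)"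
proof (induction k arbitrary: c)
  case (Suc k)
  show ?case by (rule C_k_on_SucI[OF Suc.prems, where f' = "\<lambda>x v. 0"]) (auto intro: Suc)
qed auto

lemma C_k_on_linear: 
  assumes "open U" "bounded_linear L" shows "C_k_on k U L"
proof (cases k)
  case 0
  then show ?thesis using assms by (auto intro: linear_continuous_on)
next
  case (Suc k')
  show ?thesis unfolding Suc
    by (rule C_k_on_SucI[OF assms(1), where f' = "\<lambda>x. L"])
      (auto intro: C_k_on_const assms bounded_linear_imp_has_derivative)
qed

lemma C_k_on_compose_linear:
  assumes "open U" "bounded_linear L" "C_k_on k U f"
  shows "C_k_on k U (\<lambda>x. L (f x))"
  using assms(3)
proof (induction k arbitrary: f)
  case 0
  then show ?case using assms(2) by (auto intro: bounded_linear.continuous_on)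
next
  case (Suc k)
  obtain f' where f': "\<And>x. x \<in> U \<Longrightarrow> (f has_derivative f' x) (at x)" "\<And>v. C_k_on k U (\<lambda>x. f' x v)"
    using C_k_on_SucE[OF Suc.prems] by blast
  show ?case
    by (rule C_k_on_SucI[OF assms(1), where f' = "\<lambda>x v. L (f' x v)"])
      (auto intro: bounded_linear.has_derivative[OF assms(2)] f' Suc.IH)
qed

lemma C_k_on_add:
  assumes "open U" "C_k_on k U f" "C_k_on k U g"
  shows "C_k_on k U (\<lambda>x. f x + g x)"
  using assms(2,3)
proof (induction k arbitrary: f g)
  case 0
  then show ?case by (auto intro: continuous_intros)
next
  case (Suc k)
  obtain f' where f': "\<And>x. x \<in> U \<Longrightarrow> (f has_derivative f' x) (at x)" "\<And>v. C_k_on k U (\<lambda>x. f' x v)"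
    using C_k_on_SucE[OF Suc.prems(1)] by blast
  obtain g' where g': "\<And>x. x \<in> U \<Longrightarrow> (g has_derivative g' x) (at x)" "\<And>v. C_k_on k U (\<lambda>x. g' x v)"
    using C_k_on_SucE[OF Suc.prems(2)] by blast
  show ?case
    by (rule C_k_on_SucI[OF assms(1), where f' = "\<lambda>x v. f' x v + g' x v"])
      (auto intro!: derivative_intros f' g' Suc.IH)
qed

lemma C_k_on_scaleR:
  fixes f :: "'a::real_normed_vector \<Rightarrow> real"
  assumes "open U" "C_k_on k U f" "C_k_on k U g"
  shows "C_k_on k U (\<lambda>x. f x *\<^sub>R g x)"
  using assms(2,3)
proof (induction k arbitrary: f g)
  case 0
  then show ?case by (auto intro: continuous_intros)
next
  case (Suc k)
  obtain f' where f': "\<And>x. x \<in> U \<Longrightarrow> (f has_derivative f' x) (at x)" "\<And>v. C_k_on k U (\<lambda>x. f' x v)"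
    using C_k_on_SucE[OF Suc.prems(1)] by blast
  obtain g' where g': "\<And>x. x \<in> U \<Longrightarrow> (g has_derivative g' x) (at x)" "\<And>v. C_k_on k U (\<lambda>x. g' x v)"
    using C_k_on_SucE[OF Suc.prems(2)] by blast
  show ?case
  proof (rule C_k_on_SucI[OF assms(1)])
    show "((\<lambda>x. f x *\<^sub>R g x) has_derivative (\<lambda>v. f x *\<^sub>R g' x v + f' x v *\<^sub>R g x)) (at x)" if "x \<in> U" for x
      by (rule has_derivative_scaleR[OF f'(1)[OF that] g'(1)[OF that]])
    show "C_k_on k U (\<lambda>x. f x *\<^sub>R g' x v + f' x v *\<^sub>R g x)" for v
      using Suc.IH[OF C_k_on_Suc_imp[OF assms(1) Suc.prems(1)] g'(2)]
        Suc.IH[OF f'(2) C_k_on_Suc_imp[OF assms(1) Suc.prems(2)]]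
      by (rule C_k_on_add[OF assms(1)])
  qed
qed

lemma C_k_on_inverse:
  fixes f :: "'a::real_normed_vector \<Rightarrow> real"
  assumes "open U" "C_k_on k U f" "\<And>x. x \<in> U \<Longrightarrow> f x \<noteq> 0"
  shows "C_k_on k U (\<lambda>x. inverse (f x))"
  using assms(2)
proof (induction k)
  case 0
  then show ?case using assms(3) by (auto intro: continuous_intros)
next
  case (Suc k)
  obtain f' where f': "\<And>x. x \<in> U \<Longrightarrow> (f has_derivative f' x) (at x)" "\<And>v. C_k_on k U (\<lambda>x. f' x v)"
    using C_k_on_SucE[OF Suc.prems(1)] by blast
  have IH: "C_k_on k U (\<lambda>x. inverse (f x))" by (rule Suc.IH[OF C_k_on_Suc_imp[OF assms(1) Suc.prems]])
  show ?case
  proof (rule C_k_on_SucI[OF assms(1)])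
    show "((\<lambda>x. inverse (f x)) has_derivative (\<lambda>v. inverse (f x) *\<^sub>R inverse (f x) *\<^sub>R ((-1) *\<^sub>R f' x v))) (at x)" if "x \<in> U" for x
      using has_derivative_inverse'[THEN has_derivative_compose[OF f'(1)[OF that]], OF assms(3)[OF that]]
      by (simp add: algebra_simps)
    show "C_k_on k U (\<lambda>x. inverse (f x) *\<^sub>R inverse (f x) *\<^sub>R ((-1) *\<^sub>R f' x v))" for v
      by (intro C_k_on_scaleR assms(1) IH C_k_on_const f'(2))
  qed
qed

lemma C_k_on_sqrt:
  fixes f :: "'a::real_normed_vector \<Rightarrow> real"
  assumes "open U" "C_k_on k U f" "\<And>x. x \<in> U \<Longrightarrow> f x > 0"
  shows "C_k_on k U (\<lambda>x. sqrt (f x))"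
  using assms(2)
proof (induction k)
  case 0
  then show ?case by (auto intro: continuous_intros)
next
  case (Suc k)
  obtain f' where f': "\<And>x. x \<in> U \<Longrightarrow> (f has_derivative f' x) (at x)" "\<And>v. C_k_on k U (\<lambda>x. f' x v)"
    using C_k_on_SucE[OF Suc.prems(1)] by blast
  have IH: "C_k_on k U (\<lambda>x. sqrt (f x))" by (rule Suc.IH[OF C_k_on_Suc_imp[OF assms(1) Suc.prems]])
  show ?case
  proof (rule C_k_on_SucI[OF assms(1)])
    show "((\<lambda>x. sqrt (f x)) has_derivative (\<lambda>v. inverse (2 *\<^sub>R sqrt (f x)) *\<^sub>R f' x v)) (at x)" if "x \<in> U" for x
      using has_derivative_real_sqrt[OF assms(3)[OF that] f'(1)[OF that]]
      by (simp add: field_simps)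
    show "C_k_on k U (\<lambda>x. inverse (2 *\<^sub>R sqrt (f x)) *\<^sub>R f' x v)" for v
      by (intro C_k_on_scaleR assms(1) C_k_on_inverse IH C_k_on_const f'(2)) (use assms(3) in \<open>force simp: less_imp_neq\<close>)
  qed
qed

lemma C_k_on_id: "open U \<Longrightarrow> C_k_on k U (\<lambda>x. x)"
  by (rule C_k_on_linear) (auto intro: bounded_linear_ident)

lemma C_k_on_Pair:
  assumes "open U" "C_k_on k U f" "C_k_on k U g"
  shows "C_k_on k U (\<lambda>x. (f x, g x))"
proof -
  have "C_k_on k U (\<lambda>x. (f x, 0) + (0, g x))"
    by (intro C_k_on_add C_k_on_compose_linear[OF assms(1), of "\<lambda>v. (v, 0)"]
        C_k_on_compose_linear[OF assms(1), of "\<lambda>v. (0, v)"] assms)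
      (auto intro!: bounded_linear_Pair bounded_linear_ident bounded_linear_zero)
  then show ?thesis by simp
qed

lemma C_k_on_fst: "open U \<Longrightarrow> C_k_on k U f \<Longrightarrow> C_k_on k U (\<lambda>x. fst (f x))"
  and C_k_on_snd: "open U \<Longrightarrow> C_k_on k U f \<Longrightarrow> C_k_on k U (\<lambda>x. snd (f x))"
  by (auto intro: C_k_on_compose_linear bounded_linear_fst bounded_linear_snd)

lemma C_k_on_mult:
  fixes f g :: "'a::real_normed_vector \<Rightarrow> real"
  shows "open U \<Longrightarrow> C_k_on k U f \<Longrightarrow> C_k_on k U g \<Longrightarrow> C_k_on k U (\<lambda>x. f x * g x)"
  using C_k_on_scaleR[of U k f g] by simp

lemma C_k_on_diff:
  assumes "open U" "C_k_on k U f" "C_k_on k U g"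
  shows "C_k_on k U (\<lambda>x. f x - g x)"
  using C_k_on_add[OF assms(1,2) C_k_on_compose_linear[OF assms(1) _ assms(3), of uminus]]
  by (simp add: bounded_linear_minus bounded_linear_ident)

lemma C_k_on_divide:
  fixes f g :: "'a::real_normed_vector \<Rightarrow> real"
  assumes "open U" "C_k_on k U f" "C_k_on k U g" "\<And>x. x \<in> U \<Longrightarrow> g x \<noteq> 0"
  shows "C_k_on k U (\<lambda>x. f x / g x)"
  using C_k_on_mult[OF assms(1,2) C_k_on_inverse[OF assms(1,3,4)]] by (simp add: divide_inverse)

lemma C_k_on_cmod_sq:
  assumes "open U" "C_k_on k U f"
  shows "C_k_on k U (\<lambda>x. (cmod (f x))\<^sup>2)"
  unfolding cmod_power2 unfolding power2_eq_square
  by (intro C_k_on_add C_k_on_mult C_k_on_compose_linear[of _ Re] C_k_on_compose_linear[of _ Im] assms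
      bounded_linear_Re bounded_linear_Im)

lemmas C_k_on_intros = C_k_on_const C_k_on_id C_k_on_add C_k_on_diff C_k_on_scaleR C_k_on_mult C_k_on_divide
  C_k_on_sqrt C_k_on_Pair C_k_on_fst C_k_on_snd C_k_on_cmod_sq

lemma smooth_on_imp_continuous_on: "smooth_on U f \<Longrightarrow> continuous_on U f"
  unfolding smooth_on_def by (metis C_k_on.simps(1))

text \<open>A rational parametrization of a great circle, from inverse stereographic projection. It
  uses only the arithmetic closure of \<open>C_k_on\<close> and covers \<open>w = 0\<close> without
  a case distinction.\<close>

lemma sphere_curve:
  fixes x c w :: "'a::real_inner"
  assumes R: "norm (x - c) = R" "R > 0" and w: "w \<bullet> (x - c) = 0"
  obtains n where "\<And>k. C_k_on k UNIV n" "n 0 = x" "(n has_vector_derivative w) (at 0)"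
    "\<And>t. norm (n t - c) = R"
proof -
  define s where "s t = t * t * ((norm w)\<^sup>2 / (4 * R\<^sup>2))" for t
  define n where "n t = c + inverse (1 + s t) *\<^sub>R ((1 - s t) *\<^sub>R (x - c) + t *\<^sub>R w)" for t
  have s0: "s t \<ge> 0" for t by (simp add: s_def)
  have sC: "C_k_on k UNIV s" for k unfolding s_def by (intro C_k_on_intros) auto
  have "C_k_on k UNIV n" for k
    unfolding n_def using s0 by (intro C_k_on_intros C_k_on_inverse sC) (auto simp: add_nonneg_eq_0_iff)
  moreover have "n 0 = x" by (simp add: n_def s_def)
  moreover have "(n has_vector_derivative w) (at 0)"
    unfolding n_def s_def using R(2)
    by (auto intro!: derivative_eq_intros simp: has_vector_derivative_def[symmetric])
  moreover have "norm (n t - c) = R" for t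
  proof -
    have st: "4 * R\<^sup>2 * s t = t\<^sup>2 * (norm w)\<^sup>2" using R(2) by (simp add: s_def power2_eq_square)
    have "(norm ((1 - s t) *\<^sub>R (x - c) + t *\<^sub>R w))\<^sup>2 = (1 - s t)\<^sup>2 * R\<^sup>2 + t\<^sup>2 * (norm w)\<^sup>2"
    proof -
      have "(norm (a *\<^sub>R y + b *\<^sub>R w))\<^sup>2 = a\<^sup>2 * (norm y)\<^sup>2 + b\<^sup>2 * (norm w)\<^sup>2" if "w \<bullet> y = 0" for a b y
        using that unfolding power2_norm_eq_inner
        by (simp add: inner_add inner_commute power2_eq_square)
      from this[OF w] show ?thesis unfolding R(1) .
    qed
    also have "\<dots> = ((1 + s t) * R)\<^sup>2" by (simp flip: st) (simp add: power2_eq_square algebra_simps)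
    finally have "norm ((1 - s t) *\<^sub>R (x - c) + t *\<^sub>R w) = (1 + s t) * R"
      by (rule power2_eq_imp_eq) (use s0[of t] R in auto)
    then show ?thesis using s0[of t] by (simp add: n_def)
  qed
  ultimately show thesis using that by blast
qed

section \<open>Alternating forms on the real vector space \<open>\<complex>\<^sup>2\<close>\<close>

definition altform :: "(c2 \<Rightarrow> c2 \<Rightarrow> real) \<Rightarrow> bool" where
  "altform B \<longleftrightarrow> bilinear B \<and> (\<forall>v. B v v = 0)"

abbreviation "e1 \<equiv> (1, 0) :: c2"
abbreviation "e2 \<equiv> (\<i>, 0) :: c2"
abbreviation "e3 \<equiv> (0, 1) :: c2"
abbreviation "e4 \<equiv> (0, \<i>) :: c2"

text \<open>The self-dual part of the form, up to scale: the first coordinate is the component along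
  the standard Kaehler form, the second the (2,0) component. With these signs the diagonal torus
  acts by \<open>tw\<close>.\<close>

definition jform :: "(c2 \<Rightarrow> c2 \<Rightarrow> real) \<Rightarrow> j3" where
  "jform B = (B e1 e2 + B e3 e4, Complex (B e1 e3 - B e2 e4) (- (B e1 e4 + B e2 e3)))"

text \<open>The Pfaffian, the coefficient of half the square of the form. Its sign tells whether the
  form induces the standard orientation.\<close>

definition pf :: "(c2 \<Rightarrow> c2 \<Rightarrow> real) \<Rightarrow> real" where
  "pf B = B e1 e2 * B e3 e4 - B e1 e3 * B e2 e4 + B e1 e4 * B e2 e3"

lemma altform_skew: "altform B \<Longrightarrow> B v u = - B u v"
proof -
  assume B: "altform B"
  then have b: "bilinear B" and a: "\<And>v. B v v = 0" by (auto simp: altform_def)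
  have "B (u + v) (u + v) = B u u + B u v + B v u + B v v"
    by (simp add: bilinear_ladd[OF b] bilinear_radd[OF b])
  then show ?thesis using a by simp
qed

lemma altform_expand:
  assumes B: "altform B"
  shows "B u v =
    (Re (fst u) * Im (fst v) - Im (fst u) * Re (fst v)) * B e1 e2 +
    (Re (fst u) * Re (snd v) - Re (snd u) * Re (fst v)) * B e1 e3 +
    (Re (fst u) * Im (snd v) - Im (snd u) * Re (fst v)) * B e1 e4 +
    (Im (fst u) * Re (snd v) - Re (snd u) * Im (fst v)) * B e2 e3 +
    (Im (fst u) * Im (snd v) - Im (snd u) * Im (fst v)) * B e2 e4 +
    (Re (snd u) * Im (snd v) - Im (snd u) * Re (snd v)) * B e3 e4"
proof -
  have b: "bilinear B" and a: "\<And>v. B v v = 0" using B by (auto simp: altform_def)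
  have dec: "x = Re (fst x) *\<^sub>R e1 + Im (fst x) *\<^sub>R e2 + Re (snd x) *\<^sub>R e3 + Im (snd x) *\<^sub>R e4" for x :: c2
    by (simp add: prod_eq_iff complex_eq_iff)
  have sk: "B e2 e1 = - B e1 e2" "B e3 e1 = - B e1 e3" "B e4 e1 = - B e1 e4" "B e3 e2 = - B e2 e3"
    "B e4 e2 = - B e2 e4" "B e4 e3 = - B e3 e4"
    by (rule altform_skew[OF B])+
  have gen: "B (p1 *\<^sub>R e1 + p2 *\<^sub>R e2 + p3 *\<^sub>R e3 + p4 *\<^sub>R e4) (q1 *\<^sub>R e1 + q2 *\<^sub>R e2 + q3 *\<^sub>R e3 + q4 *\<^sub>R e4) =
     (p1 * q2 - p2 * q1) * B e1 e2 + (p1 * q3 - p3 * q1) * B e1 e3 + (p1 * q4 - p4 * q1) * B e1 e4 +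
     (p2 * q3 - p3 * q2) * B e2 e3 + (p2 * q4 - p4 * q2) * B e2 e4 + (p3 * q4 - p4 * q3) * B e3 e4"
    for p1 p2 p3 p4 q1 q2 q3 q4
    unfolding bilinear_ladd[OF b] bilinear_radd[OF b] bilinear_lmul[OF b] bilinear_rmul[OF b] a sk
    by (simp add: algebra_simps)
  show ?thesis
    by (rule trans[OF arg_cong2[where f = B, OF dec[of u] dec[of v]] gen])
qed

lemma altform_pullback:
  assumes "altform B" "linear f" shows "altform (\<lambda>u v. B (f u) (f v))"
proof -
  have b: "bilinear B" and a: "\<And>v. B v v = 0" using assms by (auto simp: altform_def)
  have "bilinear (\<lambda>u v. B (f u) (f v))"
    unfolding bilinear_def
    by (intro conjI allI linearI)
      (simp_all add: linear_add[OF assms(2)] linear_cmul[OF assms(2)] bilinear_ladd[OF b] bilinear_radd[OF b]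
        bilinear_lmul[OF b] bilinear_rmul[OF b])
  then show ?thesis using a by (simp add: altform_def)
qed

lemma norm_jform: "(norm (jform B))\<^sup>2 = (B e1 e2)\<^sup>2 + (B e3 e4)\<^sup>2 + (B e1 e3)\<^sup>2 + (B e2 e4)\<^sup>2
   + (B e1 e4)\<^sup>2 + (B e2 e3)\<^sup>2 + 2 * pf B"
  unfolding norm_j3_sq cmod_sq jform_def pf_def by (simp add: power2_eq_square algebra_simps)

text \<open>By \<open>norm_jform\<close> the squared norm is a sum of squares plus twice the
  Pfaffian. This is where orientation enters: with a negative Pfaffian the self-dual part may
  vanish.\<close>

lemma jform_nonzero: "pf B > 0 \<Longrightarrow> jform B \<noteq> 0"
proof -
  assume "pf B > 0"
  then have "(norm (jform B))\<^sup>2 > 0" unfolding norm_jform by (intro add_nonneg_pos) auto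
  then show ?thesis by auto
qed

text \<open>The rows of the dual matrix are mapped by \<open>B\<close> to multiples of the Pfaffian.\<close>

lemma pf_nonzero:
  assumes B: "altform B" and nd: "\<And>v. v \<noteq> 0 \<Longrightarrow> \<exists>w. B v w \<noteq> 0"
  shows "pf B \<noteq> 0"
proof
  assume p: "pf B = 0"
  define w12 w13 w14 w23 w24 w34 where w: "w12 = B e1 e2" "w13 = B e1 e3" "w14 = B e1 e4"
    "w23 = B e2 e3" "w24 = B e2 e4" "w34 = B e3 e4"
  have p': "w12 * w34 - w13 * w24 + w14 * w23 = 0" using p by (simp add: pf_def w)
  have ker: "v = 0" if "\<And>u. B v u = 0" for v using nd that by blast
  have k1: "(Complex 0 w34, Complex (-w24) w23) = (0::c2)"
  proof (rule ker)
    fix u :: c2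
    have "B (Complex 0 w34, Complex (-w24) w23) u = - Re (fst u) * (w12 * w34 - w13 * w24 + w14 * w23)"
      by (subst altform_expand[OF B]) (simp add: w[symmetric] algebra_simps)
    then show "B (Complex 0 w34, Complex (-w24) w23) u = 0" using p' by simp
  qed
  have k2: "(Complex (-w34) 0, Complex w14 (-w13)) = (0::c2)"
  proof (rule ker)
    fix u :: c2
    have "B (Complex (-w34) 0, Complex w14 (-w13)) u = - Im (fst u) * (w12 * w34 - w13 * w24 + w14 * w23)"
      by (subst altform_expand[OF B]) (simp add: w[symmetric] algebra_simps)
    then show "B (Complex (-w34) 0, Complex w14 (-w13)) u = 0" using p' by simp
  qed
  have k3: "(Complex w24 (-w14), Complex 0 w12) = (0::c2)"
  proof (rule ker)
    fix u :: c2
    have "B (Complex w24 (-w14), Complex 0 w12) u = - Re (snd u) * (w12 * w34 - w13 * w24 + w14 * w23)"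
      by (subst altform_expand[OF B]) (simp add: w[symmetric] algebra_simps)
    then show "B (Complex w24 (-w14), Complex 0 w12) u = 0" using p' by simp
  qed
  have "w34 = 0" "w24 = 0" "w23 = 0" "w14 = 0" "w13 = 0"
    using k1 k2 by (auto simp: prod_eq_iff complex_eq_iff)
  moreover have "w12 = 0" using k3 by (auto simp: prod_eq_iff complex_eq_iff)
  ultimately have "B e1 u = 0" for u
    by (subst altform_expand[OF B]) (simp add: w[symmetric])
  then have "e1 = 0" by (rule ker)
  then show False by (simp add: zero_prod_def)
qed

text \<open>The Kaehler component is invariant under unitary maps, and the (2,0) component is
  multiplied by the determinant.\<close>

lemma jform_torus:
  assumes B: "altform B" and u: "cmod u1 = 1" "cmod u2 = 1"
  shows "jform (\<lambda>v w. B (u1 * fst v, u2 * snd v) (u1 * fst w, u2 * snd w)) = tw (u1 * u2) (jform B)"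
proof -
  have 1: "(Re u1)\<^sup>2 + (Im u1)\<^sup>2 = 1" "(Re u2)\<^sup>2 + (Im u2)\<^sup>2 = 1"
    using u cmod_sq[of u1] cmod_sq[of u2] by simp_all
  have X: "fst (jform (\<lambda>v w. B (u1 * fst v, u2 * snd v) (u1 * fst w, u2 * snd w)))
     = ((Re u1)\<^sup>2 + (Im u1)\<^sup>2) * B e1 e2 + ((Re u2)\<^sup>2 + (Im u2)\<^sup>2) * B e3 e4"
    unfolding jform_def fst_conv
    by (subst (1 2) altform_expand[OF B]) (simp add: power2_eq_square algebra_simps)
  have Z: "snd (jform (\<lambda>v w. B (u1 * fst v, u2 * snd v) (u1 * fst w, u2 * snd w))) = u1 * u2 * snd (jform B)"
    unfolding jform_def snd_conv
    by (subst (1 2 3 4) altform_expand[OF B]) (simp add: complex_eq_iff algebra_simps)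
  show ?thesis using X Z unfolding 1 by (simp add: tw_def prod_eq_iff jform_def)
qed

lemma linear_qmul: "linear (\<lambda>v. h \<otimes>\<^sub>q v)" "linear (\<lambda>v. v \<otimes>\<^sub>q h)"
  by (auto intro!: linearI simp: qmul_def prod_eq_iff complex_eq_iff algebra_simps)

text \<open>Left multiplications by unit quaternions are unitary of determinant 1, so they fix the
  Kaehler and the (2,0) component.\<close>

lemma jform_left:
  assumes B: "altform B" and h: "h \<in> S3"
  shows "jform (\<lambda>v w. B (h \<otimes>\<^sub>q v) (h \<otimes>\<^sub>q w)) = jform B"
proof -
  define n where "n = (Re (fst h))\<^sup>2 + (Im (fst h))\<^sup>2 + (Re (snd h))\<^sup>2 + (Im (snd h))\<^sup>2"
  have n: "n = 1" using h unfolding mem_S3_iff cmod_sq n_def by simp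
  have "jform (\<lambda>v w. B (h \<otimes>\<^sub>q v) (h \<otimes>\<^sub>q w)) = n *\<^sub>R jform B"
    unfolding jform_def
    by (subst (1 2 3 4 5 6) altform_expand[OF B])
      (simp add: qmul_def n_def prod_eq_iff complex_eq_iff power2_eq_square algebra_simps)
  then show ?thesis by (simp add: n)
qed

text \<open>The rotation that left multiplication by g induces on Hopf images, written so as to be
  linear in j: self-dual parts need not have unit length.\<close>

definition act :: "c2 \<Rightarrow> j3 \<Rightarrow> j3" where
  "act g j = (((cmod (fst g))\<^sup>2 - (cmod (snd g))\<^sup>2) * fst j - 2 * Re (fst g * snd g * cnj (snd j)),
     2 * cnj (fst g) * snd g * of_real (fst j) + (cnj (fst g))\<^sup>2 * snd j - (snd g)\<^sup>2 * cnj (snd j))"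

lemma hopf_qmul: "hopf (g \<otimes>\<^sub>q x) = act g (hopf x)"
proof -
  obtain a b c d where g: "g = (Complex a b, Complex c d)" by (metis complex.exhaust prod.exhaust)
  obtain p q r s where x: "x = (Complex p q, Complex r s)" by (metis complex.exhaust prod.exhaust)
  show ?thesis
    unfolding act_def hopf_def qmul_def cmod_sq g x
    by (simp add: prod_eq_iff complex_eq_iff power2_eq_square) (simp add: algebra_simps)
qed

text \<open>Right multiplications supply the other factor of SO(4), which rotates the self-dual
  forms. The quaternion on the right-hand side is h seen through the identification of self-dual
  forms with the target of \<open>hopf\<close>.\<close>

lemma jform_right:
  assumes B: "altform B"
  shows "jform (\<lambda>v w. B (v \<otimes>\<^sub>q h) (w \<otimes>\<^sub>q h)) = act (cnj (fst h), - \<i> * cnj (snd h)) (jform B)"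
proof -
  have E: "B (u \<otimes>\<^sub>q h) (v \<otimes>\<^sub>q h) =
    (Re (fst (u \<otimes>\<^sub>q h)) * Im (fst (v \<otimes>\<^sub>q h)) - Im (fst (u \<otimes>\<^sub>q h)) * Re (fst (v \<otimes>\<^sub>q h))) * B e1 e2 +
    (Re (fst (u \<otimes>\<^sub>q h)) * Re (snd (v \<otimes>\<^sub>q h)) - Re (snd (u \<otimes>\<^sub>q h)) * Re (fst (v \<otimes>\<^sub>q h))) * B e1 e3 +
    (Re (fst (u \<otimes>\<^sub>q h)) * Im (snd (v \<otimes>\<^sub>q h)) - Im (snd (u \<otimes>\<^sub>q h)) * Re (fst (v \<otimes>\<^sub>q h))) * B e1 e4 +
    (Im (fst (u \<otimes>\<^sub>q h)) * Re (snd (v \<otimes>\<^sub>q h)) - Re (snd (u \<otimes>\<^sub>q h)) * Im (fst (v \<otimes>\<^sub>q h))) * B e2 e3 +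
    (Im (fst (u \<otimes>\<^sub>q h)) * Im (snd (v \<otimes>\<^sub>q h)) - Im (snd (u \<otimes>\<^sub>q h)) * Im (fst (v \<otimes>\<^sub>q h))) * B e2 e4 +
    (Re (snd (u \<otimes>\<^sub>q h)) * Im (snd (v \<otimes>\<^sub>q h)) - Im (snd (u \<otimes>\<^sub>q h)) * Re (snd (v \<otimes>\<^sub>q h))) * B e3 e4"
    for u v by (rule altform_expand[OF B])
  obtain a b c d where h: "h = (Complex a b, Complex c d)" by (metis complex.exhaust prod.exhaust)
  show ?thesis
    unfolding jform_def act_def cmod_sq E
    by (simp add: qmul_def h prod_eq_iff complex_eq_iff power2_eq_square) (simp add: algebra_simps)
qed

text \<open>The real-linear map involved has determinant -1.\<close>

lemma pf_conj_snd:
  assumes B: "altform B"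
  shows "pf (\<lambda>v w. B (fst v, cnj (snd v)) (fst w, cnj (snd w))) = - pf B"
proof -
  have E: "B (1, cnj 0) v = B e1 v" "B (\<i>, cnj 0) v = B e2 v" "B v (\<i>, cnj 0) = B v e2" "B (0, cnj 1) v = B e3 v"
    "B v (0, cnj 1) = B v e3" "B v (0, cnj \<i>) = - B v e4" for v
    using altform_expand[OF B, of v "(0, cnj \<i>)"] altform_expand[OF B, of v e4] by simp_all
  show ?thesis by (simp only: pf_def fst_conv snd_conv E)
qed

section \<open>Continuous nondegenerate alternating forms on a submanifold\<close>

text \<open>The common weakening of the structures to be excluded. Continuity is asked of a local
  extension with fixed ambient arguments, because the tangent space varies with the point and the
  form is meaningful only there.\<close>

definition form_field :: "'a::euclidean_space set \<Rightarrow> ('a \<Rightarrow> 'a \<Rightarrow> 'a \<Rightarrow> real) \<Rightarrow> bool" where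
  "form_field M \<omega> \<longleftrightarrow>
     (\<forall>x\<in>M. \<exists>U \<Omega>. open U \<and> x \<in> U \<and> (\<forall>y\<in>M \<inter> U. bilinear (\<Omega> y)) \<and>
        (\<forall>u v. continuous_on (M \<inter> U) (\<lambda>y. \<Omega> y u v)) \<and>
        (\<forall>y\<in>M \<inter> U. \<forall>u\<in>tangent_space M y. \<forall>v\<in>tangent_space M y. \<Omega> y u v = \<omega> y u v)) \<and>
     (\<forall>x\<in>M. \<forall>u\<in>tangent_space M x. \<omega> x u u = 0) \<and> nondegenerate_two_form M \<omega>"

definition frame :: "'a::euclidean_space set \<Rightarrow> 'a \<Rightarrow> (c2 \<Rightarrow> 'a) \<Rightarrow> bool" where
  "frame M x e \<longleftrightarrow> x \<in> M \<and> linear e \<and> inj e \<and> range e = tangent_space M x"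

lemma form_field_local:
  assumes "form_field M \<omega>" "x \<in> M"
  obtains U \<Omega> where "open U" "x \<in> U" "\<And>y. y \<in> M \<Longrightarrow> y \<in> U \<Longrightarrow> bilinear (\<Omega> y)"
    "\<And>u v. continuous_on (M \<inter> U) (\<lambda>y. \<Omega> y u v)"
    "\<And>y u v. y \<in> M \<Longrightarrow> y \<in> U \<Longrightarrow> u \<in> tangent_space M y \<Longrightarrow> v \<in> tangent_space M y \<Longrightarrow> \<Omega> y u v = \<omega> y u v"
proof -
  from assms(1)[unfolded form_field_def] assms(2)
  have "\<exists>U \<Omega>. open U \<and> x \<in> U \<and> (\<forall>y\<in>M \<inter> U. bilinear (\<Omega> y)) \<and>
        (\<forall>u v. continuous_on (M \<inter> U) (\<lambda>y. \<Omega> y u v)) \<and>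
        (\<forall>y\<in>M \<inter> U. \<forall>u\<in>tangent_space M y. \<forall>v\<in>tangent_space M y. \<Omega> y u v = \<omega> y u v)"
    by (elim conjE) (erule (1) bspec)
  then show thesis
  proof (elim exE conjE)
    fix U \<Omega>
    assume "open U" "x \<in> U" "\<forall>y\<in>M \<inter> U. bilinear (\<Omega> y)"
      "\<forall>u v. continuous_on (M \<inter> U) (\<lambda>y. \<Omega> y u v)"
      "\<forall>y\<in>M \<inter> U. \<forall>u\<in>tangent_space M y. \<forall>v\<in>tangent_space M y. \<Omega> y u v = \<omega> y u v"
    then show thesis by (intro that[of U \<Omega>]) auto
  qed
qed

lemma frame_form:
  assumes w: "form_field M \<omega>" and e: "frame M x e"
  shows "altform (\<lambda>u v. \<omega> x (e u) (e v))" "pf (\<lambda>u v. \<omega> x (e u) (e v)) \<noteq> 0"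
proof -
  have x: "x \<in> M" and le: "linear e" and ie: "inj e" and re: "range e = tangent_space M x"
    using e by (auto simp: frame_def)
  have T: "e v \<in> tangent_space M x" for v using re by blast
  obtain U \<Omega> where "x \<in> U" and b: "\<And>y. y \<in> M \<Longrightarrow> y \<in> U \<Longrightarrow> bilinear (\<Omega> y)"
    and eq: "\<And>y u v. y \<in> M \<Longrightarrow> y \<in> U \<Longrightarrow> u \<in> tangent_space M y \<Longrightarrow> v \<in> tangent_space M y \<Longrightarrow> \<Omega> y u v = \<omega> y u v"
    using form_field_local[OF w x] by metis
  have wb: "\<omega> x (e u) (e v) = \<Omega> x (e u) (e v)" for u v using eq[OF x \<open>x \<in> U\<close> T T] by simp
  have bx: "bilinear (\<Omega> x)" using b[OF x \<open>x \<in> U\<close>] .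
  have "bilinear (\<lambda>u v. \<Omega> x (e u) (e v))"
    unfolding bilinear_def
    by (intro conjI allI linearI)
      (simp_all add: linear_add[OF le] linear_cmul[OF le] bilinear_ladd[OF bx] bilinear_radd[OF bx]
        bilinear_lmul[OF bx] bilinear_rmul[OF bx])
  moreover have "\<omega> x (e v) (e v) = 0" for v using w x T by (auto simp: form_field_def)
  ultimately show alt: "altform (\<lambda>u v. \<omega> x (e u) (e v))" unfolding altform_def wb by blast
  show "pf (\<lambda>u v. \<omega> x (e u) (e v)) \<noteq> 0"
  proof (rule pf_nonzero[OF alt])
    fix v :: c2 assume "v \<noteq> 0"
    then have "e v \<noteq> 0" using ie le by (metis injD linear_0)
    then obtain t where "t \<in> tangent_space M x" "\<omega> x (e v) t \<noteq> 0"
      using w x T unfolding form_field_def nondegenerate_two_form_def by metis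
    then show "\<exists>w. \<omega> x (e v) (e w) \<noteq> 0" using re by (metis rangeE)
  qed
qed

text \<open>Expanding both arguments in the ambient basis turns continuity for fixed arguments into
  joint continuity.\<close>

lemma form_field_continuous:
  fixes X :: "'s::metric_space \<Rightarrow> 'a::euclidean_space"
  assumes w: "form_field M \<omega>" and X: "continuous_on S X" "\<And>s. s \<in> S \<Longrightarrow> X s \<in> M"
    and u: "continuous_on S u" "\<And>s. s \<in> S \<Longrightarrow> u s \<in> tangent_space M (X s)"
    and v: "continuous_on S v" "\<And>s. s \<in> S \<Longrightarrow> v s \<in> tangent_space M (X s)"
  shows "continuous_on S (\<lambda>s. \<omega> (X s) (u s) (v s))"
  unfolding continuous_on_eq_continuous_within
proof
  fix s0 assume s0: "s0 \<in> S"
  obtain U \<Omega> where U: "open U" "X s0 \<in> U" and b: "\<And>y. y \<in> M \<Longrightarrow> y \<in> U \<Longrightarrow> bilinear (\<Omega> y)"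
    and c: "\<And>u v. continuous_on (M \<inter> U) (\<lambda>y. \<Omega> y u v)"
    and eq: "\<And>y u v. y \<in> M \<Longrightarrow> y \<in> U \<Longrightarrow> u \<in> tangent_space M y \<Longrightarrow> v \<in> tangent_space M y \<Longrightarrow> \<Omega> y u v = \<omega> y u v"
    using form_field_local[OF w X(2)[OF s0]] by metis
  obtain V where V: "open V" "V \<inter> S = X -` U \<inter> S"
    using X(1) U(1) unfolding continuous_on_open_invariant by blast
  have inV: "X s \<in> M" "X s \<in> U" if "s \<in> S \<inter> V" for s using that V(2) X(2) by auto
  have expand: "\<omega> (X s) (u s) (v s) = (\<Sum>i\<in>Basis. \<Sum>j\<in>Basis. (u s \<bullet> i) * ((v s \<bullet> j) * \<Omega> (X s) i j))"
    if s: "s \<in> S \<inter> V" for s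
  proof -
    have bs: "bilinear (\<Omega> (X s))" using b inV[OF s] by blast
    have l1: "linear (\<lambda>a. \<Omega> (X s) a z)" and l2: "linear (\<Omega> (X s) a)" for a z
      using bs by (auto simp: bilinear_def)
    have "\<omega> (X s) (u s) (v s) = \<Omega> (X s) (u s) (v s)"
      using eq[OF inV[OF s] u(2) v(2)] s by simp
    also have "\<dots> = \<Omega> (X s) (\<Sum>i\<in>Basis. (u s \<bullet> i) *\<^sub>R i) (\<Sum>j\<in>Basis. (v s \<bullet> j) *\<^sub>R j)"
      by (simp add: euclidean_representation)
    also have "\<dots> = (\<Sum>i\<in>Basis. \<Omega> (X s) ((u s \<bullet> i) *\<^sub>R i) (\<Sum>j\<in>Basis. (v s \<bullet> j) *\<^sub>R j))"
      using linear_sum[OF l1] by blast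
    also have "\<dots> = (\<Sum>i\<in>Basis. \<Sum>j\<in>Basis. \<Omega> (X s) ((u s \<bullet> i) *\<^sub>R i) ((v s \<bullet> j) *\<^sub>R j))"
      by (intro sum.cong refl linear_sum[OF l2])
    finally show ?thesis by (simp add: bilinear_lmul[OF bs] bilinear_rmul[OF bs] mult.left_commute)
  qed
  have "continuous_on (S \<inter> V) (\<lambda>s. \<Sum>i\<in>Basis. \<Sum>j\<in>Basis. (u s \<bullet> i) * ((v s \<bullet> j) * \<Omega> (X s) i j))"
    by (intro continuous_intros continuous_on_compose2[OF c] continuous_on_subset[OF u(1)]
        continuous_on_subset[OF v(1)] continuous_on_subset[OF X(1)]) (use inV in auto)
  then have "continuous_on (S \<inter> V) (\<lambda>s. \<omega> (X s) (u s) (v s))"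
    by (rule continuous_on_eq) (simp add: expand)
  moreover have s0V: "s0 \<in> S \<inter> V" using s0 V(2) U(2) by blast
  ultimately have "continuous (at s0 within (S \<inter> V)) (\<lambda>s. \<omega> (X s) (u s) (v s))"
    by (simp add: continuous_on_eq_continuous_within)
  moreover have "at s0 within (S \<inter> V) = at s0 within S"
    by (rule at_within_nhd[OF _ V(1)]) (use s0V in auto)
  ultimately show "continuous (at s0 within S) (\<lambda>s. \<omega> (X s) (u s) (v s))" by simp
qed

lemma continuous_jform_pf:
  fixes X :: "'s::metric_space \<Rightarrow> 'a::euclidean_space"
  assumes w: "form_field M \<omega>" and X: "continuous_on S X" 
    and e: "\<And>v. continuous_on S (\<lambda>s. e s v)" "\<And>s. s \<in> S \<Longrightarrow> frame M (X s) (e s)"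
  shows "continuous_on S (\<lambda>s. jform (\<lambda>u v. \<omega> (X s) (e s u) (e s v)))"
    "continuous_on S (\<lambda>s. pf (\<lambda>u v. \<omega> (X s) (e s u) (e s v)))"
proof -
  have T: "X s \<in> M" "e s v \<in> tangent_space M (X s)" if "s \<in> S" for s v
    using e(2)[OF that] unfolding frame_def by blast+
  have *: "continuous_on S (\<lambda>s. \<omega> (X s) (e s u) (e s v))" for u v
    by (rule form_field_continuous[OF w X T(1) e(1) T(2) e(1) T(2)])
  show "continuous_on S (\<lambda>s. jform (\<lambda>u v. \<omega> (X s) (e s u) (e s v)))"
    unfolding jform_def Complex_eq by (intro continuous_intros *)
  show "continuous_on S (\<lambda>s. pf (\<lambda>u v. \<omega> (X s) (e s u) (e s v)))"
    unfolding pf_def by (intro continuous_intros *)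
qed

text \<open>The Pfaffian is continuous along the family and never 0, by nondegeneracy, so the
  intermediate value theorem keeps its sign.\<close>

lemma pf_pos_connected:
  fixes X :: "'s::metric_space \<Rightarrow> 'a::euclidean_space"
  assumes w: "form_field M \<omega>" and X: "continuous_on S X" 
    and e: "\<And>v. continuous_on S (\<lambda>s. e s v)" "\<And>s. s \<in> S \<Longrightarrow> frame M (X s) (e s)"
    and S: "connected S" "s0 \<in> S" "pf (\<lambda>u v. \<omega> (X s0) (e s0 u) (e s0 v)) > 0" and s: "s \<in> S"
  shows "pf (\<lambda>u v. \<omega> (X s) (e s u) (e s v)) > 0"
proof (rule ccontr)
  let ?p = "\<lambda>s. pf (\<lambda>u v. \<omega> (X s) (e s u) (e s v))"
  assume "\<not> ?p s > 0"
  then have le: "?p s \<le> 0" "0 \<le> ?p s0" using S(3) by simp_all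
  have con: "connected (?p ` S)" by (rule connected_continuous_image[OF continuous_jform_pf(2)[OF w X e] S(1)])
  have "0 \<in> ?p ` S"
    by (rule connectedD_interval[OF con imageI[OF s] imageI[OF S(2)] le])
  then show False using frame_form(2)[OF w e(2)] by auto
qed

lemma smooth_curve_at_linear:
  assumes L: "bounded_linear L" and \<gamma>: "smooth_curve_at N x v \<gamma>" and im: "\<And>y. y \<in> N \<Longrightarrow> c + L y \<in> M"
  shows "smooth_curve_at M (c + L x) (L v) (\<lambda>t. c + L (\<gamma> t))"
proof -
  obtain \<epsilon> where \<epsilon>: "\<epsilon> > 0" "smooth_on {-\<epsilon><..<\<epsilon>} \<gamma>" "\<gamma> ` {-\<epsilon><..<\<epsilon>} \<subseteq> N" "\<gamma> 0 = x"
    "(\<gamma> has_vector_derivative v) (at 0)"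
    using \<gamma> by (auto simp: smooth_curve_at_def)
  have "smooth_on {-\<epsilon><..<\<epsilon>} (\<lambda>t. c + L (\<gamma> t))"
    unfolding smooth_on_def
  proof
    fix k
    have "C_k_on k {-\<epsilon><..<\<epsilon>} \<gamma>" using \<epsilon>(2) by (simp add: smooth_on_def)
    then show "C_k_on k {-\<epsilon><..<\<epsilon>} (\<lambda>t. c + L (\<gamma> t))"
      by (intro C_k_on_add[OF _ C_k_on_const C_k_on_compose_linear[OF _ L]]) auto
  qed
  moreover have "((\<lambda>t. c + L (\<gamma> t)) has_vector_derivative L v) (at 0)"
    using bounded_linear.has_vector_derivative[OF L \<epsilon>(5)] by (auto intro: derivative_eq_intros)
  ultimately show ?thesis unfolding smooth_curve_at_def using \<epsilon> im by blast
qed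

text \<open>Made for two uses: the embedding of the coordinates into matrices, where
  \<open>L\<close> is only injective, and the linear symmetries. A curve in \<open>M\<close> is
  recovered by \<open>L\<close> from its image under \<open>R\<close>, hence its velocity lies in
  the range of \<open>L\<close>.\<close>

lemma tangent_space_affine:
  assumes L: "bounded_linear L" and R: "bounded_linear R" "\<And>y. R (L y) = y"
    and M: "M = (\<lambda>y. c + L y) ` N"
  shows "tangent_space M (c + L x) = L ` tangent_space N x"
proof (intro equalityI subsetI)
  fix v assume "v \<in> tangent_space M (c + L x)"
  then obtain \<gamma> where \<gamma>: "smooth_curve_at M (c + L x) v \<gamma>" by (auto simp: tangent_space_def)
  have lin: "linear L" "linear R" using L R(1) bounded_linear.linear by blast+
  have "smooth_curve_at N (- R c + R (c + L x)) (R v) (\<lambda>t. - R c + R (\<gamma> t))"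
    by (rule smooth_curve_at_linear[OF R(1) \<gamma>]) (auto simp: M linear_add[OF lin(2)] R(2))
  then have "R v \<in> tangent_space N x"
    by (auto simp: tangent_space_def linear_add[OF lin(2)] R(2))
  moreover have "L (R v) = v"
  proof -
    obtain \<epsilon> where \<epsilon>: "\<epsilon> > 0" "\<gamma> ` {-\<epsilon><..<\<epsilon>} \<subseteq> M" "(\<gamma> has_vector_derivative v) (at 0)"
      using \<gamma> by (auto simp: smooth_curve_at_def)
    have eq: "c + L (- R c + R (\<gamma> t)) = \<gamma> t" if "t \<in> {-\<epsilon><..<\<epsilon>}" for t
      using \<epsilon>(2) that by (auto simp: M linear_add[OF lin(2)] R(2) linear_neg[OF lin(2)] dest!: subsetD)
    have "((\<lambda>t. c + L (- R c + R (\<gamma> t))) has_vector_derivative L (R v)) (at 0)"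
      using bounded_linear.has_vector_derivative[OF L has_vector_derivative_add[OF has_vector_derivative_const bounded_linear.has_vector_derivative[OF R(1) \<epsilon>(3)]], of "- R c"]
      by (auto intro: derivative_eq_intros)
    then have "(\<gamma> has_vector_derivative L (R v)) (at 0)"
      by (rule has_vector_derivative_transform_within_open[where S = "{-\<epsilon><..<\<epsilon>}"]) (use \<epsilon>(1) eq in auto)
    then show ?thesis using \<epsilon>(3) vector_derivative_unique_at by blast
  qed
  ultimately show "v \<in> L ` tangent_space N x" by (metis image_eqI)
next
  fix v assume "v \<in> L ` tangent_space N x"
  then show "v \<in> tangent_space M (c + L x)"
    unfolding tangent_space_def using smooth_curve_at_linear[OF L, of N x _ _ c M] M by blast
qed

lemma form_field_affine:
  assumes w: "form_field M \<omega>"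
    and L: "bounded_linear L" and R: "bounded_linear R" "\<And>y. R (L y) = y"
    and M: "M = (\<lambda>y. c + L y) ` N"
  shows "form_field N (\<lambda>x u v. \<omega> (c + L x) (L u) (L v))"
proof -
  note T = tangent_space_affine[OF L R M]
  have lin: "linear L" using L bounded_linear.linear by blast
  have inM: "c + L x \<in> M" if "x \<in> N" for x using M that by blast
  have Lc: "continuous_on A (\<lambda>x. c + L x)" for A
    by (intro continuous_intros linear_continuous_on L)
  show ?thesis
    unfolding form_field_def
  proof (intro conjI ballI)
    fix x assume x: "x \<in> N"
    obtain U \<Omega> where U: "open U" "c + L x \<in> U" and b: "\<And>y. y \<in> M \<Longrightarrow> y \<in> U \<Longrightarrow> bilinear (\<Omega> y)"
      and cont: "\<And>u v. continuous_on (M \<inter> U) (\<lambda>y. \<Omega> y u v)"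
      and eq: "\<And>y u v. y \<in> M \<Longrightarrow> y \<in> U \<Longrightarrow> u \<in> tangent_space M y \<Longrightarrow> v \<in> tangent_space M y \<Longrightarrow> \<Omega> y u v = \<omega> y u v"
      using form_field_local[OF w inM[OF x]] by metis
    let ?V = "(\<lambda>x. c + L x) -` U" and ?O = "\<lambda>y u v. \<Omega> (c + L y) (L u) (L v)"
    have "open ?V" using open_vimage[OF U(1) Lc] .
    moreover have "bilinear (?O y)" if "y \<in> N \<inter> ?V" for y
    proof -
      have bx: "bilinear (\<Omega> (c + L y))" using b inM that by auto
      show ?thesis unfolding bilinear_def
        by (intro conjI allI linearI)
          (simp_all add: linear_add[OF lin] linear_cmul[OF lin] bilinear_ladd[OF bx] bilinear_radd[OF bx]
            bilinear_lmul[OF bx] bilinear_rmul[OF bx])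
    qed
    moreover have "continuous_on (N \<inter> ?V) (\<lambda>y. ?O y u v)" for u v
      by (rule continuous_on_compose2[OF cont Lc]) (use inM in auto)
    moreover have "?O y u v = \<omega> (c + L y) (L u) (L v)"
      if "y \<in> N \<inter> ?V" "u \<in> tangent_space N y" "v \<in> tangent_space N y" for y u v
      by (rule eq) (use that inM T in auto)
    ultimately show "\<exists>U \<Omega>. open U \<and> x \<in> U \<and> (\<forall>y\<in>N \<inter> U. bilinear (\<Omega> y)) \<and>
        (\<forall>u v. continuous_on (N \<inter> U) (\<lambda>y. \<Omega> y u v)) \<and>
        (\<forall>y\<in>N \<inter> U. \<forall>u\<in>tangent_space N y. \<forall>v\<in>tangent_space N y. \<Omega> y u v = \<omega> (c + L y) (L u) (L v))"
      using U(2) by (intro exI[of _ ?V] exI[of _ ?O]) auto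
  next
    fix x u assume "x \<in> N" "u \<in> tangent_space N x"
    then show "\<omega> (c + L x) (L u) (L u) = 0" using w inM T by (auto simp: form_field_def)
  next
    show "nondegenerate_two_form N (\<lambda>x u v. \<omega> (c + L x) (L u) (L v))"
      unfolding nondegenerate_two_form_def
    proof (intro ballI impI)
      fix x u assume x: "x \<in> N" "u \<in> tangent_space N x" and z: "\<forall>v\<in>tangent_space N x. \<omega> (c + L x) (L u) (L v) = 0"
      then have "L u \<in> tangent_space M (c + L x)" "\<forall>v\<in>tangent_space M (c + L x). \<omega> (c + L x) (L u) v = 0"
        using T by auto
      then have "L u = 0" using w inM[OF x(1)] unfolding form_field_def nondegenerate_two_form_def by blast
      then show "u = 0" using R(2)[of u] R(2)[of 0] linear_0[OF lin] by metis
    qed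
  qed
qed

section \<open>Charts of the isospectral manifold\<close>

type_synonym P4 = "real \<times> complex \<times> real \<times> complex"

text \<open>Takes the place of the implicit function theorem: a differentiable inverse \<Phi> pulls
  curves of \<open>M\<close> back to the level set of \<open>q\<close>, and conversely every vector
  in the kernel of \<open>Q\<close> is the velocity of a given curve.\<close>

lemma tangent_chart:
  fixes \<Psi> :: "'a::euclidean_space \<Rightarrow> 'b::euclidean_space" and q :: "'a \<Rightarrow> 'c::real_normed_vector"
  assumes \<Psi>: "(\<Psi> has_derivative D) (at x)" and V: "open V" "\<Psi> x \<in> V"
    and \<Phi>: "\<Phi> differentiable (at (\<Psi> x))" "\<Phi> (\<Psi> x) = x"
    and bk: "\<And>A. A \<in> M \<Longrightarrow> A \<in> V \<Longrightarrow> \<Psi> (\<Phi> A) = A \<and> q (\<Phi> A) = 0"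
    and q: "(q has_derivative Q) (at x)"
    and curves: "\<And>w. Q w = 0 \<Longrightarrow> \<exists>\<gamma> U. open U \<and> 0 \<in> U \<and> (\<forall>k. C_k_on k U (\<lambda>t::real. \<Psi> (\<gamma> t))) \<and> \<gamma> 0 = x \<and>
          (\<gamma> has_vector_derivative w) (at 0) \<and> (\<forall>t\<in>U. \<Psi> (\<gamma> t) \<in> M)"
  shows "tangent_space M (\<Psi> x) = {D w | w. Q w = 0}"
proof (intro equalityI subsetI)
  fix v assume "v \<in> tangent_space M (\<Psi> x)"
  then obtain \<gamma> \<epsilon> where \<gamma>: "\<epsilon> > 0" "\<gamma> ` {-\<epsilon><..<\<epsilon>} \<subseteq> M" "\<gamma> 0 = \<Psi> x" "(\<gamma> has_vector_derivative v) (at 0)"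
    by (auto simp: tangent_space_def smooth_curve_at_def)
  have "isCont \<gamma> 0" using \<gamma>(4) by (rule has_vector_derivative_continuous)
  then have "\<forall>\<^sub>F t in nhds 0. \<gamma> t \<in> V"
    using V \<gamma>(3) by (simp add: isCont_def tendsto_def eventually_nhds_conv_at)
  moreover have "\<forall>\<^sub>F t in nhds 0. t \<in> {-\<epsilon><..<\<epsilon>}"
    using \<gamma>(1) by (intro eventually_nhds_in_open) auto
  ultimately have "\<forall>\<^sub>F t in nhds 0. \<gamma> t \<in> V \<and> \<gamma> t \<in> M"
    by eventually_elim (use \<gamma>(2) in auto)
  then obtain W where W: "open W" "0 \<in> W" "\<And>t. t \<in> W \<Longrightarrow> \<gamma> t \<in> V \<and> \<gamma> t \<in> M"
    by (auto simp: eventually_nhds)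
  obtain D' where D': "(\<Phi> has_derivative D') (at (\<Psi> x))" using \<Phi>(1) by (auto simp: differentiable_def)
  define w where "w = D' v"
  have n: "((\<lambda>t. \<Phi> (\<gamma> t)) has_vector_derivative w) (at 0)"
    using vector_derivative_diff_chain_within[of \<gamma> v 0 UNIV \<Phi> D'] \<gamma>(3,4) has_derivative_at_withinI[OF D']
    by (simp add: o_def w_def)
  have n0: "\<Phi> (\<gamma> 0) = x" using \<Phi>(2) \<gamma>(3) by simp
  have "((\<lambda>t. q (\<Phi> (\<gamma> t))) has_vector_derivative Q w) (at 0)"
    using vector_derivative_diff_chain_within[OF n, of q Q] has_derivative_at_withinI[OF q] n0 by (simp add: o_def)
  then have "((\<lambda>t. 0) has_vector_derivative Q w) (at 0)"
    by (rule has_vector_derivative_transform_within_open[OF _ W(1,2)]) (use bk W(3) in auto)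
  then have "Q w = 0" using vector_derivative_unique_at has_vector_derivative_const by blast
  have "((\<lambda>t. \<Psi> (\<Phi> (\<gamma> t))) has_vector_derivative D w) (at 0)"
    using vector_derivative_diff_chain_within[OF n, of \<Psi> D] has_derivative_at_withinI[OF \<Psi>] n0 by (simp add: o_def)
  then have "(\<gamma> has_vector_derivative D w) (at 0)"
    by (rule has_vector_derivative_transform_within_open[OF _ W(1,2)]) (use bk W(3) in auto)
  then have "v = D w" using \<gamma>(4) vector_derivative_unique_at by blast
  with \<open>Q w = 0\<close> show "v \<in> {D w | w. Q w = 0}" by blast
next
  fix v assume "v \<in> {D w | w. Q w = 0}"
  then obtain w where w: "v = D w" "Q w = 0" by blast
  obtain \<gamma> U where \<gamma>: "open U" "(0::real) \<in> U" "\<forall>k. C_k_on k U (\<lambda>t. \<Psi> (\<gamma> t))" "\<gamma> 0 = x"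
          "(\<gamma> has_vector_derivative w) (at 0)" "\<forall>t\<in>U. \<Psi> (\<gamma> t) \<in> M"
    using curves[OF w(2)] by blast
  obtain \<epsilon> where \<epsilon>: "\<epsilon> > 0" "ball 0 \<epsilon> \<subseteq> U" using \<gamma>(1,2) open_contains_ball by blast
  then have sub: "{-\<epsilon><..<\<epsilon>} \<subseteq> U" by (auto simp: ball_def dist_real_def subset_iff)
  have "((\<lambda>t. \<Psi> (\<gamma> t)) has_vector_derivative D w) (at 0)"
    using vector_derivative_diff_chain_within[OF \<gamma>(5), of \<Psi> D] has_derivative_at_withinI[OF \<Psi>] \<gamma>(4) by (simp add: o_def)
  moreover have "smooth_on {-\<epsilon><..<\<epsilon>} (\<lambda>t. \<Psi> (\<gamma> t))"
    using \<gamma>(3) C_k_on_subset[OF _ sub] by (auto simp: smooth_on_def)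
  ultimately have "smooth_curve_at M (\<Psi> x) v (\<lambda>t. \<Psi> (\<gamma> t))"
    unfolding smooth_curve_at_def using \<epsilon>(1) sub \<gamma>(4,6) w(1) by auto
  then show "v \<in> tangent_space M (\<Psi> x)" by (auto simp: tangent_space_def)
qed

locale spectrum =
  fixes l1 l2 l3 :: real
  assumes l12: "l1 < l2" and l23: "l2 < l3"
begin

text \<open>Coordinates \<open>(a\<^sub>1, b\<^sub>1, a\<^sub>3, b\<^sub>2)\<close>; the trace determines \<open>a\<^sub>2\<close>.  The characteristic polynomial
  agrees with \<open>(x - l1)(x - l2)(x - l3)\<close> iff the coefficients of \<open>x\<close> and the values at \<open>x = a\<^sub>1\<close> agree.\<close>

definition E2 :: "real \<Rightarrow> real \<Rightarrow> real" where
  "E2 a1 a3 = a1 * (l1 + l2 + l3 - a1 - a3) + a1 * a3 + (l1 + l2 + l3 - a1 - a3) * a3 - (l1 * l2 + l1 * l3 + l2 * l3)"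

definition tomei :: "P4 set" where
  "tomei = {(a1, b1, a3, b2). b1 \<bullet> b1 + b2 \<bullet> b2 = E2 a1 a3 \<and> (b1 \<bullet> b1) * (a1 - a3) = (a1 - l1) * (a1 - l2) * (l3 - a1)}"

text \<open>Compares the two polynomials at \<open>x = a3\<close>; the two defining equations
  already make them equal.\<close>

lemma tomei_third:
  assumes "(a1, b1, a3, b2) \<in> tomei"
  shows "(b2 \<bullet> b2) * (a1 - a3) = (a3 - l1) * (a3 - l2) * (a3 - l3)"
proof -
  have "b2 \<bullet> b2 = E2 a1 a3 - b1 \<bullet> b1" "(b1 \<bullet> b1) * (a1 - a3) = (a1 - l1) * (a1 - l2) * (l3 - a1)"
    using assms by (auto simp: tomei_def)
  then have "(b2 \<bullet> b2) * (a1 - a3) = E2 a1 a3 * (a1 - a3) - (a1 - l1) * (a1 - l2) * (l3 - a1)"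
    by (simp add: left_diff_distrib)
  then show ?thesis unfolding E2_def by (simp add: algebra_simps)
qed

lemma tomeiI:
  assumes "a1 \<noteq> a3" "(b1 \<bullet> b1) * (a1 - a3) = (a1 - l1) * (a1 - l2) * (l3 - a1)"
    "(b2 \<bullet> b2) * (a1 - a3) = (a3 - l1) * (a3 - l2) * (a3 - l3)"
  shows "(a1, b1, a3, b2) \<in> tomei"
proof -
  have "(b1 \<bullet> b1 + b2 \<bullet> b2) * (a1 - a3) = E2 a1 a3 * (a1 - a3)"
    unfolding distrib_right assms(2,3) E2_def by (simp add: algebra_simps)
  then show ?thesis using assms by (simp add: tomei_def)
qed

section \<open>The chart around the separating sphere\<close>

definition kap :: "real \<Rightarrow> real" where "kap a = sqrt ((a - l1) * (l3 - a))"

definition dkap :: "real \<Rightarrow> real" where "dkap a = (l1 + l3 - 2 * a) / (2 * kap a)"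

lemma kap_pos: "l1 < a \<Longrightarrow> a < l3 \<Longrightarrow> kap a > 0"
  by (simp add: kap_def)

lemma kap_sq: "l1 < a \<Longrightarrow> a < l3 \<Longrightarrow> kap a * kap a = (a - l1) * (l3 - a)"
  by (simp add: kap_def)

lemma kap_deriv [derivative_intros]:
  assumes "(f has_derivative f') (at x)" "l1 < f x" "f x < l3"
  shows "((\<lambda>x. kap (f x)) has_derivative (\<lambda>v. dkap (f x) * f' v)) (at x)"
proof -
  have p: "0 < (f x - l1) * (l3 - f x)" using assms(2,3) by simp
  have "((\<lambda>x. (f x - l1) * (l3 - f x)) has_derivative (\<lambda>v. (l1 + l3 - 2 * f x) * f' v)) (at x)"
    by (auto intro!: derivative_eq_intros assms(1) simp: algebra_simps)
  from has_derivative_real_sqrt[OF p this] show ?thesis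
    unfolding kap_def dkap_def by (rule has_derivative_eq_rhs) (simp add: fun_eq_iff divide_simps)
qed

definition ma1 :: "real \<times> c2 \<Rightarrow> real" where "ma1 z = l2 + fst z * (fst (snd z) \<bullet> fst (snd z))"
definition ma3 :: "real \<times> c2 \<Rightarrow> real" where "ma3 z = l2 - fst z * (snd (snd z) \<bullet> snd (snd z))"

text \<open>For l1 < a1 < l3 the equation for \<open>b1\<close>, divided by the square of
  \<open>kap a1\<close>, becomes |p|^2 (a1 - a3) = a1 - l2, and likewise |q|^2 (a1 - a3) = l2 - a3.
  So t = a1 - a3 and the point (p, q) of the 3-sphere are coordinates, and t = 0 is the separating
  sphere.\<close>

definition psi_mid :: "real \<times> c2 \<Rightarrow> P4" where
  "psi_mid z = (ma1 z, kap (ma1 z) *\<^sub>R fst (snd z), ma3 z, kap (ma3 z) *\<^sub>R snd (snd z))"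

definition dmid :: "real \<times> c2 \<Rightarrow> real \<times> c2 \<Rightarrow> P4" where
  "dmid z d =
    (let da1 = fst d * (fst (snd z) \<bullet> fst (snd z)) + 2 * fst z * (fst (snd z) \<bullet> fst (snd d));
         da3 = - (fst d * (snd (snd z) \<bullet> snd (snd z))) - 2 * fst z * (snd (snd z) \<bullet> snd (snd d))
     in (da1, kap (ma1 z) *\<^sub>R fst (snd d) + (dkap (ma1 z) * da1) *\<^sub>R fst (snd z),
         da3, kap (ma3 z) *\<^sub>R snd (snd d) + (dkap (ma3 z) * da3) *\<^sub>R snd (snd z)))"

definition mid_dom :: "(real \<times> c2) set" where
  "mid_dom = {z. l1 < ma1 z \<and> ma1 z < l3 \<and> l1 < ma3 z \<and> ma3 z < l3}"

lemma psi_mid_deriv: "z \<in> mid_dom \<Longrightarrow> (psi_mid has_derivative dmid z) (at z)"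
proof -
  assume z: "z \<in> mid_dom"
  have 1: "(ma1 has_derivative (\<lambda>d. fst d * (fst (snd z) \<bullet> fst (snd z)) + 2 * fst z * (fst (snd z) \<bullet> fst (snd d)))) (at z)"
    unfolding ma1_def by (auto intro!: derivative_eq_intros simp: inner_commute algebra_simps)
  have 3: "(ma3 has_derivative (\<lambda>d. - (fst d * (snd (snd z) \<bullet> snd (snd z))) - 2 * fst z * (snd (snd z) \<bullet> snd (snd d)))) (at z)"
    unfolding ma3_def by (auto intro!: derivative_eq_intros simp: inner_commute algebra_simps)
  have b: "((\<lambda>z::real \<times> c2. fst (snd z)) has_derivative (\<lambda>d. fst (snd d))) (at z)"
    "((\<lambda>z::real \<times> c2. snd (snd z)) has_derivative (\<lambda>d. snd (snd d))) (at z)"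
    by (auto intro!: derivative_eq_intros)
  have k: "l1 < ma1 z" "ma1 z < l3" "l1 < ma3 z" "ma3 z < l3" using z by (auto simp: mid_dom_def)
  have eq: "psi_mid = (\<lambda>z. (ma1 z, kap (ma1 z) *\<^sub>R fst (snd z), ma3 z, kap (ma3 z) *\<^sub>R snd (snd z)))"
    "dmid z = (\<lambda>d. (fst d * (fst (snd z) \<bullet> fst (snd z)) + 2 * fst z * (fst (snd z) \<bullet> fst (snd d)),
         kap (ma1 z) *\<^sub>R fst (snd d) + (dkap (ma1 z) * (fst d * (fst (snd z) \<bullet> fst (snd z)) + 2 * fst z * (fst (snd z) \<bullet> fst (snd d)))) *\<^sub>R fst (snd z),
         - (fst d * (snd (snd z) \<bullet> snd (snd z))) - 2 * fst z * (snd (snd z) \<bullet> snd (snd d)),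
         kap (ma3 z) *\<^sub>R snd (snd d) + (dkap (ma3 z) * (- (fst d * (snd (snd z) \<bullet> snd (snd z))) - 2 * fst z * (snd (snd z) \<bullet> snd (snd d)))) *\<^sub>R snd (snd z)))"
    by (simp_all add: fun_eq_iff psi_mid_def dmid_def Let_def)
  show ?thesis
    unfolding eq
    by (intro has_derivative_Pair has_derivative_scaleR 1 3 b kap_deriv[OF 1 k(1,2)] kap_deriv[OF 3 k(3,4)])
qed

lemma psi_mid_tomei:
  assumes "z \<in> mid_dom" "snd z \<in> S3"
  shows "psi_mid z \<in> tomei"
proof -
  obtain t p q where z: "z = (t, p, q)" by (metis prod.exhaust)
  define P where "P = p \<bullet> p"
  have "P + q \<bullet> q = 1" using assms(2) unfolding z mem_S3_iff by (simp add: P_def power2_norm_eq_inner)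
  then have q: "q \<bullet> q = 1 - P" by simp
  have a: "ma1 z = l2 + t * P" "ma3 z = l2 - t * (1 - P)" by (simp_all add: ma1_def ma3_def z P_def q)
  have k: "kap (ma1 z) * kap (ma1 z) = (ma1 z - l1) * (l3 - ma1 z)" "kap (ma3 z) * kap (ma3 z) = (ma3 z - l1) * (l3 - ma3 z)"
    using assms(1) by (auto simp: mid_dom_def intro!: kap_sq)
  have b: "(kap (ma1 z) *\<^sub>R p) \<bullet> (kap (ma1 z) *\<^sub>R p) = (ma1 z - l1) * (l3 - ma1 z) * P"
    "(kap (ma3 z) *\<^sub>R q) \<bullet> (kap (ma3 z) *\<^sub>R q) = (ma3 z - l1) * (l3 - ma3 z) * (1 - P)"
    unfolding inner_scaleR_left inner_scaleR_right q P_def[symmetric] mult.assoc[symmetric] k by simp_all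
  have "psi_mid z = (ma1 z, kap (ma1 z) *\<^sub>R p, ma3 z, kap (ma3 z) *\<^sub>R q)" by (simp add: psi_mid_def z)
  then show ?thesis
    unfolding tomei_def mem_Collect_eq case_prod_conv
    by (simp only: case_prod_conv b) (simp add: a E2_def algebra_simps)
qed

lemma open_tomei_dom: "open {m::P4. l1 < fst m \<and> fst m < l3 \<and> l1 < fst (snd (snd m)) \<and> fst (snd (snd m)) < l3}"
  "open {m::P4. l1 < fst m \<and> fst (snd (snd m)) < l3 \<and> fst (snd (snd m)) < fst m}"
  by (intro open_Collect_conj open_Collect_less; intro continuous_intros)+

lemma tangent_mid:
  assumes z: "z \<in> mid_dom" "snd z \<in> S3"
  shows "tangent_space tomei (psi_mid z) = {dmid z d | d. snd z \<bullet> snd d = 0}"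
proof -
  define \<Phi> :: "P4 \<Rightarrow> real \<times> c2" where
    "\<Phi> m = (fst m - fst (snd (snd m)), inverse (kap (fst m)) *\<^sub>R fst (snd m), inverse (kap (fst (snd (snd m)))) *\<^sub>R snd (snd (snd m)))" for m
  let ?V = "{m::P4. l1 < fst m \<and> fst m < l3 \<and> l1 < fst (snd (snd m)) \<and> fst (snd (snd m)) < l3}"
  have zS: "fst (snd z) \<bullet> fst (snd z) + snd (snd z) \<bullet> snd (snd z) = 1"
    using z(2) unfolding mem_S3_iff by (simp add: power2_norm_eq_inner)
  have zV: "psi_mid z \<in> ?V" using z(1) by (simp add: psi_mid_def mid_dom_def)
  have "tangent_space tomei (psi_mid z) = {dmid z d | d. 2 * (snd z \<bullet> snd d) = 0}"
  proof (rule tangent_chart[where V = ?V and \<Phi> = \<Phi> and q = "\<lambda>z. snd z \<bullet> snd z - 1"])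
    show "(psi_mid has_derivative dmid z) (at z)" by (rule psi_mid_deriv[OF z(1)])
    show "open ?V" by (rule open_tomei_dom)
    show "psi_mid z \<in> ?V" by (rule zV)
    have k: "kap (ma1 z) > 0" "kap (ma3 z) > 0" using z(1) by (auto simp: mid_dom_def intro!: kap_pos)
    have "(kap has_derivative (\<lambda>v. dkap a * v)) (at a)" if "l1 < a" "a < l3" for a
      using kap_deriv[OF has_derivative_ident that] .
    then have kd: "(\<lambda>x. kap (f x)) differentiable (at x)" if "f differentiable (at x)" "l1 < f x" "f x < l3" for f and x :: P4
      using that kap_deriv unfolding differentiable_def by blast
    show "\<Phi> differentiable (at (psi_mid z))"
      unfolding \<Phi>_def using zV k
      by (intro differentiable_Pair differentiable_scaleR differentiable_inverse kd derivative_intros)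
         (auto simp: psi_mid_def intro!: differentiable_compose[of fst] differentiable_compose[of snd] bounded_linear_imp_differentiable bounded_linear_intros)
    have "ma1 z - ma3 z = fst z * (fst (snd z) \<bullet> fst (snd z) + snd (snd z) \<bullet> snd (snd z))"
      by (simp add: ma1_def ma3_def algebra_simps)
    then show "\<Phi> (psi_mid z) = z" using k zS by (simp add: \<Phi>_def psi_mid_def prod_eq_iff)
    show "psi_mid (\<Phi> A) = A \<and> snd (\<Phi> A) \<bullet> snd (\<Phi> A) - 1 = 0" if A: "A \<in> tomei" "A \<in> ?V" for A
    proof -
      obtain a1 b1 a3 b2 where m: "A = (a1, b1, a3, b2)" by (metis prod.exhaust)
      have dom: "l1 < a1" "a1 < l3" "l1 < a3" "a3 < l3" using A(2) by (auto simp: m)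
      have kp: "kap a1 > 0" "kap a3 > 0" using dom kap_pos by auto
      define P Q where "P = (b1 \<bullet> b1) / (kap a1 * kap a1)" and "Q = (b2 \<bullet> b2) / (kap a3 * kap a3)"
      have PQ: "b1 \<bullet> b1 = P * ((a1 - l1) * (l3 - a1))" "b2 \<bullet> b2 = Q * ((a3 - l1) * (l3 - a3))"
        using kp by (simp_all add: P_def Q_def flip: kap_sq[OF dom(1,2)] kap_sq[OF dom(3,4)])
      have e1: "(b1 \<bullet> b1) * (a1 - a3) = (a1 - l1) * (a1 - l2) * (l3 - a1)" and e2: "b1 \<bullet> b1 + b2 \<bullet> b2 = E2 a1 a3"
        using A(1) by (auto simp: m tomei_def)
      have e3: "(b2 \<bullet> b2) * (a1 - a3) = (a3 - l1) * (a3 - l2) * (a3 - l3)"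
        using tomei_third A(1) by (simp add: m)
      have "((a1 - l1) * (l3 - a1)) * (P * (a1 - a3)) = ((a1 - l1) * (l3 - a1)) * (a1 - l2)"
        using e1 unfolding PQ by (simp add: algebra_simps)
      then have f1: "P * (a1 - a3) = a1 - l2" using dom by simp
      have "((a3 - l1) * (l3 - a3)) * (Q * (a1 - a3)) = ((a3 - l1) * (l3 - a3)) * (l2 - a3)"
        using e3 unfolding PQ by (simp add: algebra_simps)
      then have f3: "Q * (a1 - a3) = l2 - a3" using dom by simp
      \<comment> \<open>Away from \<open>a1 = a3\<close> the sum of \<open>f1\<close> and
        \<open>f3\<close> suffices. At \<open>a1 = a3\<close> these only give the common value l2,
        and the norm comes from the equation with \<open>E2\<close>.\<close>
      have "P + Q = 1"
      proof (cases "a1 = a3")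
        case True
        then have aa: "a1 = l2" "a3 = l2" using f1 f3 by auto
        have "((l2 - l1) * (l3 - l2)) * (P + Q) = ((l2 - l1) * (l3 - l2)) * 1"
          using e2 unfolding PQ aa E2_def by (simp add: algebra_simps)
        then show ?thesis using l12 l23 by simp
      next
        case False
        have "(P + Q) * (a1 - a3) = 1 * (a1 - a3)" using f1 f3 by (simp add: distrib_right)
        then show ?thesis using False by (simp only: mult_cancel_right) simp
      qed
      moreover have n: "(inverse (kap a1) *\<^sub>R b1) \<bullet> (inverse (kap a1) *\<^sub>R b1) = P"
        "(inverse (kap a3) *\<^sub>R b2) \<bullet> (inverse (kap a3) *\<^sub>R b2) = Q"
        by (simp_all add: P_def Q_def divide_inverse)
      have m13: "ma1 (\<Phi> A) = a1" "ma3 (\<Phi> A) = a3"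
        unfolding ma1_def ma3_def \<Phi>_def m fst_conv snd_conv n using f1 f3 by (simp_all add: mult.commute)
      moreover have "snd (\<Phi> A) \<bullet> snd (\<Phi> A) = P + Q"
        unfolding inner_prod_def \<Phi>_def m fst_conv snd_conv n by simp
      ultimately show ?thesis
        unfolding psi_mid_def m13 using kp by (simp add: \<Phi>_def m)
    qed
    show "((\<lambda>z. snd z \<bullet> snd z - 1) has_derivative (\<lambda>d. 2 * (snd z \<bullet> snd d))) (at z)"
      by (auto intro!: derivative_eq_intros simp: inner_commute)
    fix w :: "real \<times> c2" assume w: "2 * (snd z \<bullet> snd w) = 0"
    obtain n where n: "\<And>k. C_k_on k UNIV n" "n 0 = snd z" "(n has_vector_derivative snd w) (at 0)"
      "\<And>t::real. norm (n t - 0) = 1"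
      using sphere_curve[of "snd z" 0 1 "snd w"] z(2) w by (auto simp: inner_commute)
    define \<gamma> where "\<gamma> t = (fst z + t * fst w, n t)" for t
    have \<gamma>C: "C_k_on k UNIV \<gamma>" for k
      unfolding \<gamma>_def by (intro C_k_on_intros n(1)) auto
    have \<gamma>c: "continuous_on UNIV \<gamma>" using \<gamma>C[of 0] by simp
    have mc: "continuous_on UNIV (\<lambda>t. ma1 (\<gamma> t))" "continuous_on UNIV (\<lambda>t. ma3 (\<gamma> t))"
      unfolding ma1_def ma3_def by (intro continuous_intros \<gamma>c)+
    define U where "U = {t. \<gamma> t \<in> mid_dom}"
    have "open U" unfolding U_def mid_dom_def mem_Collect_eq
      by (intro open_Collect_conj open_Collect_less continuous_intros mc)
    moreover have "0 \<in> U" using z(1) n(2) by (simp add: U_def \<gamma>_def)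
    moreover have "C_k_on k U (\<lambda>t. psi_mid (\<gamma> t))" for k
    proof -
      have g: "C_k_on k U \<gamma>" by (rule C_k_on_subset[OF \<gamma>C]) auto
      have inner: "C_k_on k U (\<lambda>t. f t \<bullet> f t)" if "C_k_on k U f" for f :: "real \<Rightarrow> complex"
        using C_k_on_cmod_sq[OF \<open>open U\<close> that] by (simp add: power2_norm_eq_inner)
      have m: "C_k_on k U (\<lambda>t. ma1 (\<gamma> t))" "C_k_on k U (\<lambda>t. ma3 (\<gamma> t))"
        unfolding ma1_def ma3_def by (intro C_k_on_intros inner g \<open>open U\<close>)+
      show ?thesis
        unfolding psi_mid_def kap_def
        by (intro C_k_on_intros m g \<open>open U\<close>) (auto simp: U_def mid_dom_def)
    qed
    moreover have "\<gamma> 0 = z" by (simp add: \<gamma>_def n(2))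
    moreover have "(\<gamma> has_vector_derivative w) (at 0)"
    proof -
      have "(\<gamma> has_vector_derivative (fst w, snd w)) (at 0)"
        unfolding \<gamma>_def using n(3) by (intro has_vector_derivative_Pair) (auto intro!: derivative_eq_intros)
      then show ?thesis by simp
    qed
    moreover have "psi_mid (\<gamma> t) \<in> tomei" if "t \<in> U" for t
      using psi_mid_tomei[of "\<gamma> t"] that n(4)[of t] by (simp add: U_def \<gamma>_def)
    ultimately show "\<exists>\<gamma> U. open U \<and> 0 \<in> U \<and> (\<forall>k. C_k_on k U (\<lambda>t::real. psi_mid (\<gamma> t))) \<and> \<gamma> 0 = z \<and>
          (\<gamma> has_vector_derivative w) (at 0) \<and> (\<forall>t\<in>U. psi_mid (\<gamma> t) \<in> tomei)"
      by blast
  qed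
  then show ?thesis by simp
qed


text \<open>The part \<open>a\<^sub>3 < a\<^sub>1\<close> of the manifold is a product of two 2-spheres
  \<open>\<bar>c\<^sub>1\<bar>\<^sup>2 = (a\<^sub>1 - l2)(l3 - a\<^sub>1)\<close>, \<open>\<bar>c\<^sub>2\<bar>\<^sup>2 = (a\<^sub>3 - l1)(l2 - a\<^sub>3)\<close> without the point \<open>a\<^sub>1 = a\<^sub>3 = l2\<close>.\<close>

definition k1 :: "P4 \<Rightarrow> real" where "k1 x = sqrt ((fst x - l1) / (fst x - fst (snd (snd x))))"
definition k2 :: "P4 \<Rightarrow> real" where "k2 x = sqrt ((l3 - fst (snd (snd x))) / (fst x - fst (snd (snd x))))"

definition psi_side :: "P4 \<Rightarrow> P4" where
  "psi_side x = (fst x, k1 x *\<^sub>R fst (snd x), fst (snd (snd x)), k2 x *\<^sub>R snd (snd (snd x)))"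

definition dk1 :: "P4 \<Rightarrow> P4 \<Rightarrow> real" where
  "dk1 x d = (fst d * (fst x - fst (snd (snd x))) - (fst x - l1) * (fst d - fst (snd (snd d)))) /
     (fst x - fst (snd (snd x)))\<^sup>2 * (inverse (k1 x) / 2)"

definition dk2 :: "P4 \<Rightarrow> P4 \<Rightarrow> real" where
  "dk2 x d = (- fst (snd (snd d)) * (fst x - fst (snd (snd x))) - (l3 - fst (snd (snd x))) * (fst d - fst (snd (snd d)))) /
     (fst x - fst (snd (snd x)))\<^sup>2 * (inverse (k2 x) / 2)"

definition dside :: "P4 \<Rightarrow> P4 \<Rightarrow> P4" where
  "dside x d = (fst d, k1 x *\<^sub>R fst (snd d) + dk1 x d *\<^sub>R fst (snd x),
     fst (snd (snd d)), k2 x *\<^sub>R snd (snd (snd d)) + dk2 x d *\<^sub>R snd (snd (snd x)))"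

definition side_dom :: "P4 set" where
  "side_dom = {x. l1 < fst x \<and> fst (snd (snd x)) < l3 \<and> fst (snd (snd x)) < fst x}"

lemma open_side_dom: "open side_dom"
  unfolding side_dom_def by (rule open_tomei_dom)

lemma k_pos: "x \<in> side_dom \<Longrightarrow> k1 x > 0" "x \<in> side_dom \<Longrightarrow> k2 x > 0"
  by (simp_all add: k1_def k2_def side_dom_def)

lemma k_sq: "x \<in> side_dom \<Longrightarrow> k1 x * k1 x = (fst x - l1) / (fst x - fst (snd (snd x)))"
  "x \<in> side_dom \<Longrightarrow> k2 x * k2 x = (l3 - fst (snd (snd x))) / (fst x - fst (snd (snd x)))"
  by (simp_all add: k1_def k2_def side_dom_def)

lemma proj_deriv:
  "((\<lambda>x::P4. fst x) has_derivative (\<lambda>d. fst d)) (at x)"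
  "((\<lambda>x::P4. fst (snd x)) has_derivative (\<lambda>d. fst (snd d))) (at x)"
  "((\<lambda>x::P4. fst (snd (snd x))) has_derivative (\<lambda>d. fst (snd (snd d)))) (at x)"
  "((\<lambda>x::P4. snd (snd (snd x))) has_derivative (\<lambda>d. snd (snd (snd d)))) (at x)"
  by (auto intro!: derivative_eq_intros)

lemma k1_deriv: assumes "x \<in> side_dom" shows "(k1 has_derivative dk1 x) (at x)"
proof -
  have ne: "fst x - fst (snd (snd x)) \<noteq> 0" and p: "0 < (fst x - l1) / (fst x - fst (snd (snd x)))"
    using assms by (auto simp: side_dom_def)
  have "((\<lambda>x::P4. (fst x - l1) / (fst x - fst (snd (snd x)))) has_derivative
      (\<lambda>d. (fst d * (fst x - fst (snd (snd x))) - (fst x - l1) * (fst d - fst (snd (snd d)))) / (fst x - fst (snd (snd x)))\<^sup>2)) (at x)"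
    by (rule has_derivative_eq_rhs[OF has_derivative_divide'])
      (use ne in \<open>auto intro!: derivative_eq_intros simp: power2_eq_square\<close>)
  from has_derivative_real_sqrt[OF p this] show ?thesis
    unfolding k1_def[abs_def] dk1_def[abs_def] .
qed

lemma k2_deriv: assumes "x \<in> side_dom" shows "(k2 has_derivative dk2 x) (at x)"
proof -
  have ne: "fst x - fst (snd (snd x)) \<noteq> 0" and p: "0 < (l3 - fst (snd (snd x))) / (fst x - fst (snd (snd x)))"
    using assms by (auto simp: side_dom_def)
  have "((\<lambda>x::P4. (l3 - fst (snd (snd x))) / (fst x - fst (snd (snd x)))) has_derivative
      (\<lambda>d. (- fst (snd (snd d)) * (fst x - fst (snd (snd x))) - (l3 - fst (snd (snd x))) * (fst d - fst (snd (snd d)))) / (fst x - fst (snd (snd x)))\<^sup>2)) (at x)"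
    by (rule has_derivative_eq_rhs[OF has_derivative_divide'])
      (use ne in \<open>auto intro!: derivative_eq_intros simp: power2_eq_square\<close>)
  from has_derivative_real_sqrt[OF p this] show ?thesis
    unfolding k2_def[abs_def] dk2_def[abs_def] .
qed

lemma psi_side_deriv: assumes "x \<in> side_dom" shows "(psi_side has_derivative dside x) (at x)"
  unfolding psi_side_def[abs_def] dside_def[abs_def]
  by (intro has_derivative_Pair has_derivative_scaleR proj_deriv k1_deriv[OF assms] k2_deriv[OF assms])

definition spheres :: "P4 set" where
  "spheres = {(a1, c1, a3, c2). c1 \<bullet> c1 = (a1 - l2) * (l3 - a1) \<and> c2 \<bullet> c2 = (a3 - l1) * (l2 - a3)}"

definition sphq :: "P4 \<Rightarrow> real \<times> real" where
  "sphq x = (fst (snd x) \<bullet> fst (snd x) - (fst x - l2) * (l3 - fst x),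
     snd (snd (snd x)) \<bullet> snd (snd (snd x)) - (fst (snd (snd x)) - l1) * (l2 - fst (snd (snd x))))"

definition dsphq :: "P4 \<Rightarrow> P4 \<Rightarrow> real \<times> real" where
  "dsphq x d = (2 * (fst (snd x) \<bullet> fst (snd d)) - (l2 + l3 - 2 * fst x) * fst d,
     2 * (snd (snd (snd x)) \<bullet> snd (snd (snd d))) - (l1 + l2 - 2 * fst (snd (snd x))) * fst (snd (snd d)))"

lemma spheres_sphq: "x \<in> spheres \<longleftrightarrow> sphq x = 0"
  by (auto simp: spheres_def sphq_def zero_prod_def case_prod_beta)

lemma sphq_deriv: "(sphq has_derivative dsphq x) (at x)"
  unfolding sphq_def[abs_def] dsphq_def[abs_def]
  by (intro has_derivative_Pair) (auto intro!: derivative_eq_intros simp: inner_commute algebra_simps)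

lemma psi_side_tomei:
  assumes "x \<in> side_dom" "x \<in> spheres" shows "psi_side x \<in> tomei"
proof -
  obtain a1 c1 a3 c2 where x: "x = (a1, c1, a3, c2)" by (metis prod.exhaust)
  have lt: "a3 < a1" using assms(1) by (simp add: side_dom_def x)
  have c: "c1 \<bullet> c1 = (a1 - l2) * (l3 - a1)" "c2 \<bullet> c2 = (a3 - l1) * (l2 - a3)"
    using assms(2) by (auto simp: spheres_def x)
  have k: "k1 x * (k1 x * z) = (a1 - l1) / (a1 - a3) * z" "k2 x * (k2 x * z) = (l3 - a3) / (a1 - a3) * z" for z
    unfolding mult.assoc[symmetric] k_sq[OF assms(1)] by (simp_all add: x)
  have b: "(k1 x *\<^sub>R c1) \<bullet> (k1 x *\<^sub>R c1) = (a1 - l1) / (a1 - a3) * ((a1 - l2) * (l3 - a1))"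
    "(k2 x *\<^sub>R c2) \<bullet> (k2 x *\<^sub>R c2) = (l3 - a3) / (a1 - a3) * ((a3 - l1) * (l2 - a3))"
    unfolding inner_scaleR_left inner_scaleR_right k c by simp_all
  have "(a1, k1 x *\<^sub>R c1, a3, k2 x *\<^sub>R c2) \<in> tomei"
  proof (rule tomeiI, unfold b)
    show "a1 \<noteq> a3" using lt by simp
    show "(a1 - l1) / (a1 - a3) * ((a1 - l2) * (l3 - a1)) * (a1 - a3) = (a1 - l1) * (a1 - l2) * (l3 - a1)"
      using lt by simp
    have "(l3 - a3) / (a1 - a3) * ((a3 - l1) * (l2 - a3)) * (a1 - a3) = (l3 - a3) * ((a3 - l1) * (l2 - a3))"
      using lt by simp
    then show "(l3 - a3) / (a1 - a3) * ((a3 - l1) * (l2 - a3)) * (a1 - a3) = (a3 - l1) * (a3 - l2) * (a3 - l3)"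
      by (simp add: algebra_simps)
  qed
  then show ?thesis by (simp add: psi_side_def x)
qed

text \<open>The equation describes the round sphere having the segment from \<open>(m, 0)\<close> to
  \<open>(n, 0)\<close> as a diameter, so \<open>sphere_curve\<close> applies.\<close>

lemma circle_curve:
  fixes a :: real and c :: complex
  assumes "c \<bullet> c = (a - m) * (n - a)" "m < n" "2 * (c \<bullet> dc) = (m + n - 2 * a) * da"
  obtains g where "\<And>k. C_k_on k UNIV g" "g 0 = (a, c)" "(g has_vector_derivative (da, dc)) (at 0)"
    "\<And>t::real. snd (g t) \<bullet> snd (g t) = (fst (g t) - m) * (n - fst (g t))"
proof -
  let ?o = "((m + n) / 2, 0::complex)" and ?R = "(n - m) / 2"
  have sph: "snd z \<bullet> snd z = (fst z - m) * (n - fst z) \<longleftrightarrow> (norm (z - ?o))\<^sup>2 = ?R\<^sup>2" for z :: "real \<times> complex"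
  proof -
    have "(norm (z - ?o))\<^sup>2 = (fst z - (m + n) / 2)\<^sup>2 + snd z \<bullet> snd z"
      unfolding power2_norm_eq_inner inner_prod_def by (simp add: power2_eq_square)
    moreover have "(fst z - (m + n) / 2)\<^sup>2 = ?R\<^sup>2 - (fst z - m) * (n - fst z)"
      by (simp add: power2_eq_square field_simps)
    ultimately show ?thesis by auto
  qed
  have "norm ((a, c) - ?o) = ?R"
    using assms(1,2) sph[of "(a, c)"] by (simp add: power2_eq_iff_nonneg)
  moreover have "(da, dc) \<bullet> ((a, c) - ?o) = 0"
    using assms(3) by (simp add: inner_prod_def inner_commute field_simps)
  ultimately obtain g where g: "\<And>k. C_k_on k UNIV g" "g 0 = (a, c)" "(g has_vector_derivative (da, dc)) (at 0)"
    "\<And>t::real. norm (g t - ?o) = ?R"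
    using sphere_curve[of "(a, c)" ?o ?R "(da, dc)"] assms(2) by auto
  have "snd (g t) \<bullet> snd (g t) = (fst (g t) - m) * (n - fst (g t))" for t
    unfolding sph g(4) by (rule refl)
  then show thesis by (rule that[OF g(1-3)])
qed

lemma tangent_side:
  assumes x: "x \<in> side_dom" "x \<in> spheres"
  shows "tangent_space tomei (psi_side x) = {dside x d | d. dsphq x d = 0}"
proof -
  \<comment> \<open>\<open>k1\<close> and \<open>k2\<close> depend only on \<open>a1\<close> and
    \<open>a3\<close>, which the chart keeps, so the inverse divides by the same numbers.\<close>
  define \<Phi> :: "P4 \<Rightarrow> P4" where
    "\<Phi> m = (fst m, inverse (k1 m) *\<^sub>R fst (snd m), fst (snd (snd m)), inverse (k2 m) *\<^sub>R snd (snd (snd m)))" for m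
  have kinv: "k1 (psi_side y) = k1 y" "k2 (psi_side y) = k2 y" "k1 (\<Phi> y) = k1 y" "k2 (\<Phi> y) = k2 y" for y
    by (simp_all add: psi_side_def k1_def k2_def \<Phi>_def)
  have xV: "psi_side x \<in> side_dom" using x(1) by (simp add: psi_side_def side_dom_def)
  show ?thesis
  proof (rule tangent_chart[where \<Psi> = psi_side and x = x and D = "dside x" and Q = "dsphq x" and V = side_dom and \<Phi> = \<Phi> and q = sphq])
    show "(psi_side has_derivative dside x) (at x)" by (rule psi_side_deriv[OF x(1)])
    show "open side_dom" by (rule open_side_dom)
    show "psi_side x \<in> side_dom" by (rule xV)
    show "(sphq has_derivative dsphq x) (at x)" by (rule sphq_deriv)
    have k: "k1 (psi_side x) \<noteq> 0" "k2 (psi_side x) \<noteq> 0" using k_pos[OF xV] by auto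
    show "\<Phi> differentiable (at (psi_side x))"
    proof -
      have pd: "(\<lambda>x::P4. fst x) differentiable (at m)" "(\<lambda>x::P4. fst (snd x)) differentiable (at m)"
        "(\<lambda>x::P4. fst (snd (snd x))) differentiable (at m)" "(\<lambda>x::P4. snd (snd (snd x))) differentiable (at m)" for m
        using proj_deriv unfolding differentiable_def by blast+
      have kd: "k1 differentiable (at (psi_side x))" "k2 differentiable (at (psi_side x))"
        using k1_deriv[OF xV] k2_deriv[OF xV] unfolding differentiable_def by blast+
      show ?thesis
        unfolding \<Phi>_def by (intro differentiable_Pair differentiable_scaleR differentiable_inverse kd pd k)
    qed
    show "\<Phi> (psi_side x) = x" unfolding \<Phi>_def kinv using k_pos[OF x(1)] by (simp add: psi_side_def)
    show "psi_side (\<Phi> A) = A \<and> sphq (\<Phi> A) = 0" if A: "A \<in> tomei" "A \<in> side_dom" for A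
    proof
      show "psi_side (\<Phi> A) = A" unfolding psi_side_def kinv using k_pos[OF A(2)] by (simp add: \<Phi>_def)
      obtain a1 b1 a3 b2 where m: "A = (a1, b1, a3, b2)" by (metis prod.exhaust)
      have dom: "l1 < a1" "a3 < l3" "a3 < a1" using A(2) by (auto simp: m side_dom_def)
      have e1: "(b1 \<bullet> b1) * (a1 - a3) = (a1 - l1) * (a1 - l2) * (l3 - a1)"
        using A(1) by (auto simp: m tomei_def)
      have e3: "(b2 \<bullet> b2) * (a1 - a3) = (a3 - l1) * (a3 - l2) * (a3 - l3)"
        using tomei_third A(1) by (simp add: m)
      have "(inverse (k1 A) *\<^sub>R b1) \<bullet> (inverse (k1 A) *\<^sub>R b1) = (b1 \<bullet> b1) / (k1 A * k1 A)"
        "(inverse (k2 A) *\<^sub>R b2) \<bullet> (inverse (k2 A) *\<^sub>R b2) = (b2 \<bullet> b2) / (k2 A * k2 A)"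
        by (simp_all add: divide_inverse)
      moreover have "(b1 \<bullet> b1) / (k1 A * k1 A) = (a1 - l2) * (l3 - a1)"
        unfolding k_sq[OF A(2)] using dom e1 by (simp add: m field_simps)
      moreover have "(b2 \<bullet> b2) / (k2 A * k2 A) = (a3 - l1) * (l2 - a3)"
        unfolding k_sq[OF A(2)] using dom e3 by (simp add: m field_simps)
      ultimately show "sphq (\<Phi> A) = 0"
        unfolding spheres_sphq[symmetric] spheres_def \<Phi>_def by (simp add: m)
    qed
    fix w assume w: "dsphq x w = 0"
    obtain a1 c1 a3 c2 where xx: "x = (a1, c1, a3, c2)" by (metis prod.exhaust)
    obtain d1 e1 d3 e2 where ww: "w = (d1, e1, d3, e2)" by (metis prod.exhaust)
    have c: "c1 \<bullet> c1 = (a1 - l2) * (l3 - a1)" "c2 \<bullet> c2 = (a3 - l1) * (l2 - a3)"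
      using x(2) by (auto simp: spheres_def xx)
    have d: "2 * (c1 \<bullet> e1) = (l2 + l3 - 2 * a1) * d1" "2 * (c2 \<bullet> e2) = (l1 + l2 - 2 * a3) * d3"
      using w by (auto simp: dsphq_def xx ww zero_prod_def)
    obtain g where g: "\<And>k. C_k_on k UNIV g" "g 0 = (a1, c1)" "(g has_vector_derivative (d1, e1)) (at 0)"
      "\<And>t::real. snd (g t) \<bullet> snd (g t) = (fst (g t) - l2) * (l3 - fst (g t))"
      using circle_curve[OF c(1) l23 d(1)] by blast
    obtain h where h: "\<And>k. C_k_on k UNIV h" "h 0 = (a3, c2)" "(h has_vector_derivative (d3, e2)) (at 0)"
      "\<And>t::real. snd (h t) \<bullet> snd (h t) = (fst (h t) - l1) * (l2 - fst (h t))"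
      using circle_curve[OF c(2) l12 d(2)] by blast
    define \<gamma> where "\<gamma> t = (fst (g t), snd (g t), h t)" for t
    have \<gamma>C: "C_k_on k UNIV \<gamma>" for k
      unfolding \<gamma>_def by (intro C_k_on_intros g(1) h(1)) auto
    have \<gamma>c: "continuous_on UNIV \<gamma>" using \<gamma>C[of 0] by simp
    define U where "U = \<gamma> -` side_dom"
    have "open U" unfolding U_def by (rule open_vimage[OF open_side_dom \<gamma>c])
    moreover have "0 \<in> U" using x(1) g(2) h(2) by (simp add: U_def \<gamma>_def xx)
    moreover have "C_k_on k U (\<lambda>t. psi_side (\<gamma> t))" for k
    proof -
      have G: "C_k_on k U \<gamma>" by (rule C_k_on_subset[OF \<gamma>C]) auto
      show ?thesis
        unfolding psi_side_def k1_def k2_def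
        by (intro C_k_on_intros G \<open>open U\<close>) (auto simp: U_def side_dom_def)
    qed
    moreover have "\<gamma> 0 = x" by (simp add: \<gamma>_def g(2) h(2) xx)
    moreover have "(\<gamma> has_vector_derivative w) (at 0)"
    proof -
      have "(\<gamma> has_vector_derivative (fst (d1, e1), snd (d1, e1), (d3, e2))) (at 0)"
        unfolding \<gamma>_def
        by (intro has_vector_derivative_Pair h(3) bounded_linear.has_vector_derivative[OF bounded_linear_fst g(3)]
            bounded_linear.has_vector_derivative[OF bounded_linear_snd g(3)])
      then show ?thesis by (simp add: ww)
    qed
    moreover have "psi_side (\<gamma> t) \<in> tomei" if "t \<in> U" for t
      by (rule psi_side_tomei) (use that g(4)[of t] h(4)[of t] in \<open>auto simp: U_def \<gamma>_def spheres_def case_prod_beta\<close>)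
    ultimately show "\<exists>\<gamma> U. open U \<and> 0 \<in> U \<and> (\<forall>k. C_k_on k U (\<lambda>t::real. psi_side (\<gamma> t))) \<and> \<gamma> 0 = x \<and>
          (\<gamma> has_vector_derivative w) (at 0) \<and> (\<forall>t\<in>U. psi_side (\<gamma> t) \<in> tomei)"
      by blast
  qed
qed


section \<open>A global frame over one side of the separating sphere\<close>

abbreviation rho1 :: real where "rho1 \<equiv> l3 - l2"
abbreviation rho2 :: real where "rho2 \<equiv> l2 - l1"
definition r1 :: real where "r1 = sqrt rho1"
definition r2 :: real where "r2 = sqrt rho2"

lemma r_pos: "r1 > 0" "r2 > 0" using l12 l23 by (simp_all add: r1_def r2_def)

lemma r_sq: "r1 * r1 = rho1" "r2 * r2 = rho2" using l12 l23 by (simp_all add: r1_def r2_def)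

definition conorm :: "complex \<Rightarrow> real" where "conorm x = sqrt (1 - x \<bullet> x)"

lemma conorm_sq: "x \<bullet> x \<le> 1 \<Longrightarrow> conorm x * conorm x = 1 - x \<bullet> x" by (simp add: conorm_def)

lemma conorm_pos: "x \<bullet> x < 1 \<Longrightarrow> conorm x > 0" by (simp add: conorm_def)

text \<open>Each factor \<open>x \<mapsto> (l2 + \<rho> \<bar>x\<bar>\<^sup>2, \<rho> sqrt (1 - \<bar>x\<bar>\<^sup>2) x)\<close> maps the closed unit disc onto one of the two
  spheres and collapses the boundary circle; \<open>side_vec\<close> is a global frame of the pulled back tangent bundle.\<close>

definition side_point :: "c2 \<Rightarrow> P4" where
  "side_point x = (l2 + rho1 * (fst x \<bullet> fst x), (rho1 * conorm (fst x)) *\<^sub>R fst x,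
           l2 - rho2 * (snd x \<bullet> snd x), (rho2 * conorm (snd x)) *\<^sub>R snd x)"

definition side_vec :: "c2 \<Rightarrow> c2 \<Rightarrow> P4" where
  "side_vec x v = (2 * conorm (fst x) * (fst x \<bullet> fst v), fst v - (2 * (fst x \<bullet> fst v)) *\<^sub>R fst x,
           - (2 * conorm (snd x) * (snd x \<bullet> snd v)), snd v - (2 * (snd x \<bullet> snd v)) *\<^sub>R snd x)"

definition bidisc :: "c2 set" where
  "bidisc = {x. fst x \<bullet> fst x \<le> 1 \<and> snd x \<bullet> snd x \<le> 1 \<and> x \<noteq> 0}"

lemma side_point_spheres: assumes "x \<in> bidisc" shows "side_point x \<in> spheres"
proof -
  have y: "conorm (fst x) * conorm (fst x) = 1 - fst x \<bullet> fst x" "conorm (snd x) * conorm (snd x) = 1 - snd x \<bullet> snd x"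
    using assms by (auto simp: bidisc_def intro!: conorm_sq)
  have b: "((rho * conorm z) *\<^sub>R z) \<bullet> ((rho * conorm z) *\<^sub>R z) = rho * rho * (conorm z * conorm z) * (z \<bullet> z)" for rho z
    by simp
  show ?thesis
    unfolding spheres_def side_point_def mem_Collect_eq case_prod_conv b y by (simp add: algebra_simps)
qed

lemma side_point_dom: assumes "x \<in> bidisc" shows "side_point x \<in> side_dom"
proof -
  have n: "0 \<le> fst x \<bullet> fst x" "0 \<le> snd x \<bullet> snd x" by simp_all
  have "fst x \<bullet> fst x > 0 \<or> snd x \<bullet> snd x > 0" using assms by (auto simp: bidisc_def prod_eq_iff)
  then have "rho1 * (fst x \<bullet> fst x) + rho2 * (snd x \<bullet> snd x) > 0"
    using l12 l23 n by (auto intro: add_pos_nonneg add_nonneg_pos)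
  moreover have "rho1 * (fst x \<bullet> fst x) \<ge> 0" "rho2 * (snd x \<bullet> snd x) \<ge> 0" using l12 l23 n by simp_all
  ultimately show ?thesis
    unfolding side_dom_def side_point_def mem_Collect_eq fst_conv snd_conv using l12 l23 by (intro conjI) linarith+
qed

text \<open>Surjectivity of one half of \<open>side_vec\<close>: the hypothesis on \<open>dc\<close>
  and \<open>da\<close> is tangency to the sphere, in a form that survives at the collapsed boundary
  circle.\<close>

lemma half_frame:
  fixes x dc :: complex and y da :: real
  assumes y: "y * y = 1 - x \<bullet> x" and t: "2 * y * (x \<bullet> dc) = (1 - 2 * (x \<bullet> x)) * da"
  shows "\<exists>v. 2 * y * (x \<bullet> v) = da \<and> v - (2 * (x \<bullet> v)) *\<^sub>R x = dc"
proof -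
  define n X where "n = x \<bullet> x" and "X = x \<bullet> dc"
  \<comment> \<open>With s = x \<bullet> v the requirements read (1 - 2n) s = X and 2 y s = da.
    Because (1 - 2n)^2 + 4 n y^2 = 1, this combination of them determines s even where 1 - 2n or y
    vanishes.\<close>
  define s where "s = (1 - 2 * n) * X + 2 * y * n * da"
  define v where "v = dc + (2 * s) *\<^sub>R x"
  have y': "y * y = 1 - n" and t': "2 * y * X = (1 - 2 * n) * da" using y t by (simp_all add: n_def X_def)
  have "x \<bullet> v = X + 2 * s * n" by (simp add: v_def inner_add_right n_def X_def)
  also have "\<dots> = s + n * (4 * (1 - n) * X - 2 * y * ((1 - 2 * n) * da))"
    by (simp add: s_def algebra_simps)
  also have "2 * y * ((1 - 2 * n) * da) = 4 * (1 - n) * X"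
    unfolding t'[symmetric] y'[symmetric] by simp
  finally have xv: "x \<bullet> v = s" by simp
  have "2 * y * s = (1 - 2 * n) * (2 * y * X) + 4 * (y * y) * n * da" by (simp add: s_def algebra_simps)
  also have "\<dots> = da" unfolding t' y' by (simp add: algebra_simps)
  finally have "2 * y * s = da" .
  moreover have "v - (2 * s) *\<^sub>R x = dc" by (simp add: v_def)
  ultimately show ?thesis using xv by auto
qed

text \<open>If x \<bullet> v were nonzero, then y = 0 and |x| = 1, and pairing the second equation
  with x would give x \<bullet> v = 2 (x \<bullet> v).\<close>

lemma half_frame_inj:
  fixes x v :: complex and y :: real
  assumes y: "y * y = 1 - x \<bullet> x" and "2 * y * (x \<bullet> v) = 0" "v - (2 * (x \<bullet> v)) *\<^sub>R x = 0"
  shows "v = 0"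
proof -
  define s where "s = x \<bullet> v"
  have v: "v = (2 * s) *\<^sub>R x" using assms(3) by (simp add: s_def)
  have "s = 2 * s * (x \<bullet> x)" using arg_cong[OF v, of "\<lambda>z. x \<bullet> z"] by (simp add: s_def)
  moreover have "s = 0 \<or> x \<bullet> x = 1" using assms(2) y by (auto simp: s_def)
  ultimately have "s = 0" by auto
  then show ?thesis using v by simp
qed

lemma linear_dside: "x \<in> side_dom \<Longrightarrow> linear (dside x)"
  by (rule has_derivative_linear[OF psi_side_deriv])

lemma linear_dmid: "z \<in> mid_dom \<Longrightarrow> linear (dmid z)"
  by (rule has_derivative_linear[OF psi_mid_deriv])

lemma linear_side_vec: "linear (side_vec x)"
proof (rule linearI)
  have a: "v + w - (2 * (x \<bullet> (v + w))) *\<^sub>R x = (v - (2 * (x \<bullet> v)) *\<^sub>R x) + (w - (2 * (x \<bullet> w)) *\<^sub>R x)" for x v w :: complex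
    by (simp add: inner_add_right distrib_left scaleR_add_left)
  have c: "c *\<^sub>R v - (2 * (x \<bullet> (c *\<^sub>R v))) *\<^sub>R x = c *\<^sub>R (v - (2 * (x \<bullet> v)) *\<^sub>R x)" for c and x v :: complex
    by (simp add: scaleR_diff_right mult.left_commute)
  fix v w :: c2 and c :: real
  show "side_vec x (v + w) = side_vec x v + side_vec x w"
    unfolding side_vec_def fst_add snd_add a add_Pair by (simp add: inner_add_right distrib_left)
  show "side_vec x (c *\<^sub>R v) = c *\<^sub>R side_vec x v"
    unfolding side_vec_def fst_scaleR snd_scaleR c scaleR_Pair by simp
qed

lemma side_frame:
  assumes x: "x \<in> bidisc"
  shows "frame tomei (psi_side (side_point x)) (\<lambda>v. dside (side_point x) (side_vec x v))"
proof -
  note S = side_point_dom[OF x] side_point_spheres[OF x]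
  have y: "conorm (fst x) * conorm (fst x) = 1 - fst x \<bullet> fst x" "conorm (snd x) * conorm (snd x) = 1 - snd x \<bullet> snd x"
    using x by (auto simp: bidisc_def intro!: conorm_sq)
  have lin: "linear (\<lambda>v. dside (side_point x) (side_vec x v))"
    using linear_compose[OF linear_side_vec linear_dside[OF S(1)]] by (simp add: o_def)
  have k: "k1 (side_point x) \<noteq> 0" "k2 (side_point x) \<noteq> 0" using k_pos[OF S(1)] by auto
  have inj0: "v = 0" if "dside (side_point x) (side_vec x v) = 0" for v
  proof -
    have a: "fst (side_vec x v) = 0" "fst (snd (snd (side_vec x v))) = 0"
      using that by (simp_all add: dside_def prod_eq_iff)
    then have "dk1 (side_point x) (side_vec x v) = 0" "dk2 (side_point x) (side_vec x v) = 0" by (simp_all add: dk1_def dk2_def)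
    then have c: "fst (snd (side_vec x v)) = 0" "snd (snd (snd (side_vec x v))) = 0"
      using that k by (simp_all add: dside_def prod_eq_iff)
    have "fst v = 0" by (rule half_frame_inj[OF y(1)]) (use a c in \<open>simp_all add: side_vec_def\<close>)
    moreover have "snd v = 0" by (rule half_frame_inj[OF y(2)]) (use a c in \<open>simp_all add: side_vec_def\<close>)
    ultimately show ?thesis by (simp add: prod_eq_iff)
  qed
  have range: "range (side_vec x) = {d. dsphq (side_point x) d = 0}"
  proof (intro equalityI subsetI)
    fix d assume "d \<in> range (side_vec x)"
    then obtain v where d: "d = side_vec x v" by blast
    have e: "2 * ((rho * conorm z) *\<^sub>R z \<bullet> (w - (2 * (z \<bullet> w)) *\<^sub>R z)) = (rho * (1 - 2 * (z \<bullet> z))) * (2 * conorm z * (z \<bullet> w))"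
      for rho and z w :: complex
      by (simp add: inner_diff_right algebra_simps)
    have e1: "l2 + l3 - 2 * (l2 + rho1 * n) = rho1 * (1 - 2 * n)" "l1 + l2 - 2 * (l2 - rho2 * n) = - (rho2 * (1 - 2 * n))" for n
      by (simp_all add: algebra_simps)
    show "d \<in> {d. dsphq (side_point x) d = 0}"
      unfolding d dsphq_def side_point_def side_vec_def mem_Collect_eq fst_conv snd_conv e e1 by (simp add: zero_prod_def)
  next
    fix d assume "d \<in> {d. dsphq (side_point x) d = 0}"
    then have q: "2 * (rho1 * conorm (fst x) * (fst x \<bullet> fst (snd d))) = (l2 + l3 - 2 * (l2 + rho1 * (fst x \<bullet> fst x))) * fst d"
      "2 * (rho2 * conorm (snd x) * (snd x \<bullet> snd (snd (snd d)))) = (l1 + l2 - 2 * (l2 - rho2 * (snd x \<bullet> snd x))) * fst (snd (snd d))"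
      by (simp_all add: dsphq_def side_point_def zero_prod_def)
    have "rho1 * (2 * conorm (fst x) * (fst x \<bullet> fst (snd d))) = rho1 * ((1 - 2 * (fst x \<bullet> fst x)) * fst d)"
      using q(1) by (simp add: algebra_simps)
    then have 1: "2 * conorm (fst x) * (fst x \<bullet> fst (snd d)) = (1 - 2 * (fst x \<bullet> fst x)) * fst d"
      using l23 by simp
    have q2: "rho2 * (2 * conorm (snd x) * (snd x \<bullet> snd (snd (snd d)))) = rho2 * ((1 - 2 * (snd x \<bullet> snd x)) * (- fst (snd (snd d))))"
      using q(2) by (simp add: algebra_simps)
    have ne2: "rho2 \<noteq> 0" using l12 by simp
    have 2: "2 * conorm (snd x) * (snd x \<bullet> snd (snd (snd d))) = (1 - 2 * (snd x \<bullet> snd x)) * (- fst (snd (snd d)))"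
      by (rule mult_left_cancel[THEN iffD1, OF ne2 q2])
    obtain v where v: "2 * conorm (fst x) * (fst x \<bullet> v) = fst d" "v - (2 * (fst x \<bullet> v)) *\<^sub>R fst x = fst (snd d)"
      using half_frame[OF y(1) 1] by blast
    obtain w where w: "2 * conorm (snd x) * (snd x \<bullet> w) = - fst (snd (snd d))" "w - (2 * (snd x \<bullet> w)) *\<^sub>R snd x = snd (snd (snd d))"
      using half_frame[OF y(2) 2] by blast
    have "side_vec x (v, w) = d" using v w by (simp add: side_vec_def prod_eq_iff)
    then show "d \<in> range (side_vec x)" by blast
  qed
  have "range (\<lambda>v. dside (side_point x) (side_vec x v)) = dside (side_point x) ` range (side_vec x)" by (simp add: image_image)
  also have "\<dots> = tangent_space tomei (psi_side (side_point x))"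
    unfolding tangent_side[OF S] range by blast
  finally show ?thesis
    using psi_side_tomei[OF S] lin inj0 by (auto simp: frame_def linear_injective_0[OF lin])
qed

text \<open>The part of \<open>A v\<close> along the point of the sphere goes to the t-direction,
  the orthogonal part to the sphere. The positive factors and the isomorphism \<open>A\<close> are
  left free so that frames can be deformed.\<close>

lemma mid_frame:
  assumes z: "z \<in> mid_dom" "snd z \<in> S3" and cd: "c > 0" "d > 0" and A: "linear A" "inj A"
  shows "frame tomei (psi_mid z) (\<lambda>v. dmid z (c * (snd z \<bullet> A v), d *\<^sub>R (A v - (snd z \<bullet> A v) *\<^sub>R snd z)))"
proof -
  have bb: "snd z \<bullet> snd z = 1" using z(2) by (simp add: dot_square_norm)
  define g where "g v = (c * (snd z \<bullet> A v), d *\<^sub>R (A v - (snd z \<bullet> A v) *\<^sub>R snd z))" for v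
  have lg: "linear g" unfolding g_def
    by (intro linearI) (simp_all add: linear_add[OF A(1)] linear_cmul[OF A(1)] inner_add_right algebra_simps)
  have lin: "linear (\<lambda>v. dmid z (g v))" using linear_compose[OF lg linear_dmid[OF z(1)]] by (simp add: o_def)
  have rg: "range g = {e. snd z \<bullet> snd e = 0}"
  proof (intro equalityI subsetI)
    fix e assume "e \<in> range g"
    then show "e \<in> {e. snd z \<bullet> snd e = 0}" using bb by (auto simp: g_def inner_diff_right)
  next
    fix e :: "real \<times> c2" assume e: "e \<in> {e. snd z \<bullet> snd e = 0}"
    obtain v where v: "A v = (fst e / c) *\<^sub>R snd z + inverse d *\<^sub>R snd e"
      using linear_injective_imp_surjective[OF A] by (metis surjD)
    have "snd z \<bullet> A v = fst e / c" using e bb by (simp add: v inner_add_right)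
    then have "g v = e" using cd by (simp add: g_def prod_eq_iff) (simp add: v)
    then show "e \<in> range g" by blast
  qed
  have kp: "kap (ma1 z) \<noteq> 0" "kap (ma3 z) \<noteq> 0"
    using kap_pos[of "ma1 z"] kap_pos[of "ma3 z"] z(1) by (auto simp: mid_dom_def)
  have inj0: "v = 0" if "dmid z (g v) = 0" for v
  proof -
    define e where "e = g v"
    have e0: "dmid z e = 0" using that by (simp add: e_def)
    define A1 where "A1 = fst e * (fst (snd z) \<bullet> fst (snd z)) + 2 * fst z * (fst (snd z) \<bullet> fst (snd e))"
    define A3 where "A3 = - (fst e * (snd (snd z) \<bullet> snd (snd z))) - 2 * fst z * (snd (snd z) \<bullet> snd (snd e))"
    have dm: "dmid z e = (A1, kap (ma1 z) *\<^sub>R fst (snd e) + (dkap (ma1 z) * A1) *\<^sub>R fst (snd z),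
         A3, kap (ma3 z) *\<^sub>R snd (snd e) + (dkap (ma3 z) * A3) *\<^sub>R snd (snd z))"
      by (simp add: dmid_def Let_def A1_def A3_def)
    have A0: "A1 = 0" "A3 = 0" using e0 by (simp_all add: dm prod_eq_iff)
    then have s: "fst (snd e) = 0" "snd (snd e) = 0"
      using e0 kp by (simp_all add: dm prod_eq_iff)
    have p: "fst e * (fst (snd z) \<bullet> fst (snd z)) = 0" "fst e * (snd (snd z) \<bullet> snd (snd z)) = 0"
      using A0 unfolding A1_def A3_def s by simp_all
    have "fst e * (snd z \<bullet> snd z) = 0" unfolding inner_prod_def distrib_left p by simp
    then have "e = 0" using bb s by (simp add: prod_eq_iff)
    then have "snd z \<bullet> A v = 0" "A v - (snd z \<bullet> A v) *\<^sub>R snd z = 0" using cd by (simp_all add: e_def g_def prod_eq_iff)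
    then have "A v = 0" by simp
    then show "v = 0" using A by (metis injD linear_0)
  qed
  have "range (\<lambda>v. dmid z (g v)) = dmid z ` range g" by (simp add: image_image)
  also have "\<dots> = tangent_space tomei (psi_mid z)" unfolding tangent_mid[OF z] rg by blast
  finally have "frame tomei (psi_mid z) (\<lambda>v. dmid z (g v))"
    using psi_mid_tomei[OF z] lin inj0 by (auto simp: frame_def linear_injective_0[OF lin])
  then show ?thesis by (simp add: g_def)
qed

lemma continuous_dside:
  assumes "continuous_on S X" "continuous_on S d" "\<And>s. s \<in> S \<Longrightarrow> X s \<in> side_dom"
  shows "continuous_on S (\<lambda>s. psi_side (X s))" "continuous_on S (\<lambda>s. dside (X s) (d s))"
proof -
  have ne: "fst (X s) - fst (snd (snd (X s))) \<noteq> 0" if "s \<in> S" for s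
    using assms(3)[OF that] by (simp add: side_dom_def)
  have k: "continuous_on S (\<lambda>s. k1 (X s))" "continuous_on S (\<lambda>s. k2 (X s))"
    unfolding k1_def k2_def by (intro continuous_intros assms(1); use ne in simp)+
  have kne: "k1 (X s) \<noteq> 0" "k2 (X s) \<noteq> 0" if "s \<in> S" for s using k_pos[OF assms(3)[OF that]] by auto
  show "continuous_on S (\<lambda>s. psi_side (X s))" unfolding psi_side_def by (intro continuous_intros assms(1) k)
  show "continuous_on S (\<lambda>s. dside (X s) (d s))"
    unfolding dside_def dk1_def dk2_def
    by (intro continuous_intros assms(1,2) k) (use ne kne in auto)
qed

lemma continuous_dmid:
  assumes "continuous_on S X" "continuous_on S d" "\<And>s. s \<in> S \<Longrightarrow> X s \<in> mid_dom"
  shows "continuous_on S (\<lambda>s. psi_mid (X s))" "continuous_on S (\<lambda>s. dmid (X s) (d s))"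
proof -
  have m: "continuous_on S (\<lambda>s. ma1 (X s))" "continuous_on S (\<lambda>s. ma3 (X s))"
    unfolding ma1_def ma3_def by (intro continuous_intros assms(1))+
  have k: "continuous_on S (\<lambda>s. kap (ma1 (X s)))" "continuous_on S (\<lambda>s. kap (ma3 (X s)))"
    unfolding kap_def by (intro continuous_intros m)+
  have kne: "kap (ma1 (X s)) \<noteq> 0" "kap (ma3 (X s)) \<noteq> 0" if "s \<in> S" for s
    using assms(3)[OF that] kap_pos[of "ma1 (X s)"] kap_pos[of "ma3 (X s)"] by (auto simp: mid_dom_def)
  show "continuous_on S (\<lambda>s. psi_mid (X s))" unfolding psi_mid_def by (intro continuous_intros assms(1) k m)
  show "continuous_on S (\<lambda>s. dmid (X s) (d s))"
    unfolding dmid_def Let_def dkap_def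
    by (intro continuous_intros assms(1,2) k m) (use kne in auto)
qed

text \<open>Near the sphere \<open>a\<^sub>1 = a\<^sub>3\<close> the two charts differ by polar coordinates.\<close>

definition disc_scale :: "c2 \<Rightarrow> c2" where "disc_scale x = (r1 *\<^sub>R fst x, r2 *\<^sub>R snd x)"

lemma norm_disc_scale: "(norm (disc_scale x))\<^sup>2 = rho1 * (fst x \<bullet> fst x) + rho2 * (snd x \<bullet> snd x)"
  unfolding power2_norm_eq_inner inner_prod_def disc_scale_def fst_conv snd_conv inner_scaleR_left inner_scaleR_right
    mult.assoc[symmetric] r_sq ..

definition polar :: "c2 \<Rightarrow> real \<times> c2" where "polar x = ((norm x)\<^sup>2, x /\<^sub>R norm x)"

definition bidisc_open :: "c2 set" where
  "bidisc_open = {x. fst x \<bullet> fst x < 1 \<and> snd x \<bullet> snd x < 1 \<and> x \<noteq> 0}"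

lemma open_bidisc_open: "open bidisc_open"
proof -
  have "open (- {0::c2})" by (intro open_Compl closed_singleton)
  moreover have "open {x::c2. fst x \<bullet> fst x < 1}" "open {x::c2. snd x \<bullet> snd x < 1}"
    by (intro open_Collect_less continuous_intros)+
  ultimately have "open ({x::c2. fst x \<bullet> fst x < 1} \<inter> {x. snd x \<bullet> snd x < 1} \<inter> - {0})"
    by (intro open_Int)
  also have "{x::c2. fst x \<bullet> fst x < 1} \<inter> {x. snd x \<bullet> snd x < 1} \<inter> - {0} = bidisc_open"
    by (auto simp: bidisc_open_def)
  finally show ?thesis .
qed

text \<open>The difference a1 - a3 is the squared norm of \<open>disc_scale x\<close>, so polar
  coordinates produce t and the point of the sphere. In the off-diagonal entries
  \<open>conorm\<close> accounts for the factor sqrt (l3 - a1), respectively sqrt (a3 - l1), of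
  \<open>kap\<close>.\<close>

lemma polar_chart:
  assumes x: "x \<in> bidisc_open"
  shows "psi_side (side_point x) = psi_mid (polar (disc_scale x))" "polar (disc_scale x) \<in> mid_dom" "snd (polar (disc_scale x)) \<in> S3" "disc_scale x \<noteq> 0"
proof -
  have b: "x \<in> bidisc" using x by (simp add: bidisc_def bidisc_open_def)
  define N where "N = norm (disc_scale x)"
  define n1 n2 where "n1 = fst x \<bullet> fst x" and "n2 = snd x \<bullet> snd x"
  have n: "0 \<le> n1" "n1 < 1" "0 \<le> n2" "n2 < 1" using x by (auto simp: bidisc_open_def n1_def n2_def)
  show nz: "disc_scale x \<noteq> 0" using x r_pos by (auto simp: bidisc_open_def disc_scale_def prod_eq_iff)
  then have N: "N > 0" by (simp add: N_def)
  have N2: "N * N = rho1 * n1 + rho2 * n2"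
    using norm_disc_scale[of x] by (simp add: N_def n1_def n2_def power2_eq_square)
  have p: "polar (disc_scale x) = (N * N, (inverse N * r1) *\<^sub>R fst x, (inverse N * r2) *\<^sub>R snd x)"
    by (simp add: polar_def disc_scale_def N_def power2_eq_square)
  have c: "N * N * (inverse N * r * (inverse N * r * w)) = r * r * w" for r w
    using N by (simp add: field_simps)
  have a: "ma1 (polar (disc_scale x)) = l2 + rho1 * n1" "ma3 (polar (disc_scale x)) = l2 - rho2 * n2"
    unfolding ma1_def ma3_def p fst_conv snd_conv inner_scaleR_left inner_scaleR_right c r_sq
    by (simp_all add: n1_def n2_def)
  have lt: "rho1 * n1 < rho1" "rho2 * n2 < rho2" "0 \<le> rho1 * n1" "0 \<le> rho2 * n2"
    using n l12 l23 by (auto intro: mult_left_less_imp_less)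
  show dom: "polar (disc_scale x) \<in> mid_dom" unfolding mid_dom_def mem_Collect_eq a using lt l12 l23 by (intro conjI) linarith+
  show "snd (polar (disc_scale x)) \<in> S3" using nz by (simp add: polar_def)
  have spx: "side_point x = (l2 + rho1 * n1, (rho1 * conorm (fst x)) *\<^sub>R fst x, l2 - rho2 * n2, (rho2 * conorm (snd x)) *\<^sub>R snd x)"
    by (simp add: side_point_def n1_def n2_def)
  have diff: "l2 + rho1 * n1 - (l2 - rho2 * n2) = N * N" using N2 by simp
  have sN: "sqrt (N * N) = N" using N by simp
  have k1: "k1 (side_point x) * (rho1 * conorm (fst x)) = kap (l2 + rho1 * n1) * (inverse N * r1)"
  proof -
    have "kap (l2 + rho1 * n1) = sqrt (l2 + rho1 * n1 - l1) * (r1 * conorm (fst x))"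
    proof -
      have eq: "(l2 + rho1 * n1 - l1) * (l3 - (l2 + rho1 * n1)) = (l2 + rho1 * n1 - l1) * (rho1 * (1 - n1))"
        by (simp add: algebra_simps)
      show ?thesis unfolding kap_def eq unfolding real_sqrt_mult conorm_def r1_def n1_def ..
    qed
    moreover have "k1 (side_point x) = sqrt (l2 + rho1 * n1 - l1) / N"
      unfolding k1_def spx fst_conv snd_conv diff real_sqrt_divide sN ..
    ultimately show ?thesis unfolding divide_inverse r_sq[symmetric] by (simp only: ac_simps)
  qed
  have k2: "k2 (side_point x) * (rho2 * conorm (snd x)) = kap (l2 - rho2 * n2) * (inverse N * r2)"
  proof -
    have "kap (l2 - rho2 * n2) = sqrt (l3 - (l2 - rho2 * n2)) * (r2 * conorm (snd x))"
    proof -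
      have eq: "(l2 - rho2 * n2 - l1) * (l3 - (l2 - rho2 * n2)) = (l3 - (l2 - rho2 * n2)) * (rho2 * (1 - n2))"
        by (simp add: algebra_simps)
      show ?thesis unfolding kap_def eq unfolding real_sqrt_mult conorm_def r2_def n2_def ..
    qed
    moreover have "k2 (side_point x) = sqrt (l3 - (l2 - rho2 * n2)) / N"
      unfolding k2_def spx fst_conv snd_conv diff real_sqrt_divide sN ..
    ultimately show ?thesis unfolding divide_inverse r_sq[symmetric] by (simp only: ac_simps)
  qed
  show "psi_side (side_point x) = psi_mid (polar (disc_scale x))"
    unfolding psi_mid_def a unfolding psi_side_def p fst_conv snd_conv
    unfolding scaleR_scaleR spx fst_conv snd_conv k1[unfolded spx] k2[unfolded spx] ..
qed

definition dpolar :: "c2 \<Rightarrow> c2 \<Rightarrow> real \<times> c2" where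
  "dpolar b w = (2 * (b \<bullet> w), inverse (norm b) *\<^sub>R (w - ((b \<bullet> w) / (norm b)\<^sup>2) *\<^sub>R b))"

lemma polar_deriv: assumes "b \<noteq> 0" shows "(polar has_derivative dpolar b) (at b)"
proof -
  have i: "((\<lambda>x::c2. inverse (norm x)) has_derivative (\<lambda>w. - ((b \<bullet> w) / (norm b) ^ 3))) (at b)"
    by (rule has_derivative_eq_rhs[OF Deriv.has_derivative_inverse[OF _ has_derivative_norm[OF assms]]])
      (use assms in \<open>auto simp: fun_eq_iff sgn_div_norm inner_commute field_simps power3_eq_cube\<close>)
  have s: "((\<lambda>x::c2. x /\<^sub>R norm x) has_derivative (\<lambda>w. inverse (norm b) *\<^sub>R (w - ((b \<bullet> w) / (norm b)\<^sup>2) *\<^sub>R b))) (at b)"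
    by (rule has_derivative_eq_rhs[OF has_derivative_scaleR[OF i has_derivative_ident]])
      (use assms in \<open>simp add: fun_eq_iff scaleR_diff_right power3_eq_cube power2_eq_square divide_inverse\<close>)
  have n: "((\<lambda>x::c2. (norm x)\<^sup>2) has_derivative (\<lambda>w. 2 * (b \<bullet> w))) (at b)"
    unfolding power2_norm_eq_inner by (auto intro!: derivative_eq_intros simp: inner_commute)
  show ?thesis unfolding polar_def[abs_def] dpolar_def[abs_def] by (intro has_derivative_Pair n s)
qed

text \<open>The vector at \<open>disc_scale x\<close> that represents \<open>side_vec x v\<close>.
  It makes sense only in the open bidisc, since \<open>conorm\<close> vanishes on the boundary
  circles.\<close>

definition tan_scale :: "c2 \<Rightarrow> c2 \<Rightarrow> c2" where
  "tan_scale x v = (inverse (conorm (fst x) * r1) *\<^sub>R (fst v - (fst x \<bullet> fst v) *\<^sub>R fst x),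
             inverse (conorm (snd x) * r2) *\<^sub>R (snd v - (snd x \<bullet> snd v) *\<^sub>R snd x))"

lemma conorm_deriv:
  assumes "z \<bullet> z < 1"
  shows "(conorm has_derivative (\<lambda>w. - ((z \<bullet> w) / conorm z))) (at z)"
proof -
  have p: "0 < 1 - z \<bullet> z" using assms by simp
  have "((\<lambda>z::complex. 1 - z \<bullet> z) has_derivative (\<lambda>w. - (2 * (z \<bullet> w)))) (at z)"
    by (auto intro!: derivative_eq_intros simp: inner_commute)
  from has_derivative_real_sqrt[OF p this] show ?thesis
    unfolding conorm_def[abs_def] by (rule has_derivative_eq_rhs) (simp add: fun_eq_iff divide_simps)
qed

text \<open>Both sides are values of the derivative of one and the same map, written in two charts;
  uniqueness of derivatives spares a comparison of the formulas for \<open>dside\<close> and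
  \<open>dmid\<close>.\<close>

lemma side_frame_polar:
  assumes x: "x \<in> bidisc_open"
  shows "dside (side_point x) (side_vec x v) = dmid (polar (disc_scale x)) (dpolar (disc_scale x) (tan_scale x v))"
proof -
  have b: "x \<in> bidisc" using x by (simp add: bidisc_def bidisc_open_def)
  have lt: "fst x \<bullet> fst x < 1" "snd x \<bullet> snd x < 1" using x by (auto simp: bidisc_open_def)
  have y: "conorm (fst x) \<noteq> 0" "conorm (snd x) \<noteq> 0" using conorm_pos[OF lt(1)] conorm_pos[OF lt(2)] by auto
  have y2: "conorm (fst x) * conorm (fst x) = 1 - fst x \<bullet> fst x" "conorm (snd x) * conorm (snd x) = 1 - snd x \<bullet> snd x"
    using lt by (auto intro!: conorm_sq)
  define dsp where "dsp V = (rho1 * (2 * (fst x \<bullet> fst V)), (rho1 * conorm (fst x)) *\<^sub>R fst V + (rho1 * - ((fst x \<bullet> fst V) / conorm (fst x))) *\<^sub>R fst x,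
      - (rho2 * (2 * (snd x \<bullet> snd V))), (rho2 * conorm (snd x)) *\<^sub>R snd V + (rho2 * - ((snd x \<bullet> snd V) / conorm (snd x))) *\<^sub>R snd x)" for V
  have f: "((\<lambda>x::c2. fst x) has_derivative (\<lambda>V. fst V)) (at x)" "((\<lambda>x::c2. snd x) has_derivative (\<lambda>V. snd V)) (at x)"
    by (auto intro!: derivative_eq_intros)
  have yd: "((\<lambda>x. rho1 * conorm (fst x)) has_derivative (\<lambda>V. rho1 * - ((fst x \<bullet> fst V) / conorm (fst x)))) (at x)"
    "((\<lambda>x. rho2 * conorm (snd x)) has_derivative (\<lambda>V. rho2 * - ((snd x \<bullet> snd V) / conorm (snd x)))) (at x)"
    by (intro has_derivative_mult_right has_derivative_compose[OF f(1) conorm_deriv[OF lt(1)]] has_derivative_compose[OF f(2) conorm_deriv[OF lt(2)]])+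
  have nd: "((\<lambda>x::c2. l2 + rho1 * (fst x \<bullet> fst x)) has_derivative (\<lambda>V. rho1 * (2 * (fst x \<bullet> fst V)))) (at x)"
    "((\<lambda>x::c2. l2 - rho2 * (snd x \<bullet> snd x)) has_derivative (\<lambda>V. - (rho2 * (2 * (snd x \<bullet> snd V))))) (at x)"
    by (auto intro!: derivative_eq_intros simp: inner_commute)
  have "(side_point has_derivative dsp) (at x)"
    unfolding side_point_def[abs_def] dsp_def[abs_def]
    by (intro has_derivative_Pair has_derivative_scaleR f yd nd)
  then have L: "((\<lambda>x. psi_side (side_point x)) has_derivative (\<lambda>V. dside (side_point x) (dsp V))) (at x)"
    using has_derivative_compose[of side_point dsp x UNIV psi_side "dside (side_point x)"] psi_side_deriv[OF side_point_dom[OF b]] by blast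
  have "(disc_scale has_derivative disc_scale) (at x)"
    unfolding disc_scale_def[abs_def] by (auto intro!: derivative_eq_intros)
  then have "((\<lambda>x. polar (disc_scale x)) has_derivative (\<lambda>V. dpolar (disc_scale x) (disc_scale V))) (at x)"
    using has_derivative_compose[of disc_scale disc_scale x UNIV polar "dpolar (disc_scale x)"] polar_deriv[OF polar_chart(4)[OF x]] by blast
  then have "((\<lambda>x. psi_mid (polar (disc_scale x))) has_derivative (\<lambda>V. dmid (polar (disc_scale x)) (dpolar (disc_scale x) (disc_scale V)))) (at x)"
    using has_derivative_compose[of "\<lambda>x. polar (disc_scale x)" "\<lambda>V. dpolar (disc_scale x) (disc_scale V)" x UNIV psi_mid "dmid (polar (disc_scale x))"]
      psi_mid_deriv[OF polar_chart(2)[OF x]] by blast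
  then have "((\<lambda>x. psi_side (side_point x)) has_derivative (\<lambda>V. dmid (polar (disc_scale x)) (dpolar (disc_scale x) (disc_scale V)))) (at x)"
    by (rule has_derivative_transform_within_open[OF _ open_bidisc_open x]) (simp add: polar_chart(1))
  then have eq: "dside (side_point x) (dsp V) = dmid (polar (disc_scale x)) (dpolar (disc_scale x) (disc_scale V))" for V
    using has_derivative_unique[OF L] by (metis)
  \<comment> \<open>The solution of \<open>dsp V = side_vec x v\<close>, obtained by removing the
    radial component and rescaling.\<close>
  define V where "V = (inverse (conorm (fst x) * rho1) *\<^sub>R (fst v - (fst x \<bullet> fst v) *\<^sub>R fst x),
      inverse (conorm (snd x) * rho2) *\<^sub>R (snd v - (snd x \<bullet> snd v) *\<^sub>R snd x))"
  have rV: "disc_scale V = tan_scale x v"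
    using r_pos l12 l23 unfolding disc_scale_def V_def tan_scale_def by (simp flip: r_sq)
  have red: "rho * (2 * (z \<bullet> W)) = 2 * Y * (z \<bullet> w)"
    "(rho * Y) *\<^sub>R W + (rho * - ((z \<bullet> W) / Y)) *\<^sub>R z = w - (2 * (z \<bullet> w)) *\<^sub>R z"
    if W: "W = inverse (Y * rho) *\<^sub>R (w - (z \<bullet> w) *\<^sub>R z)" and Y: "Y \<noteq> 0" "Y * Y = 1 - z \<bullet> z" and r: "rho \<noteq> 0"
    for rho Y and z w W :: complex
  proof -
    have "z \<bullet> W = inverse (Y * rho) * ((z \<bullet> w) * (1 - z \<bullet> z))"
      unfolding W by (simp add: inner_diff_right algebra_simps)
    then have zW: "z \<bullet> W = (z \<bullet> w) * Y / rho" using Y(1) r unfolding Y(2)[symmetric] by (simp add: field_simps)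
    show "rho * (2 * (z \<bullet> W)) = 2 * Y * (z \<bullet> w)" unfolding zW using r by simp
    have "rho * Y * inverse (Y * rho) = 1" using Y(1) r by (simp add: field_simps)
    then have rW: "(rho * Y) *\<^sub>R W = w - (z \<bullet> w) *\<^sub>R z" unfolding W scaleR_scaleR by simp
    have rz: "rho * - ((z \<bullet> W) / Y) = - (z \<bullet> w)" unfolding zW using Y r by simp
    show "(rho * Y) *\<^sub>R W + (rho * - ((z \<bullet> W) / Y)) *\<^sub>R z = w - (2 * (z \<bullet> w)) *\<^sub>R z"
      unfolding rW rz mult_2 scaleR_add_left by simp
  qed
  have ne: "rho1 \<noteq> 0" "rho2 \<noteq> 0" using l12 l23 by auto
  have W: "fst V = inverse (conorm (fst x) * rho1) *\<^sub>R (fst v - (fst x \<bullet> fst v) *\<^sub>R fst x)"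
    "snd V = inverse (conorm (snd x) * rho2) *\<^sub>R (snd v - (snd x \<bullet> snd v) *\<^sub>R snd x)" by (simp_all add: V_def)
  have "dsp V = side_vec x v"
    unfolding dsp_def side_vec_def red[OF W(1) y(1) y2(1) ne(1)] red[OF W(2) y(2) y2(2) ne(2)] ..
  then show ?thesis using eq[of V] rV by simp
qed


text \<open>The component of v along \<beta> becomes the t-direction, transversal to the separating
  sphere, and the orthogonal part becomes tangent to it.\<close>

definition mid_eq_frame :: "c2 \<Rightarrow> c2 \<Rightarrow> P4" where
  "mid_eq_frame \<beta> v = dmid (0, \<beta>) (\<beta> \<bullet> v, v - (\<beta> \<bullet> v) *\<^sub>R \<beta>)"

section \<open>Frames joining the boundary of the bidisc to the separating sphere\<close>

definition eps :: real where "eps = min r1 r2 / 2"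

lemma eps: "eps > 0" "eps / r1 \<le> 1/2" "eps / r2 \<le> 1/2" "eps * eps < rho1" "eps * eps < rho2"
proof -
  show p: "eps > 0" using r_pos by (simp add: eps_def)
  show "eps / r1 \<le> 1/2" "eps / r2 \<le> 1/2" using r_pos by (simp_all add: eps_def divide_le_eq min_def)
  have "eps < r1" "eps < r2" using r_pos by (auto simp: eps_def min_def)
  then have "eps * eps < r1 * r1" "eps * eps < r2 * r2" using p by (auto intro!: mult_strict_mono)
  then show "eps * eps < rho1" "eps * eps < rho2" by (simp_all only: r_sq)
qed

text \<open>Moves the sphere of radius \<open>eps\<close> in the coordinates
  \<open>disc_scale\<close>, at time 0, to the boundary of the bidisc, at time 1, where division by
  the larger modulus puts a coordinate on the unit circle. The size of \<open>eps\<close> keeps the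
  small sphere in the open bidisc.\<close>

definition disc_path :: "real \<times> c2 \<Rightarrow> c2" where
  "disc_path z = (((1 - fst z) * (eps / r1) + fst z / max (cmod (fst (snd z))) (cmod (snd (snd z)))) *\<^sub>R fst (snd z),
           ((1 - fst z) * (eps / r2) + fst z / max (cmod (fst (snd z))) (cmod (snd (snd z)))) *\<^sub>R snd (snd z))"

lemma S3_bounds:
  assumes "b \<in> S3"
  shows "cmod (fst b) \<le> 1" "cmod (snd b) \<le> 1" "0 < max (cmod (fst b)) (cmod (snd b))"
proof -
  have s: "(cmod (fst b))\<^sup>2 + (cmod (snd b))\<^sup>2 = 1" using assms by (simp only: mem_S3_iff)
  then have "(cmod (fst b))\<^sup>2 \<le> 1\<^sup>2" "(cmod (snd b))\<^sup>2 \<le> 1\<^sup>2" by (smt (verit) one_power2 zero_le_power2)+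
  then show "cmod (fst b) \<le> 1" "cmod (snd b) \<le> 1" by (meson norm_ge_zero power2_le_imp_le zero_le_one)+
  show "0 < max (cmod (fst b)) (cmod (snd b))" using s by (auto simp: less_max_iff_disj)
qed

lemma scaled_le_one:
  fixes b :: complex
  assumes "t \<in> {0..1}" "0 \<le> e" "e \<le> 1/2" "cmod b \<le> 1" "cmod b \<le> m" "0 < m"
  shows "((1 - t) * e + t / m) *\<^sub>R b \<bullet> ((1 - t) * e + t / m) *\<^sub>R b \<le> 1"
proof -
  have c: "0 \<le> (1 - t) * e + t / m" using assms by simp
  have "((1 - t) * e + t / m) * cmod b = (1 - t) * (e * cmod b) + t * (cmod b / m)"
    by (simp add: algebra_simps)
  also have "\<dots> \<le> (1 - t) * 1 + t * 1"
  proof -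
    have "e * cmod b \<le> 1 * 1" using assms by (intro mult_mono) auto
    moreover have "cmod b / m \<le> 1" using assms by simp
    ultimately show ?thesis using assms(1) by (intro add_mono mult_left_mono) auto
  qed
  finally have "norm (((1 - t) * e + t / m) *\<^sub>R b) \<le> 1" unfolding norm_scaleR using c by simp
  then show ?thesis unfolding power2_norm_eq_inner[symmetric] by (simp add: power_le_one_iff del: norm_scaleR)
qed

lemma disc_path_bidisc:
  assumes "t \<in> {0..1}" "b \<in> S3"
  shows "disc_path (t, b) \<in> bidisc"
proof -
  let ?m = "max (cmod (fst b)) (cmod (snd b))"
  have e: "0 \<le> eps / r1" "0 \<le> eps / r2" using eps r_pos by (simp_all add: less_imp_le)
  note B = S3_bounds[OF assms(2)]
  have c: "(1 - t) * (eps / r) + t / ?m > 0" if "r > 0" for r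
  proof (cases "t = 0")
    case True then show ?thesis using eps that by simp
  next
    case False
    then show ?thesis using eps that assms(1) B(3) by (intro add_nonneg_pos) auto
  qed
  have "disc_path (t, b) \<noteq> 0"
    using c[OF r_pos(1)] c[OF r_pos(2)] B(3) unfolding disc_path_def by (auto simp: prod_eq_iff)
  then show ?thesis
    unfolding bidisc_def mem_Collect_eq unfolding disc_path_def fst_conv snd_conv
    using scaled_le_one[OF assms(1) e(1) eps(2) B(1) _ B(3)] scaled_le_one[OF assms(1) e(2) eps(3) B(2) _ B(3)] by auto
qed

lemma continuous_disc_path: "continuous_on ({0..1} \<times> S3) disc_path"
proof -
  have "max (cmod (fst (snd z))) (cmod (snd (snd z))) \<noteq> 0" if "z \<in> {0..1} \<times> S3" for z :: "real \<times> c2"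
    using S3_bounds(3)[of "snd z"] that by (metis mem_Sigma_iff order_less_irrefl prod.collapse)
  then show ?thesis unfolding disc_path_def[abs_def] by (intro continuous_intros) auto
qed

lemma side_family:
  "continuous_on ({0..1} \<times> S3) (\<lambda>z. psi_side (side_point (disc_path z)))"
  "continuous_on ({0..1} \<times> S3) (\<lambda>z. dside (side_point (disc_path z)) (side_vec (disc_path z) v))"
  "z \<in> {0..1} \<times> S3 \<Longrightarrow> frame tomei (psi_side (side_point (disc_path z))) (\<lambda>v. dside (side_point (disc_path z)) (side_vec (disc_path z) v))"
proof -
  have b: "disc_path z \<in> bidisc" if "z \<in> {0..1} \<times> S3" for z using disc_path_bidisc[of "fst z" "snd z"] that by auto
  note c = continuous_disc_path
  have side_point: "continuous_on ({0..1} \<times> S3) (\<lambda>z. side_point (disc_path z))"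
    unfolding side_point_def conorm_def by (intro continuous_intros c)
  have side_vec: "continuous_on ({0..1} \<times> S3) (\<lambda>z. side_vec (disc_path z) v)"
    unfolding side_vec_def conorm_def by (intro continuous_intros c)
  show "continuous_on ({0..1} \<times> S3) (\<lambda>z. psi_side (side_point (disc_path z)))"
    "continuous_on ({0..1} \<times> S3) (\<lambda>z. dside (side_point (disc_path z)) (side_vec (disc_path z) v))"
    using continuous_dside[OF side_point side_vec side_point_dom[OF b]] by blast+
  show "frame tomei (psi_side (side_point (disc_path z))) (\<lambda>v. dside (side_point (disc_path z)) (side_vec (disc_path z) v))" if "z \<in> {0..1} \<times> S3"
    by (rule side_frame[OF b[OF that]])
qed

text \<open>Deforms the frame of the side chart near the separating sphere into the frame of the middle
  chart on that sphere; it stays a frame since \<open>\<langle>v, blend z v\<rangle> > 0\<close> for \<open>v \<noteq> 0\<close>.\<close>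

definition blend_weight :: "real \<Rightarrow> real \<Rightarrow> complex \<Rightarrow> real" where
  "blend_weight s r x = (1 - s) * inverse (conorm x * r)"

definition blend :: "real \<times> c2 \<Rightarrow> c2 \<Rightarrow> c2" where
  "blend z v = (let x = disc_path (0, snd z); s = fst z in
     (blend_weight s r1 (fst x) *\<^sub>R (fst v - (fst x \<bullet> fst v) *\<^sub>R fst x) + s *\<^sub>R fst v,
      blend_weight s r2 (snd x) *\<^sub>R (snd v - (snd x \<bullet> snd v) *\<^sub>R snd x) + s *\<^sub>R snd v))"

text \<open>The start is at \<open>eps * eps\<close> because \<open>polar\<close> squares the
  radius.\<close>

definition mid_path :: "real \<times> c2 \<Rightarrow> real \<times> c2" where "mid_path z = ((1 - fst z) * (eps * eps), snd z)"

text \<open>The factors 2 eps and 1 / eps at time 0 are those of \<open>dpolar\<close> on the sphere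
  of radius \<open>eps\<close>; at time 1 both have become 1, as in
  \<open>mid_eq_frame\<close>.\<close>

definition mid_path_vec :: "real \<times> c2 \<Rightarrow> c2 \<Rightarrow> real \<times> c2" where
  "mid_path_vec z v = (((1 - fst z) * (2 * eps) + fst z) * (snd z \<bullet> blend z v),
     ((1 - fst z) / eps + fst z) *\<^sub>R (blend z v - (snd z \<bullet> blend z v) *\<^sub>R snd z))"

lemma disc_path0: "disc_path (0, b) = ((eps / r1) *\<^sub>R fst b, (eps / r2) *\<^sub>R snd b)"
  by (simp add: disc_path_def)

lemma disc_path0_bounds:
  assumes "b \<in> S3"
  shows "fst (disc_path (0, b)) \<bullet> fst (disc_path (0, b)) < 1" "snd (disc_path (0, b)) \<bullet> snd (disc_path (0, b)) < 1" "disc_path (0, b) \<in> bidisc_open"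
proof -
  have *: "e *\<^sub>R x \<bullet> e *\<^sub>R x < 1" if "0 < e" "e \<le> 1/2" "cmod x \<le> 1" for e and x :: complex
  proof -
    have "e * cmod x \<le> 1/2 * 1" using that by (intro mult_mono) auto
    then have "norm (e *\<^sub>R x) < 1" using that by simp
    then show ?thesis unfolding power2_norm_eq_inner[symmetric] by (simp add: power_less_one_iff abs_square_less_1 del: norm_scaleR)
  qed
  have e: "0 < eps / r1" "0 < eps / r2" using eps r_pos by simp_all
  show 1: "fst (disc_path (0, b)) \<bullet> fst (disc_path (0, b)) < 1" "snd (disc_path (0, b)) \<bullet> snd (disc_path (0, b)) < 1"
    unfolding disc_path0 fst_conv snd_conv using *[OF e(1) eps(2)] *[OF e(2) eps(3)] S3_bounds[OF assms] by auto
  then show "disc_path (0, b) \<in> bidisc_open" using disc_path_bidisc[OF _ assms, of 0] by (simp add: bidisc_open_def bidisc_def)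
qed

lemma half_blend_inj:
  fixes x v :: complex
  assumes x: "x \<bullet> x < 1" and p: "0 \<le> p" "0 \<le> s" "p + s > 0"
    and z: "p *\<^sub>R (v - (x \<bullet> v) *\<^sub>R x) + s *\<^sub>R v = 0"
  shows "v = 0"
proof (rule ccontr)
  assume v: "v \<noteq> 0"
  have "(x \<bullet> v)\<^sup>2 \<le> (x \<bullet> x) * (v \<bullet> v)" by (rule Cauchy_Schwarz_ineq)
  also have "\<dots> < 1 * (v \<bullet> v)" using x v by (intro mult_strict_right_mono) auto
  finally have lt: "v \<bullet> v - (x \<bullet> v)\<^sup>2 > 0" by simp
  have "0 = v \<bullet> (p *\<^sub>R (v - (x \<bullet> v) *\<^sub>R x) + s *\<^sub>R v)" unfolding z by simp
  also have "\<dots> = p * (v \<bullet> v - (x \<bullet> v)\<^sup>2) + s * (v \<bullet> v)"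
    by (simp add: inner_add_right inner_diff_right inner_commute power2_eq_square)
  also have "\<dots> > 0"
  proof (cases "p = 0")
    case True then show ?thesis using p v by simp
  next
    case False then show ?thesis using p lt v by (intro add_pos_nonneg mult_pos_pos) auto
  qed
  finally show False by simp
qed

lemma linear_blend: "linear (blend z)"
proof (rule linearI)
  have a: "p *\<^sub>R (v + w - (x \<bullet> (v + w)) *\<^sub>R x) + s *\<^sub>R (v + w) =
     (p *\<^sub>R (v - (x \<bullet> v) *\<^sub>R x) + s *\<^sub>R v) + (p *\<^sub>R (w - (x \<bullet> w) *\<^sub>R x) + s *\<^sub>R w)" for p s and x v w :: complex
    by (simp add: inner_add_right scaleR_add_left scaleR_add_right scaleR_diff_right)
  have c: "p *\<^sub>R (c *\<^sub>R v - (x \<bullet> (c *\<^sub>R v)) *\<^sub>R x) + s *\<^sub>R (c *\<^sub>R v) =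
     c *\<^sub>R (p *\<^sub>R (v - (x \<bullet> v) *\<^sub>R x) + s *\<^sub>R v)" for p s c and x v :: complex
    by (simp add: scaleR_add_right scaleR_diff_right mult.left_commute mult.commute)
  fix v w and c :: real
  show "blend z (v + w) = blend z v + blend z w" unfolding blend_def Let_def fst_add snd_add a add_Pair ..
  show "blend z (c *\<^sub>R v) = c *\<^sub>R blend z v" unfolding blend_def Let_def fst_scaleR snd_scaleR c scaleR_Pair ..
qed

lemma inj_blend:
  assumes "s \<in> {0..1}" "b \<in> S3"
  shows "inj (blend (s, b))"
  unfolding linear_injective_0[OF linear_blend]
proof (intro allI impI)
  fix v assume z: "blend (s, b) v = 0"
  note X = disc_path0_bounds[OF assms(2)]
  have w: "blend_weight s r x \<ge> 0" "blend_weight s r x + s > 0" if "x \<bullet> x < 1" "r > 0" for x r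
  proof -
    have i: "inverse (conorm x * r) > 0" using conorm_pos[OF that(1)] that(2) by simp
    then show n: "blend_weight s r x \<ge> 0" using assms(1) by (simp add: blend_weight_def del: inverse_mult_distrib)
    show "blend_weight s r x + s > 0"
    proof (cases "s = 0")
      case True then show ?thesis using i by (simp add: blend_weight_def del: inverse_mult_distrib)
    next
      case False then show ?thesis using n assms(1) by (intro add_nonneg_pos) auto
    qed
  qed
  have "fst v = 0"
    by (rule half_blend_inj[OF X(1) w(1)[OF X(1) r_pos(1)] _ w(2)[OF X(1) r_pos(1)]])
      (use z assms in \<open>auto simp: blend_def Let_def zero_prod_def\<close>)
  moreover have "snd v = 0"
    by (rule half_blend_inj[OF X(2) w(1)[OF X(2) r_pos(2)] _ w(2)[OF X(2) r_pos(2)]])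
      (use z assms in \<open>auto simp: blend_def Let_def zero_prod_def\<close>)
  ultimately show "v = 0" by (simp add: prod_eq_iff)
qed

lemma mid_path_dom:
  assumes "s \<in> {0..1}" "b \<in> S3"
  shows "mid_path (s, b) \<in> mid_dom" "snd (mid_path (s, b)) \<in> S3"
proof -
  have *: "0 \<le> (1 - s) * (eps * eps) * (x \<bullet> x)" "(1 - s) * (eps * eps) * (x \<bullet> x) \<le> eps * eps" if "cmod x \<le> 1" for x
  proof -
    show "0 \<le> (1 - s) * (eps * eps) * (x \<bullet> x)" using assms by simp
    have "x \<bullet> x \<le> 1" using that unfolding power2_norm_eq_inner[symmetric] by (simp add: power_le_one_iff)
    then have "(1 - s) * (eps * eps) * (x \<bullet> x) \<le> 1 * (eps * eps) * 1" using assms eps(1) by (intro mult_mono) auto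
    then show "(1 - s) * (eps * eps) * (x \<bullet> x) \<le> eps * eps" by simp
  qed
  note B = S3_bounds[OF assms(2)]
  show "mid_path (s, b) \<in> mid_dom"
    unfolding mid_dom_def mem_Collect_eq ma1_def ma3_def mid_path_def fst_conv snd_conv
    using *[OF B(1)] *[OF B(2)] eps(4,5) l12 l23 by (intro conjI) linarith+
  show "snd (mid_path (s, b)) \<in> S3" using assms(2) by (simp only: mid_path_def snd_conv)
qed

lemma mid_family:
  "continuous_on ({0..1} \<times> S3) (\<lambda>z. psi_mid (mid_path z))"
  "continuous_on ({0..1} \<times> S3) (\<lambda>z. dmid (mid_path z) (mid_path_vec z v))"
  "z \<in> {0..1} \<times> S3 \<Longrightarrow> frame tomei (psi_mid (mid_path z)) (\<lambda>v. dmid (mid_path z) (mid_path_vec z v))"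
proof -
  have d: "mid_path z \<in> mid_dom" "snd (mid_path z) \<in> S3" if "z \<in> {0..1} \<times> S3" for z
    using mid_path_dom[of "fst z" "snd z"] that by (auto simp del: mem_sphere_0)
  have zc: "continuous_on ({0..1} \<times> S3) mid_path" unfolding mid_path_def[abs_def] by (intro continuous_intros)
  have x0: "continuous_on ({0..1} \<times> S3) (\<lambda>z. disc_path (0, snd z))" unfolding disc_path0 by (intro continuous_intros)
  have yn: "conorm (fst (disc_path (0, snd z))) * r1 \<noteq> 0" "conorm (snd (disc_path (0, snd z))) * r2 \<noteq> 0" if "z \<in> {0..1} \<times> S3" for z :: "real \<times> c2"
  proof -
    have "snd z \<in> S3" using that by (metis mem_Times_iff)
    then show "conorm (fst (disc_path (0, snd z))) * r1 \<noteq> 0" "conorm (snd (disc_path (0, snd z))) * r2 \<noteq> 0"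
      using disc_path0_bounds conorm_pos r_pos by (metis mult_pos_pos order_less_irrefl)+
  qed
  have yc: "continuous_on ({0..1} \<times> S3) (\<lambda>z. conorm (fst (disc_path (0, snd z))))" "continuous_on ({0..1} \<times> S3) (\<lambda>z. conorm (snd (disc_path (0, snd z))))"
    unfolding conorm_def by (intro continuous_intros x0)+
  have wc: "continuous_on ({0..1} \<times> S3) (\<lambda>z. blend_weight (fst z) r1 (fst (disc_path (0, snd z))))"
    "continuous_on ({0..1} \<times> S3) (\<lambda>z. blend_weight (fst z) r2 (snd (disc_path (0, snd z))))"
    unfolding blend_weight_def by (intro continuous_intros yc; use yn in blast)+
  have bc: "continuous_on ({0..1} \<times> S3) (\<lambda>z. blend z v)"
    unfolding blend_def Let_def by (intro continuous_intros x0 wc)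
  have dc: "continuous_on ({0..1} \<times> S3) (\<lambda>z. mid_path_vec z v)"
    unfolding mid_path_vec_def using eps by (intro continuous_intros bc) auto
  show "continuous_on ({0..1} \<times> S3) (\<lambda>z. psi_mid (mid_path z))"
    "continuous_on ({0..1} \<times> S3) (\<lambda>z. dmid (mid_path z) (mid_path_vec z v))"
    using continuous_dmid[OF zc dc d(1)] by blast+
  show "frame tomei (psi_mid (mid_path z)) (\<lambda>v. dmid (mid_path z) (mid_path_vec z v))" if z: "z \<in> {0..1} \<times> S3"
  proof -
    obtain s b where sb: "z = (s, b)" "s \<in> {0..1}" "b \<in> S3" using z by blast
    have c: "(1 - s) * (2 * eps) + s > 0" "(1 - s) / eps + s > 0"
    proof -
      have "(1 - s) * c + s > 0" if "c > 0" for c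
        using sb(2) that by (cases "s = 0") (auto intro!: add_nonneg_pos)
      from this[of "2 * eps"] this[of "inverse eps"] show "(1 - s) * (2 * eps) + s > 0" "(1 - s) / eps + s > 0"
        using eps(1) by (simp_all add: divide_inverse)
    qed
    have "snd (mid_path z) = b" by (simp add: mid_path_def sb)
    then show ?thesis
      using mid_frame[OF d[OF z] c linear_blend[of z] inj_blend[OF sb(2,3), folded sb(1)]] by (simp add: mid_path_vec_def sb(1))
  qed
qed

text \<open>The disc coordinates at time 0 are scaled to eps b, where
  \<open>side_frame_polar\<close> translates one frame into the other.\<close>

lemma families_meet:
  assumes b: "b \<in> S3"
  shows "psi_mid (mid_path (0, b)) = psi_side (side_point (disc_path (0, b)))"
    "dmid (mid_path (0, b)) (mid_path_vec (0, b) v) = dside (side_point (disc_path (0, b))) (side_vec (disc_path (0, b)) v)"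
proof -
  note o = disc_path0_bounds(3)[OF b]
  have rx: "disc_scale (disc_path (0, b)) = eps *\<^sub>R b" using r_pos by (simp add: disc_scale_def disc_path0 prod_eq_iff)
  have nb: "norm b = 1" using b by simp
  then have ne: "norm (eps *\<^sub>R b) = eps" using eps(1) by simp
  have pz: "polar (disc_scale (disc_path (0, b))) = mid_path (0, b)"
    unfolding rx polar_def ne using eps(1) by (simp add: mid_path_def power2_eq_square)
  show "psi_mid (mid_path (0, b)) = psi_side (side_point (disc_path (0, b)))" using polar_chart(1)[OF o] by (simp add: pz)
  have "blend (0, b) v = tan_scale (disc_path (0, b)) v" by (simp add: blend_def tan_scale_def blend_weight_def Let_def)
  then have "mid_path_vec (0, b) v = dpolar (disc_scale (disc_path (0, b))) (tan_scale (disc_path (0, b)) v)"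
    unfolding rx dpolar_def ne mid_path_vec_def using eps(1) by (simp add: power2_eq_square divide_inverse)
  then show "dmid (mid_path (0, b)) (mid_path_vec (0, b) v) = dside (side_point (disc_path (0, b))) (side_vec (disc_path (0, b)) v)"
    using side_frame_polar[OF o] by (simp only: pz)
qed

lemma mid_family_end: "mid_path (1, b) = (0, b)" "dmid (mid_path (1, b)) (mid_path_vec (1, b) v) = mid_eq_frame b v"
  by (simp_all add: mid_path_def mid_path_vec_def mid_eq_frame_def blend_def blend_weight_def Let_def)

text \<open>On the boundary \<open>\<bar>x\<^sub>1\<bar> = 1\<close> of the closed disc the chart collapses a circle, and the frame
  rotates twice along it.\<close>

lemma half_boundary:
  fixes u x v :: complex
  assumes "cmod u = 1" "cmod x = 1"
  shows "v - (2 * ((u * x) \<bullet> v)) *\<^sub>R (u * x) = (cnj u)\<^sup>2 * v - (2 * (x \<bullet> ((cnj u)\<^sup>2 * v))) *\<^sub>R x" 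
    "conorm (u * x) = 0" "conorm x = 0" "(u * x) \<bullet> (u * x) = x \<bullet> x"
proof -
  have m: "w \<bullet> w = 1" if "cmod w = 1" for w using that by (simp add: dot_square_norm)
  have ux: "cmod (u * x) = 1" using assms by (simp add: norm_mult)
  show "conorm (u * x) = 0" "conorm x = 0" "(u * x) \<bullet> (u * x) = x \<bullet> x" using m[OF ux] m[OF assms(2)] by (simp_all add: conorm_def)
  \<comment> \<open>For |w| = 1 the reflection along w sends v to -w^2 cnj v, so turning w by u
    turns the reflection by u^2. This is the double rotation of the frame.\<close>
  have *: "v - (2 * (w \<bullet> v)) *\<^sub>R w = - (w\<^sup>2 * cnj v)" if "cmod w = 1" for v w :: complex
  proof -
    have "w * cnj w = 1" using that by (simp add: complex_norm_square[symmetric])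
    then have n: "w * (cnj w * v) = v" by (simp add: mult.assoc[symmetric])
    have "of_real (2 * (w \<bullet> v)) = w * cnj v + cnj w * v" by (simp add: complex_eq_iff inner_complex_def)
    then have "v - (2 * (w \<bullet> v)) *\<^sub>R w = v - w * (w * cnj v) - w * (cnj w * v)"
      unfolding scaleR_conv_of_real by (simp add: algebra_simps)
    then show ?thesis unfolding n by (simp add: power2_eq_square)
  qed
  have "cnj u * u = 1" using assms(1) by (simp add: complex_norm_square[symmetric] mult.commute)
  show "v - (2 * ((u * x) \<bullet> v)) *\<^sub>R (u * x) = (cnj u)\<^sup>2 * v - (2 * (x \<bullet> ((cnj u)\<^sup>2 * v))) *\<^sub>R x"
    unfolding *[OF ux] *[OF assms(2)] by (simp add: power_mult_distrib algebra_simps)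
qed

lemma side_boundary_fst:
  assumes "cmod u = 1" "cmod x = 1"
  shows "side_point (u * x, y) = side_point (x, y)" "side_vec (u * x, y) v = side_vec (x, y) ((cnj u)\<^sup>2 * fst v, snd v)"
  using half_boundary(2-)[OF assms] half_boundary(1)[OF assms, of "fst v"] by (simp_all add: side_point_def side_vec_def)

lemma side_boundary_snd:
  assumes "cmod u = 1" "cmod y = 1"
  shows "side_point (x, u * y) = side_point (x, y)" "side_vec (x, u * y) v = side_vec (x, y) (fst v, (cnj u)\<^sup>2 * snd v)"
  using half_boundary(2-)[OF assms] half_boundary(1)[OF assms, of "snd v"] by (simp_all add: side_point_def side_vec_def)

text \<open>The maps are deformed from the boundary of the bidisc, where
  \<open>even_lift_twisted\<close> applies, through the place where the families meet, to the
  separating sphere. Positivity of the Pfaffian travels the other way, from the single point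
  \<open>b0\<close>, and keeps all maps nonzero.\<close>

lemma even_lift_mid:
  assumes w: "form_field tomei \<omega>"
    and b0: "b0 \<in> S3" "pf (\<lambda>u v. \<omega> (psi_mid (0, b0)) (mid_eq_frame b0 u) (mid_eq_frame b0 v)) > 0"
  shows "even_lift (\<lambda>b. jform (\<lambda>u v. \<omega> (psi_mid (0, b)) (mid_eq_frame b u) (mid_eq_frame b v)))"
    and "b \<in> S3 \<Longrightarrow> pf (\<lambda>u v. \<omega> (psi_mid (0, b)) (mid_eq_frame b u) (mid_eq_frame b v)) > 0"
proof -
  have conn: "connected ({0..1::real} \<times> S3)" by (intro connected_Times connected_sphere) auto
  define FC where "FC z u v = \<omega> (psi_mid (mid_path z)) (dmid (mid_path z) (mid_path_vec z u)) (dmid (mid_path z) (mid_path_vec z v))" for z u v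
  define FA where "FA z u v = \<omega> (psi_side (side_point (disc_path z))) (dside (side_point (disc_path z)) (side_vec (disc_path z) u)) (dside (side_point (disc_path z)) (side_vec (disc_path z) v))" for z u v
  have end1: "FC (1, b) = (\<lambda>u v. \<omega> (psi_mid (0, b)) (mid_eq_frame b u) (mid_eq_frame b v))" for b
    unfolding FC_def mid_family_end(2) unfolding mid_family_end(1) ..
  have meet: "FC (0, b) = FA (0, b)" if "b \<in> S3" for b
    unfolding FC_def FA_def families_meet[OF that] ..
  have b0': "(1::real, b0) \<in> {0..1} \<times> S3" "(0::real, b0) \<in> {0..1} \<times> S3" using b0(1) by simp_all
  have C: "pf (FC z) > 0" if "z \<in> {0..1} \<times> S3" for z
    using pf_pos_connected[OF w mid_family(1,2,3) conn b0'(1) _ that] b0(2) unfolding FC_def[symmetric] end1 by blast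
  have A: "pf (FA z) > 0" if "z \<in> {0..1} \<times> S3" for z
    using pf_pos_connected[OF w side_family(1,2,3) conn b0'(2) _ that] C[OF b0'(2)] meet[OF b0(1)] unfolding FA_def[symmetric] by simp
  show "b \<in> S3 \<Longrightarrow> pf (\<lambda>u v. \<omega> (psi_mid (0, b)) (mid_eq_frame b u) (mid_eq_frame b v)) > 0"
    using C[of "(1, b)"] by (simp only: end1) simp
  have cC: "continuous_on ({0..1} \<times> S3) (\<lambda>z. jform (FC z))"
    using continuous_jform_pf(1)[OF w mid_family(1,2,3)] unfolding FC_def .
  have cA: "continuous_on ({0..1} \<times> S3) (\<lambda>z. jform (FA z))"
    using continuous_jform_pf(1)[OF w side_family(1,2,3)] unfolding FA_def .
  have altA: "altform (FA z)" if "z \<in> {0..1} \<times> S3" for z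
    using frame_form(1)[OF w side_family(3)[OF that]] unfolding FA_def .
  have x1: "disc_path (1, b) = (fst b / max (cmod (fst b)) (cmod (snd b)), snd b / max (cmod (fst b)) (cmod (snd b)))" for b
    by (simp add: disc_path_def scaleR_conv_of_real divide_inverse mult.commute)
  \<comment> \<open>Along a collapsed circle the point stays and the frame turns by
    \<open>(cnj u)^2\<close>. That this square agrees at u and -u is the source of even
    parity.\<close>
  have "even_lift (\<lambda>b. jform (FA (1, b)))"
  proof (rule even_lift_twisted[where s = "\<lambda>u. (cnj u)\<^sup>2"])
    show "continuous_on S3 (\<lambda>b. jform (FA (1, b)))"
      by (rule continuous_on_compose2[OF cA]) (auto intro!: continuous_intros)
    show "jform (FA (1, b)) \<noteq> 0" if "b \<in> S3" for b using jform_nonzero[OF A] that by simp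
    show "continuous_on (sphere 0 1) (\<lambda>u. (cnj u)\<^sup>2)" by (intro continuous_intros)
    show "cmod ((cnj u)\<^sup>2) = 1" if "cmod u = 1" for u using that by (simp add: norm_power)
    show "(cnj (- u))\<^sup>2 = (cnj u)\<^sup>2" for u by simp
    fix u p q assume pq: "(p, q) \<in> S3" "cmod u = 1"
    have n: "cmod ((cnj u)\<^sup>2) = 1" using pq(2) by (simp add: norm_power)
    have z: "(1::real, (p, q)) \<in> {0..1} \<times> S3" using pq(1) by (simp only: mem_Times_iff fst_conv snd_conv) simp
    note m0 = S3_bounds(3)[OF pq(1)]
    show "jform (FA (1, (u * p, q))) = tw ((cnj u)\<^sup>2) (jform (FA (1, (p, q))))" if le: "cmod q \<le> cmod p"
    proof -
      have p1: "cmod (p / cmod p) = 1" using m0 le by (auto simp: norm_divide)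
      have e: "disc_path (1, (u * p, q)) = (u * (p / cmod p), q / cmod p)" "disc_path (1, (p, q)) = (p / cmod p, q / cmod p)"
        unfolding x1 using le pq(2) by (simp_all add: norm_mult)
      have "FA (1, (u * p, q)) = (\<lambda>v w. FA (1, (p, q)) ((cnj u)\<^sup>2 * fst v, 1 * snd v) ((cnj u)\<^sup>2 * fst w, 1 * snd w))"
        unfolding FA_def e side_boundary_fst[OF pq(2) p1] by simp
      then show ?thesis using jform_torus[OF altA[OF z] n, of 1] by simp
    qed
    show "jform (FA (1, (p, u * q))) = tw ((cnj u)\<^sup>2) (jform (FA (1, (p, q))))" if le: "cmod p \<le> cmod q"
    proof -
      have p1: "cmod (q / cmod q) = 1" using m0 le by (auto simp: norm_divide)
      have e: "disc_path (1, (p, u * q)) = (p / cmod q, u * (q / cmod q))" "disc_path (1, (p, q)) = (p / cmod q, q / cmod q)"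
        unfolding x1 using le pq(2) by (simp_all add: norm_mult)
      have "FA (1, (p, u * q)) = (\<lambda>v w. FA (1, (p, q)) (1 * fst v, (cnj u)\<^sup>2 * snd v) (1 * fst w, (cnj u)\<^sup>2 * snd w))"
        unfolding FA_def e side_boundary_snd[OF pq(2) p1] by simp
      then show ?thesis using jform_torus[OF altA[OF z] _ n, of 1] by simp
    qed
  qed
  then have e1: "even_lift (\<lambda>b. jform (FA (1 - 0, b)))" by simp
  have "even_lift (\<lambda>b. (\<lambda>z. jform (FA (1 - fst z, snd z))) (1, b))"
  proof (rule even_lift_homotopy)
    show "continuous_on ({0..1} \<times> S3) (\<lambda>z. jform (FA (1 - fst z, snd z)))"
      by (rule continuous_on_compose2[OF cA]) (auto intro!: continuous_intros)
    show "jform (FA (1 - fst (t, b), snd (t, b))) \<noteq> 0" if "t \<in> {0..1}" "b \<in> S3" for t b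
      using jform_nonzero[OF A] that by simp
  qed (use e1 in simp)
  then have "even_lift (\<lambda>b. jform (FC (0, b)))" by (rule even_lift_cong) (simp add: meet)
  then have "even_lift (\<lambda>b. jform (FC (1, b)))"
    using even_lift_homotopy[OF cC] jform_nonzero[OF C] by simp
  then show "even_lift (\<lambda>b. jform (\<lambda>u v. \<omega> (psi_mid (0, b)) (mid_eq_frame b u) (mid_eq_frame b v)))"
    by (simp only: end1)
qed

end

section \<open>Symmetries of the isospectral manifold\<close>

context spectrum
begin

text \<open>Only the moduli of the off-diagonal entries matter for \<open>tomei\<close>, so one of
  them may be conjugated. This reverses the orientation and is used to make the Pfaffian
  positive.\<close>

definition conj_sym :: "P4 \<Rightarrow> P4" where
  "conj_sym x = (fst x, fst (snd x), fst (snd (snd x)), cnj (snd (snd (snd x))))"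

text \<open>Reversal of rows and columns, followed by conjugation of the new first off-diagonal
  entry. Reversal sends t to -t; the additional conjugation makes the whole map preserve the
  orientation.\<close>

definition swap_sym :: "P4 \<Rightarrow> P4" where
  "swap_sym x = (fst (snd (snd x)), snd (snd (snd x)), fst x, cnj (fst (snd x)))"

definition swap_sym_inv :: "P4 \<Rightarrow> P4" where
  "swap_sym_inv x = (fst (snd (snd x)), cnj (snd (snd (snd x))), fst x, fst (snd x))"

lemma cnj_scaleR: "cnj (c *\<^sub>R z) = c *\<^sub>R cnj z"
  by (simp add: complex_eq_iff)

lemma bounded_linear_symmetries: "bounded_linear conj_sym" "bounded_linear swap_sym" "bounded_linear swap_sym_inv"
proof -
  have "linear conj_sym" "linear swap_sym" "linear swap_sym_inv"
    by (rule linearI; simp add: conj_sym_def swap_sym_def swap_sym_inv_def cnj_scaleR)+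
  then show "bounded_linear conj_sym" "bounded_linear swap_sym" "bounded_linear swap_sym_inv"
    by (simp_all only: linear_conv_bounded_linear)
qed

lemma symmetry_inverses: "conj_sym (conj_sym x) = x" "swap_sym_inv (swap_sym x) = x" "swap_sym (swap_sym_inv x) = x"
  by (simp_all add: conj_sym_def swap_sym_def swap_sym_inv_def)

lemma cnj_inner_cnj: "cnj a \<bullet> cnj b = a \<bullet> b"
  by (simp add: inner_complex_def)

lemma symmetries_tomei: "x \<in> tomei \<Longrightarrow> conj_sym x \<in> tomei" "x \<in> tomei \<Longrightarrow> swap_sym x \<in> tomei" "x \<in> tomei \<Longrightarrow> swap_sym_inv x \<in> tomei"
proof -
  obtain a1 b1 a3 b2 where x: "x = (a1, b1, a3, b2)" by (metis prod.exhaust)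
  assume t: "x \<in> tomei"
  have e: "b1 \<bullet> b1 + b2 \<bullet> b2 = E2 a1 a3" "(b1 \<bullet> b1) * (a1 - a3) = (a1 - l1) * (a1 - l2) * (l3 - a1)"
    "(b2 \<bullet> b2) * (a1 - a3) = (a3 - l1) * (a3 - l2) * (a3 - l3)"
    using t tomei_third[of a1 b1 a3 b2] by (simp_all add: x tomei_def)
  have E: "E2 a3 a1 = E2 a1 a3" by (simp add: E2_def algebra_simps)
  have "(b2 \<bullet> b2) * (a3 - a1) = - ((b2 \<bullet> b2) * (a1 - a3))" by (simp add: algebra_simps)
  then have "(b2 \<bullet> b2) * (a3 - a1) = (a3 - l1) * (a3 - l2) * (l3 - a3)" unfolding e(3) by (simp add: algebra_simps)
  then show "conj_sym x \<in> tomei" "swap_sym x \<in> tomei" "swap_sym_inv x \<in> tomei"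
    using e by (simp_all add: x conj_sym_def swap_sym_def swap_sym_inv_def tomei_def cnj_inner_cnj E add.commute)
qed

lemma form_field_symmetries:
  assumes w: "form_field tomei \<omega>"
  shows "form_field tomei (\<lambda>x u v. \<omega> (conj_sym x) (conj_sym u) (conj_sym v))" "form_field tomei (\<lambda>x u v. \<omega> (swap_sym x) (swap_sym u) (swap_sym v))"
proof -
  have M: "tomei = (\<lambda>y. 0 + f y) ` tomei" if "\<And>x. x \<in> tomei \<Longrightarrow> f x \<in> tomei" "\<And>x. x \<in> tomei \<Longrightarrow> h x \<in> tomei" "\<And>x. f (h x) = x"
    for f h :: "P4 \<Rightarrow> P4"
    unfolding add_0 using that by (metis (no_types, opaque_lifting) image_eqI image_subsetI subsetI subset_antisym)
  note M = M[OF symmetries_tomei(1,1) symmetry_inverses(1)] M[OF symmetries_tomei(2,3) symmetry_inverses(3)]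
  show "form_field tomei (\<lambda>x u v. \<omega> (conj_sym x) (conj_sym u) (conj_sym v))"
    using form_field_affine[OF w bounded_linear_symmetries(1,1) symmetry_inverses(1) M(1)] unfolding add_0 .
  show "form_field tomei (\<lambda>x u v. \<omega> (swap_sym x) (swap_sym u) (swap_sym v))"
    using form_field_affine[OF w bounded_linear_symmetries(2,3) symmetry_inverses(2) M(2)] unfolding add_0 .
qed

section \<open>The symmetries on the separating sphere and the contradiction\<close>

definition mid_form :: "(P4 \<Rightarrow> P4 \<Rightarrow> P4 \<Rightarrow> real) \<Rightarrow> c2 \<Rightarrow> c2 \<Rightarrow> c2 \<Rightarrow> real" where
  "mid_form \<omega> b u v = \<omega> (psi_mid (0, b)) (mid_eq_frame b u) (mid_eq_frame b v)"

lemma mid_eq_frame: "b \<in> S3 \<Longrightarrow> frame tomei (psi_mid (0, b)) (mid_eq_frame b)"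
  using mid_family(3)[of "(1, b)"] unfolding mid_family_end(2) unfolding mid_family_end(1) by auto

lemma altform_mid_form: "form_field tomei \<omega> \<Longrightarrow> b \<in> S3 \<Longrightarrow> altform (mid_form \<omega> b)"
  "form_field tomei \<omega> \<Longrightarrow> b \<in> S3 \<Longrightarrow> pf (mid_form \<omega> b) \<noteq> 0"
  using frame_form[OF _ mid_eq_frame] unfolding mid_form_def[abs_def] by blast+

lemma psi_mid0: "psi_mid (0, b) = (l2, kap l2 *\<^sub>R fst b, l2, kap l2 *\<^sub>R snd b)"
  by (simp add: psi_mid_def ma1_def ma3_def)

lemma dmid0: "dmid (0, b) (t, w) = (t * (fst b \<bullet> fst b), kap l2 *\<^sub>R fst w + (dkap l2 * (t * (fst b \<bullet> fst b))) *\<^sub>R fst b,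
    - (t * (snd b \<bullet> snd b)), kap l2 *\<^sub>R snd w - (dkap l2 * (t * (snd b \<bullet> snd b))) *\<^sub>R snd b)"
  by (simp add: dmid_def ma1_def ma3_def Let_def)

definition cnj2 :: "c2 \<Rightarrow> c2" where "cnj2 b = (fst b, cnj (snd b))"
definition flip2 :: "c2 \<Rightarrow> c2" where "flip2 b = (snd b, cnj (fst b))"

lemma conj_sym_mid: "conj_sym (psi_mid (0, b)) = psi_mid (0, cnj2 b)" "conj_sym (mid_eq_frame b v) = mid_eq_frame (cnj2 b) (cnj2 v)"
  by (simp_all add: conj_sym_def psi_mid0 mid_eq_frame_def dmid0 cnj2_def inner_prod_def cnj_inner_cnj cnj_scaleR)

text \<open>Exchanging a1 and a3 reverses the t-direction, so the component of v along b changes its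
  sign before \<open>flip2\<close> is applied.\<close>

lemma swap_sym_mid:
  assumes "b \<in> S3"
  shows "swap_sym (psi_mid (0, b)) = psi_mid (0, flip2 b)"
    "swap_sym (mid_eq_frame b v) = mid_eq_frame (flip2 b) (flip2 (v - (2 * (b \<bullet> v)) *\<^sub>R b))"
proof -
  have n: "b \<bullet> b = 1" using assms by (simp add: dot_square_norm)
  have f: "flip2 (v + w) = flip2 v + flip2 w" "flip2 (c *\<^sub>R v) = c *\<^sub>R flip2 v" "flip2 (v - w) = flip2 v - flip2 w" "flip2 v \<bullet> flip2 w = v \<bullet> w" for v w c
    by (simp_all add: flip2_def cnj_scaleR inner_prod_def cnj_inner_cnj)
  show "swap_sym (psi_mid (0, b)) = psi_mid (0, flip2 b)" by (simp add: swap_sym_def psi_mid0 flip2_def cnj_scaleR)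
  have i: "flip2 b \<bullet> flip2 (v - (2 * (b \<bullet> v)) *\<^sub>R b) = - (b \<bullet> v)" unfolding f(4) by (simp add: inner_diff_right n)
  have t: "flip2 (v - (2 * (b \<bullet> v)) *\<^sub>R b) - (- (b \<bullet> v)) *\<^sub>R flip2 b = flip2 (v - (b \<bullet> v) *\<^sub>R b)"
    unfolding f mult_2 scaleR_add_left by simp
  show "swap_sym (mid_eq_frame b v) = mid_eq_frame (flip2 b) (flip2 (v - (2 * (b \<bullet> v)) *\<^sub>R b))"
    unfolding mid_eq_frame_def i t unfolding dmid0 swap_sym_def by (simp add: flip2_def cnj_inner_cnj cnj_scaleR)
qed

text \<open>\<open>flip2 v\<close> is \<open>(0, 1) \<otimes>\<^sub>q qcnj v\<close>, and reflection
  along b sends v to - b qcnj(v) b, so the two conjugations cancel. What remains is a left and a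
  right multiplication, as required for \<open>jform_left\<close> and
  \<open>jform_right\<close>.\<close>

lemma flip2_reflection:
  assumes "b \<in> S3"
  shows "flip2 (v - (2 * (b \<bullet> v)) *\<^sub>R b) = ((0, -1) \<otimes>\<^sub>q qcnj b) \<otimes>\<^sub>q (v \<otimes>\<^sub>q qcnj b)"
proof -
  obtain a c d e where b: "b = (Complex a c, Complex d e)" by (metis complex.exhaust prod.exhaust)
  obtain p q r s where v: "v = (Complex p q, Complex r s)" by (metis complex.exhaust prod.exhaust)
  have "a\<^sup>2 + c\<^sup>2 + d\<^sup>2 + e\<^sup>2 = 1" using assms unfolding mem_S3_iff cmod_sq by (simp add: b)
  then have n: "a * a = 1 - c * c - d * d - e * e" by (simp add: power2_eq_square)
  have n': "a * (a * x) = x - c * (c * x) - d * (d * x) - e * (e * x)" for x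
    using arg_cong[OF n, of "\<lambda>y. y * x"] by (simp add: algebra_simps)
  show ?thesis
    by (simp add: b v flip2_def qmul_def qcnj_def inner_prod_def inner_complex_def prod_eq_iff complex_eq_iff)
      (simp add: algebra_simps n n')
qed

text \<open>The map is left multiplication by the unit quaternion \<open>(0, -1)\<close>, of
  determinant 1.\<close>

lemma pf_quarter_turn:
  assumes B: "altform B"
  shows "pf (\<lambda>v w. B (snd v, - fst v) (snd w, - fst w)) = pf B"
proof -
  have "B (- a) b = - B a b" "B a (- b) = - B a b" for a b
    using B by (auto simp: altform_def bilinear_lneg bilinear_rneg)
  from this(1)[of e3] this(2)[of _ e3] this(1)[of e4] this(2)[of _ e4]
  have E: "B (0, -1) v = - B e3 v" "B v (0, -1) = - B v e3" "B (0, -\<i>) v = - B e4 v" "B v (0, - \<i>) = - B v e4" for v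
    by simp_all
  have s: "B e3 e1 = - B e1 e3" "B e4 e2 = - B e2 e4" "B e3 e2 = - B e2 e3" "B e4 e1 = - B e1 e4"
    using altform_skew[OF B] by blast+
  show ?thesis by (simp add: pf_def E s)
qed

lemma act_scaleR: "act g (c *\<^sub>R j) = c *\<^sub>R act g j"
  by (simp add: act_def prod_eq_iff complex_eq_iff algebra_simps)

theorem no_form_field_tomei: "\<not> form_field tomei \<omega>"
proof
  assume w0: "form_field tomei \<omega>"
  have e1S: "e1 \<in> S3" unfolding mem_S3_iff by simp
  \<comment> \<open>If the Pfaffian is negative, the pullback by \<open>conj_sym\<close> has a
    positive one.\<close>
  have "\<exists>\<omega>. form_field tomei \<omega> \<and> pf (mid_form \<omega> e1) > 0"
  proof (cases "pf (mid_form \<omega> e1) > 0")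
    case False
    have "mid_form (\<lambda>x u v. \<omega> (conj_sym x) (conj_sym u) (conj_sym v)) e1 = (\<lambda>v w. mid_form \<omega> e1 (fst v, cnj (snd v)) (fst w, cnj (snd w)))"
      by (simp add: mid_form_def conj_sym_mid fun_eq_iff cnj2_def)
    then have "pf (mid_form (\<lambda>x u v. \<omega> (conj_sym x) (conj_sym u) (conj_sym v)) e1) = - pf (mid_form \<omega> e1)"
      using pf_conj_snd[OF altform_mid_form(1)[OF w0 e1S]] by simp
    then show ?thesis using False altform_mid_form(2)[OF w0 e1S] form_field_symmetries(1)[OF w0] by fastforce
  qed (use w0 in blast)
  then obtain \<omega> where w: "form_field tomei \<omega>" and p1: "pf (mid_form \<omega> e1) > 0" by blast
  \<comment> \<open>Since \<open>swap_sym\<close> exchanges the two sides,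
    \<open>even_lift_mid\<close> for this form gives the information from the other side.\<close>
  define \<omega>' where "\<omega>' x u v = \<omega> (swap_sym x) (swap_sym u) (swap_sym v)" for x u v
  have w': "form_field tomei \<omega>'" unfolding \<omega>'_def by (rule form_field_symmetries(2)[OF w])
  have fS: "flip2 b \<in> S3" if "b \<in> S3" for b using that unfolding mem_S3_iff by (simp add: flip2_def add.commute)
  have mf': "mid_form \<omega>' b u v = mid_form \<omega> (flip2 b) (flip2 (u - (2 * (b \<bullet> u)) *\<^sub>R b)) (flip2 (v - (2 * (b \<bullet> v)) *\<^sub>R b))"
    if "b \<in> S3" for b u v
    by (simp only: mid_form_def \<omega>'_def swap_sym_mid[OF that])
  note ev = even_lift_mid[OF w e1S, folded mid_form_def, OF p1]
  have "mid_form \<omega>' e1 = (\<lambda>u v. mid_form \<omega> (flip2 e1) (snd u, - fst u) (snd v, - fst v))"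
  proof -
    have "flip2 (u - (2 * (e1 \<bullet> u)) *\<^sub>R e1) = (snd u, - fst u)" for u
      by (simp add: flip2_def inner_prod_def inner_complex_def complex_eq_iff)
    then show ?thesis using mf'[OF e1S] by (simp only: fun_eq_iff) simp
  qed
  then have "pf (mid_form \<omega>' e1) = pf (mid_form \<omega> (flip2 e1))"
    using pf_quarter_turn[OF altform_mid_form(1)[OF w fS[OF e1S]]] by simp
  then have p1': "pf (mid_form \<omega>' e1) > 0" using ev(2)[OF fS[OF e1S]] by (simp only:)
  note ev' = even_lift_mid[OF w' e1S, folded mid_form_def, OF p1']
  define f where "f b = jform (mid_form \<omega> b)" for b
  define f' where "f' b = jform (mid_form \<omega>' b)" for b
  have evf: "even_lift f" "even_lift f'" using ev(1) ev'(1) unfolding f_def[abs_def] f'_def[abs_def] mid_form_def by simp_all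
  have fnz: "f b \<noteq> 0" if "b \<in> S3" for b unfolding f_def by (rule jform_nonzero[OF ev(2)[OF that]])
  \<comment> \<open>The right factor \<open>qcnj b\<close> of \<open>flip2_reflection\<close> in the
    form in which \<open>jform_right\<close> lets it act. As a function of b it is an isometry of
    the 3-sphere.\<close>
  define g :: "c2 \<Rightarrow> c2" where "g b = (fst b, \<i> * cnj (snd b))" for b
  have gS: "g b \<in> S3" if "b \<in> S3" for b using that unfolding mem_S3_iff by (simp add: g_def norm_mult)
  have act: "f' b = act (g b) (f (flip2 b))" if b: "b \<in> S3" for b
  proof -
    let ?h = "(0, -1) \<otimes>\<^sub>q qcnj b"
    let ?C = "\<lambda>u v. mid_form \<omega> (flip2 b) (?h \<otimes>\<^sub>q u) (?h \<otimes>\<^sub>q v)"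
    note B = altform_mid_form(1)[OF w fS[OF b]]
    have h: "?h \<in> S3" by (intro qmul_S3 qcnj_S3 b) (simp add: mem_S3_iff norm_prod_def)
    have C: "altform ?C" by (rule altform_pullback[OF B linear_qmul(1)])
    have "mid_form \<omega>' b = (\<lambda>u v. ?C (u \<otimes>\<^sub>q qcnj b) (v \<otimes>\<^sub>q qcnj b))"
      by (simp only: fun_eq_iff mf'[OF b] flip2_reflection[OF b]) simp
    then have "f' b = act (cnj (fst (qcnj b)), - \<i> * cnj (snd (qcnj b))) (jform ?C)"
      unfolding f'_def by (simp only: jform_right[OF C])
    also have "jform ?C = f (flip2 b)" unfolding f_def by (rule jform_left[OF B h])
    also have "(cnj (fst (qcnj b)), - \<i> * cnj (snd (qcnj b))) = g b" by (simp add: qcnj_def g_def)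
    finally show ?thesis .
  qed
  obtain p where p: "lifts f p" "even_type p" using evf(1) by (auto simp: even_lift_def)
  have fc: "continuous_on S3 flip2" unfolding flip2_def[abs_def] by (intro continuous_intros)
  have gc: "continuous_on S3 g" unfolding g_def[abs_def] by (intro continuous_intros)
  have pf2: "even_type (\<lambda>b. p (flip2 b))"
    by (rule even_type_compose_odd[OF p(2) fc fS]) (simp_all add: flip2_def)
  \<comment> \<open>The rotation \<open>act (g b)\<close> is covered by left multiplication with
    \<open>g b\<close>, so a lift of \<open>f\<close> yields one of \<open>f'\<close>. By uniqueness
    of lifts this one, too, is of even type.\<close>
  have "lifts f' (\<lambda>b. g b \<otimes>\<^sub>q p (flip2 b))"
    unfolding lifts_def
  proof (intro conjI ballI)
    show "continuous_on S3 (\<lambda>b. g b \<otimes>\<^sub>q p (flip2 b))"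
      by (intro continuous_intros gc even_type_continuous[OF pf2])
    fix b assume b: "b \<in> S3"
    have P: "p (flip2 b) \<in> S3" using even_type_S3[OF pf2 b] .
    show S: "g b \<otimes>\<^sub>q p (flip2 b) \<in> S3" by (intro qmul_S3 gS b P)
    have "hopf (p (flip2 b)) = sgn (f (flip2 b))" using p(1) fS[OF b] unfolding lifts_def by blast
    then have "f (flip2 b) = norm (f (flip2 b)) *\<^sub>R hopf (p (flip2 b))" using fnz[OF fS[OF b]] by (simp add: sgn_div_norm)
    then have "f' b = norm (f (flip2 b)) *\<^sub>R hopf (g b \<otimes>\<^sub>q p (flip2 b))"
      unfolding act[OF b] hopf_qmul by (metis act_scaleR)
    then show "hopf (g b \<otimes>\<^sub>q p (flip2 b)) = sgn (f' b)"
      using norm_hopf_S3[OF S] fnz[OF fS[OF b]] by (simp add: sgn_div_norm)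
  qed
  then have "even_type (\<lambda>b. g b \<otimes>\<^sub>q p (flip2 b))" by (rule even_lift_all[OF evf(2)])
  \<comment> \<open>Cancelling the factor that comes from \<open>p\<close> leaves \<open>g\<close>
    alone, and undoing that isometry leaves the identity.\<close>
  then have "even_type (\<lambda>b. (g b \<otimes>\<^sub>q p (flip2 b)) \<otimes>\<^sub>q qcnj (p (flip2 b)))"
    by (rule even_type_qmul[OF _ even_type_qcnj[OF pf2]])
  then have "even_type g"
    by (rule even_type_cong)
      (simp only: qmul_assoc qmul_qcnj(1)[OF even_type_S3[OF pf2]] qmul_one)
  define g' :: "c2 \<Rightarrow> c2" where "g' b = (fst b, cnj (- \<i> * snd b))" for b
  have "continuous_on S3 g'" unfolding g'_def[abs_def] by (intro continuous_intros)
  moreover have "g' b \<in> S3" if "b \<in> S3" for b using that unfolding mem_S3_iff by (simp add: g'_def norm_mult)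
  ultimately have "even_type (\<lambda>b. g' (g b))" by (rule even_type_compose_left[OF \<open>even_type g\<close>])
  then have "even_type (\<lambda>b. b)" by (rule even_type_cong) (simp add: g'_def g_def)
  then show False using id_not_heq_even by (metis even_typeE)
qed

end

section \<open>Spectra of Hermitian matrices\<close>

lemma eigenvalues_det:
  fixes A :: "complex^'n^'n"
  shows "\<mu> \<in> eigenvalues A \<longleftrightarrow> det (A - mat \<mu>) = 0"
proof -
  have m: "mat \<mu> *v v = \<mu> *s v" for v :: "complex^'n"
    by (simp add: vec_eq_iff matrix_vector_mult_def mat_def if_distrib if_distribR cong: if_cong)
  have "\<mu> \<in> eigenvalues A \<longleftrightarrow> (\<exists>v. v \<noteq> 0 \<and> (A - mat \<mu>) *v v = 0)"
    by (simp add: eigenvalues_def matrix_vector_mult_diff_rdistrib m)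
  also have "\<dots> \<longleftrightarrow> \<not> invertible (A - mat \<mu>)"
    unfolding invertible_left_inverse matrix_left_invertible_ker by blast
  finally show ?thesis by (simp add: invertible_det_nz)
qed

definition tr3 :: "complex^3^3 \<Rightarrow> complex" where "tr3 A = A$1$1 + A$2$2 + A$3$3"

definition minors3 :: "complex^3^3 \<Rightarrow> complex" where
  "minors3 A = A$1$1 * A$2$2 - A$1$2 * A$2$1 + A$1$1 * A$3$3 - A$1$3 * A$3$1 + A$2$2 * A$3$3 - A$2$3 * A$3$2"

lemma charpoly3:
  fixes A :: "complex^3^3"
  shows "det (A - mat \<mu>) = - (\<mu>^3 - tr3 A * \<mu>\<^sup>2 + minors3 A * \<mu> - det A)"
proof -
  have "mat \<mu> $ (1::3) $ (1::3) = \<mu>" "mat \<mu> $ (2::3) $ (2::3) = \<mu>" "mat \<mu> $ (3::3) $ (3::3) = \<mu>"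
    "mat \<mu> $ (1::3) $ (2::3) = 0" "mat \<mu> $ (1::3) $ (3::3) = 0" "mat \<mu> $ (2::3) $ (1::3) = 0"
    "mat \<mu> $ (2::3) $ (3::3) = 0" "mat \<mu> $ (3::3) $ (1::3) = 0" "mat \<mu> $ (3::3) $ (2::3) = 0"
    by (simp_all add: mat_def)
  note m = this
  show ?thesis
    unfolding det_3 tr3_def minors3_def vector_minus_component m diff_0_right
    by (simp add: algebra_simps power2_eq_square power3_eq_cube)
qed

lemma cayley_hamilton3:
  fixes A :: "complex^3^3"
  shows "(A ** (A ** A)) $ i $ j = tr3 A * (A ** A) $ i $ j - minors3 A * A $ i $ j + det A * (if i = j then 1 else 0)"
proof -
  have "\<forall>i j. (A ** (A ** A)) $ i $ j = tr3 A * (A ** A) $ i $ j - minors3 A * A $ i $ j + det A * (if i = j then 1 else 0)"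
    unfolding forall_3 matrix_matrix_mult_def sum_3 det_3 tr3_def minors3_def vec_lambda_beta
    by (simp add: algebra_simps)
  then show ?thesis by blast
qed

text \<open>\<open>has_spectrum\<close> fixes only the set of roots. The difference from (x - a)(x -
  b)(x - c) has degree at most 2 and three distinct zeros, so it vanishes identically.\<close>

lemma three_roots:
  fixes a b c t s d :: complex
  assumes ne: "a \<noteq> b" "a \<noteq> c" "b \<noteq> c"
  shows "{\<mu>. \<mu>^3 - t * \<mu>\<^sup>2 + s * \<mu> - d = 0} = {a, b, c} \<longleftrightarrow> t = a + b + c \<and> s = a * b + a * c + b * c \<and> d = a * b * c"
proof
  assume eq: "{\<mu>. \<mu>^3 - t * \<mu>\<^sup>2 + s * \<mu> - d = 0} = {a, b, c}"
  define T S D where "T = a + b + c - t" and "S = s - (a * b + a * c + b * c)" and "D = a * b * c - d"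
  have q: "T * x\<^sup>2 + S * x + D = 0" if "x \<in> {a, b, c}" for x
  proof -
    have 1: "x^3 - t * x\<^sup>2 + s * x - d = 0" using that eq by blast
    have 2: "(x - a) * (x - b) * (x - c) = 0" using that by auto
    have "T * x\<^sup>2 + S * x + D = (x^3 - t * x\<^sup>2 + s * x - d) - (x - a) * (x - b) * (x - c)"
      by (simp add: T_def S_def D_def algebra_simps power2_eq_square power3_eq_cube)
    then show ?thesis unfolding 1 2 by simp
  qed
  have "(a - x) * (T * (a + x) + S) = (T * a\<^sup>2 + S * a + D) - (T * x\<^sup>2 + S * x + D)" for x
    by (simp add: algebra_simps power2_eq_square)
  moreover have "T * a\<^sup>2 + S * a + D = 0" "T * b\<^sup>2 + S * b + D = 0" "T * c\<^sup>2 + S * c + D = 0"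
    by (rule q; simp)+
  ultimately have "(a - b) * (T * (a + b) + S) = 0" "(a - c) * (T * (a + c) + S) = 0"
    by (simp_all only: diff_self)
  then have l: "T * (a + b) + S = 0" "T * (a + c) + S = 0" using ne by simp_all
  have "T * (b - c) = (T * (a + b) + S) - (T * (a + c) + S)" by (simp add: algebra_simps)
  then have "T * (b - c) = 0" unfolding l by simp
  then have "T = 0" using ne by simp
  moreover from this have "S = 0" using l by simp
  moreover from calculation have "D = 0" using q[of a] by simp
  ultimately show "t = a + b + c \<and> s = a * b + a * c + b * c \<and> d = a * b * c" by (simp add: T_def S_def D_def)
next
  assume "t = a + b + c \<and> s = a * b + a * c + b * c \<and> d = a * b * c"
  then have "\<mu>^3 - t * \<mu>\<^sup>2 + s * \<mu> - d = (\<mu> - a) * (\<mu> - b) * (\<mu> - c)" for \<mu>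
    by (simp add: algebra_simps power2_eq_square power3_eq_cube)
  then show "{\<mu>. \<mu>^3 - t * \<mu>\<^sup>2 + s * \<mu> - d = 0} = {a, b, c}" by auto
qed

lemma has_spectrum_iff:
  assumes "l1 \<noteq> l2" "l1 \<noteq> l3" "l2 \<noteq> l3"
  shows "has_spectrum A l1 l2 l3 \<longleftrightarrow>
    tr3 A = of_real (l1 + l2 + l3) \<and> minors3 A = of_real (l1 * l2 + l1 * l3 + l2 * l3) \<and> det A = of_real (l1 * l2 * l3)"
proof -
  have "eigenvalues A = {\<mu>. \<mu>^3 - tr3 A * \<mu>\<^sup>2 + minors3 A * \<mu> - det A = 0}"
    unfolding set_eq_iff eigenvalues_det charpoly3 neg_equal_0_iff_equal by simp
  then show ?thesis
    unfolding has_spectrum_def using three_roots[of "of_real l1 :: complex" "of_real l2" "of_real l3"] assms by simp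
qed

lemma has_spectrum_cubic:
  assumes "l1 \<noteq> l2" "l1 \<noteq> l3" "l2 \<noteq> l3" "has_spectrum A l1 l2 l3"
  shows "A ** (A ** A) = (l1 + l2 + l3) *\<^sub>R (A ** A) - (l1 * l2 + l1 * l3 + l2 * l3) *\<^sub>R A + (l1 * l2 * l3) *\<^sub>R mat 1"
proof -
  have s: "tr3 A = of_real (l1 + l2 + l3)" "minors3 A = of_real (l1 * l2 + l1 * l3 + l2 * l3)" "det A = of_real (l1 * l2 * l3)"
    using has_spectrum_iff[OF assms(1-3)] assms(4) by blast+
  show ?thesis
    unfolding vec_eq_iff cayley_hamilton3 s
    by (simp add: mat_def scaleR_conv_of_real[of _ "z::complex" for z])
qed

section \<open>Tridiagonal matrices in the coordinates of \<open>tomei\<close>\<close>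

context spectrum
begin

text \<open>The constant trace is split off into \<open>tri_off\<close>, which leaves a linear
  map.\<close>

definition tri :: "P4 \<Rightarrow> complex^3^3" where
  "tri x = vector [vector [of_real (fst x), fst (snd x), 0],
     vector [cnj (fst (snd x)), of_real (- fst x - fst (snd (snd x))), snd (snd (snd x))],
     vector [0, cnj (snd (snd (snd x))), of_real (fst (snd (snd x)))]]"

definition tri_off :: "complex^3^3" where
  "tri_off = vector [vector [0, 0, 0], vector [0, of_real (l1 + l2 + l3), 0], vector [0, 0, 0]]"

definition tri_coords :: "complex^3^3 \<Rightarrow> P4" where
  "tri_coords A = (Re (A$1$1), A$1$2, Re (A$3$3), A$2$3)"

lemma tri_coords_tri: "tri_coords (tri x) = x"
  by (simp add: tri_coords_def tri_def)

lemma bounded_linear_tri: "bounded_linear tri" "bounded_linear tri_coords"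
proof -
  have "linear tri"
    by (rule linearI) (simp_all add: tri_def vec_eq_iff forall_3 complex_eq_iff algebra_simps)
  moreover have "linear tri_coords"
    by (rule linearI) (simp_all add: tri_coords_def)
  ultimately show "bounded_linear tri" "bounded_linear tri_coords" by (simp_all only: linear_conv_bounded_linear)
qed

lemma cnj_mult_inner: "z * cnj z = of_real (z \<bullet> z)" 
  by (simp add: complex_eq_iff inner_complex_def)

lemma tri_spectrum:
  "has_spectrum (vector [vector [of_real a1, b1, 0], vector [cnj b1, of_real a2, b2], vector [0, cnj b2, of_real a3]]) l1 l2 l3
    \<longleftrightarrow> a2 = l1 + l2 + l3 - a1 - a3 \<and> (a1, b1, a3, b2) \<in> tomei"
proof -
  let ?A = "vector [vector [of_real a1, b1, 0], vector [cnj b1, of_real a2, b2], vector [0, cnj b2, of_real a3]] :: complex^3^3"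
  have t: "tr3 ?A = of_real (a1 + a2 + a3)" by (simp add: tr3_def)
  have m: "minors3 ?A = of_real (a1 * a2 + a1 * a3 + a2 * a3 - b1 \<bullet> b1 - b2 \<bullet> b2)"
    by (simp add: minors3_def cnj_mult_inner)
  have "det ?A = of_real a1 * of_real a2 * of_real a3 - of_real a1 * (b2 * cnj b2) - of_real a3 * (b1 * cnj b1)"
    by (simp add: det_3 algebra_simps)
  then have d: "det ?A = of_real (a1 * a2 * a3 - a1 * (b2 \<bullet> b2) - a3 * (b1 \<bullet> b1))" by (simp add: cnj_mult_inner)
  have ne: "l1 \<noteq> l2" "l1 \<noteq> l3" "l2 \<noteq> l3" using l12 l23 by auto
  have sp: "has_spectrum ?A l1 l2 l3 \<longleftrightarrow> a1 + a2 + a3 = l1 + l2 + l3 \<and>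
     a1 * a2 + a1 * a3 + a2 * a3 - b1 \<bullet> b1 - b2 \<bullet> b2 = l1 * l2 + l1 * l3 + l2 * l3 \<and>
     a1 * a2 * a3 - a1 * (b2 \<bullet> b2) - a3 * (b1 \<bullet> b1) = l1 * l2 * l3"
    unfolding has_spectrum_iff[OF ne] t m d of_real_eq_iff ..
  define p q where "p = b1 \<bullet> b1" and "q = b2 \<bullet> b2"
  \<comment> \<open>The value of the characteristic polynomial at a1 combines a1 times its linear
    coefficient with the determinant. Once \<open>p + q = E2 a1 a3\<close>, the value at a1 and the
    determinant therefore impose the same equation.\<close>
  have "a1 * (p + q - E2 a1 a3) - (p * (a1 - a3) - (a1 - l1) * (a1 - l2) * (l3 - a1))
      = l1 * l2 * l3 - (a1 * (l1 + l2 + l3 - a1 - a3) * a3 - a1 * q - a3 * p)"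
    unfolding E2_def by (simp add: algebra_simps)
  then have "p + q = E2 a1 a3 \<and> p * (a1 - a3) = (a1 - l1) * (a1 - l2) * (l3 - a1) \<longleftrightarrow>
     p + q = E2 a1 a3 \<and> a1 * (l1 + l2 + l3 - a1 - a3) * a3 - a1 * q - a3 * p = l1 * l2 * l3"
    by (cases "p + q = E2 a1 a3") (simp_all, linarith)
  moreover have "a1 * a2 + a1 * a3 + a2 * a3 - p - q = l1 * l2 + l1 * l3 + l2 * l3 \<longleftrightarrow> p + q = E2 a1 a3"
    if "a2 = l1 + l2 + l3 - a1 - a3"
    unfolding E2_def that by linarith
  moreover have "a1 + a2 + a3 = l1 + l2 + l3 \<longleftrightarrow> a2 = l1 + l2 + l3 - a1 - a3" by linarith
  ultimately show ?thesis
    unfolding sp unfolding tomei_def mem_Collect_eq case_prod_conv p_def[symmetric] q_def[symmetric]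
    by (cases "a2 = l1 + l2 + l3 - a1 - a3") simp_all
qed

lemma hermitian_tomei_eq: "hermitian_tomei l1 l2 l3 = (\<lambda>x. tri_off + tri x) ` tomei"
proof -
  have v: "tri_off + tri (a1, b1, a3, b2) =
      vector [vector [of_real a1, b1, 0], vector [cnj b1, of_real (l1 + l2 + l3 - a1 - a3), b2], vector [0, cnj b2, of_real a3]]"
    for a1 b1 a3 b2
    by (simp add: tri_off_def tri_def vec_eq_iff forall_3)
  show ?thesis
  proof (intro equalityI subsetI)
    fix A assume "A \<in> hermitian_tomei l1 l2 l3"
    then obtain a1 a2 a3 :: real and b1 b2 where A: "A = vector [vector [of_real a1, b1, 0], vector [cnj b1, of_real a2, b2], vector [0, cnj b2, of_real a3]]"
      "has_spectrum A l1 l2 l3"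
      by (auto simp: hermitian_tomei_def hermitian_tridiagonal_def)
    then have "a2 = l1 + l2 + l3 - a1 - a3" "(a1, b1, a3, b2) \<in> tomei" using tri_spectrum by blast+
    then show "A \<in> (\<lambda>x. tri_off + tri x) ` tomei" using v A(1) by (metis image_eqI)
  next
    fix A assume "A \<in> (\<lambda>x. tri_off + tri x) ` tomei"
    then obtain y where y: "y \<in> tomei" "A = tri_off + tri y" by blast
    obtain a1 b1 a3 b2 where "y = (a1, b1, a3, b2)" by (metis prod.exhaust)
    with y have x: "(a1, b1, a3, b2) \<in> tomei" "A = tri_off + tri (a1, b1, a3, b2)" by simp_all
    have "has_spectrum A l1 l2 l3" unfolding x(2) v tri_spectrum using x(1) by blast
    moreover have "hermitian_tridiagonal A" unfolding hermitian_tridiagonal_def x(2) v by blast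
    ultimately show "A \<in> hermitian_tomei l1 l2 l3" by (simp only: hermitian_tomei_def mem_Collect_eq)
  qed
qed

theorem no_form_field_hermitian_tomei: "\<not> form_field (hermitian_tomei l1 l2 l3) \<omega>"
  using form_field_affine[OF _ bounded_linear_tri tri_coords_tri hermitian_tomei_eq] no_form_field_tomei by blast

end

section \<open>The Kirillov--Kostant--Souriau form\<close>

type_synonym mat3 = "complex^3^3"

lemma bounded_bilinear_matrix_mult: "bounded_bilinear ((**) :: mat3 \<Rightarrow> mat3 \<Rightarrow> mat3)"
proof -
  have "bilinear ((**) :: mat3 \<Rightarrow> mat3 \<Rightarrow> mat3)"
    unfolding bilinear_def
    by (intro conjI allI linearI)
      (simp_all add: matrix_add_ldistrib scalar_matrix_assoc[symmetric] matrix_scalar_ac,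
        simp add: matrix_matrix_mult_def vec_eq_iff sum.distrib algebra_simps)
  then show ?thesis by (simp only: bilinear_conv_bounded_bilinear)
qed

interpretation matmul: bounded_bilinear "(**) :: mat3 \<Rightarrow> mat3 \<Rightarrow> mat3"
  by (rule bounded_bilinear_matrix_mult)

lemma bounded_linear_mat_adjoint: "bounded_linear (mat_adjoint :: mat3 \<Rightarrow> mat3)"
proof -
  have "linear (mat_adjoint :: mat3 \<Rightarrow> mat3)"
    by (rule linearI) (simp_all add: mat_adjoint_def vec_eq_iff complex_eq_iff)
  then show ?thesis by (simp only: linear_conv_bounded_linear)
qed

lemmas mat_adjoint_linear = bounded_linear_mat_adjoint[THEN bounded_linear.linear, THEN linear_add]
  bounded_linear_mat_adjoint[THEN bounded_linear.linear, THEN linear_diff]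
  bounded_linear_mat_adjoint[THEN bounded_linear.linear, THEN linear_cmul]

lemma mat_adjoint_mult: "mat_adjoint (A ** B) = mat_adjoint B ** mat_adjoint A"
  by (simp add: mat_adjoint_def matrix_matrix_mult_def vec_eq_iff cnj_sum mult.commute)

lemma mat_adjoint_one: "mat_adjoint (mat 1) = mat 1"
  by (auto simp: mat_adjoint_def mat_def vec_eq_iff)

lemma trace_commutator:
  fixes A B X :: "complex^'n^'n"
  shows "trace (X ** commutator A B) = - trace (commutator A X ** B)" "trace (X ** commutator A B) = trace (A ** commutator B X)"
proof -
  have d: "A ** (B - C) = A ** B - A ** C" "(B - C) ** A = B ** A - C ** A" for A B C :: "complex^'n^'n"
    by (simp_all add: matrix_matrix_mult_def vec_eq_iff sum_subtractf algebra_simps)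
  have c: "trace (X ** (B ** A)) = trace (A ** (X ** B))" "trace (X ** (A ** B)) = trace (A ** (B ** X))"
    "trace (X ** (B ** A)) = trace (A ** (X ** B))"
    by (metis matrix_mul_assoc trace_mul_sym)+
  show "trace (X ** commutator A B) = - trace (commutator A X ** B)"
    unfolding commutator_def d trace_sub c(1) by (simp add: matrix_mul_assoc)
  show "trace (X ** commutator A B) = trace (A ** commutator B X)"
    unfolding commutator_def d trace_sub c ..
qed

text \<open>By cyclicity of the trace the value depends on A only through
  \<open>commutator A X\<close> and on B only through \<open>commutator B X\<close>, so the definite
  description has exactly one candidate.\<close>

lemma kks_form_eq:
  fixes X :: "complex^'n^'n"
  assumes "skew_hermitian A" "skew_hermitian B"
  shows "kks_form X (commutator A X) (commutator B X) = Im (trace (commutator A X ** B))"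
proof -
  have "kks_form X (commutator A X) (commutator B X) = - Im (trace (X ** commutator A B))"
    unfolding kks_form_def
  proof (rule the_equality)
    fix c assume "\<exists>A' B'. skew_hermitian A' \<and> skew_hermitian B' \<and> commutator A X = commutator A' X \<and>
       commutator B X = commutator B' X \<and> c = - Im (trace (X ** commutator A' B'))"
    then obtain A' B' where e: "commutator A X = commutator A' X" "commutator B X = commutator B' X"
      "c = - Im (trace (X ** commutator A' B'))" by blast
    have "trace (X ** commutator A B) = trace (X ** commutator A B')"
      unfolding trace_commutator(2) e ..
    also have "\<dots> = trace (X ** commutator A' B')"
      unfolding trace_commutator(1) e ..
    finally show "c = - Im (trace (X ** commutator A B))" using e by simp
  qed (use assms in blast)
  then show ?thesis by (simp add: trace_commutator(1))
qed

text \<open>The Lagrange interpolation polynomial at the eigenvalue a, hence the spectral projection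
  of a matrix with distinct eigenvalues a, b, c.\<close>

definition prj :: "real \<Rightarrow> real \<Rightarrow> real \<Rightarrow> mat3 \<Rightarrow> mat3" where
  "prj a b c X = (1 / ((a - b) * (a - c))) *\<^sub>R (X ** X - (b + c) *\<^sub>R X + (b * c) *\<^sub>R mat 1)"

definition cubic :: "real \<Rightarrow> real \<Rightarrow> real \<Rightarrow> mat3 \<Rightarrow> mat3" where
  "cubic a b c X = X ** (X ** X) - (a + b + c) *\<^sub>R (X ** X) + (a * b + a * c + b * c) *\<^sub>R X - (a * b * c) *\<^sub>R mat 1"

text \<open>The derivative of \<open>cubic\<close> at X in the direction W; its vanishing is the
  linearized spectral condition.\<close>

definition dcubic :: "real \<Rightarrow> real \<Rightarrow> real \<Rightarrow> mat3 \<Rightarrow> mat3 \<Rightarrow> mat3" where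
  "dcubic a b c X W = W ** (X ** X) + X ** (W ** X + X ** W) - (a + b + c) *\<^sub>R (W ** X + X ** W) + (a * b + a * c + b * c) *\<^sub>R W"

lemma cubic_perm: "cubic b a c X = cubic a b c X" "cubic c a b X = cubic a b c X"
  by (simp_all add: cubic_def algebra_simps)

lemma dcubic_perm: "dcubic b a c X W = dcubic a b c X W" "dcubic c a b X W = dcubic a b c X W"
  by (simp_all add: dcubic_def algebra_simps)

lemma prj_eigen:
  assumes "cubic a b c X = 0"
  shows "X ** prj a b c X = a *\<^sub>R prj a b c X" "prj a b c X ** X = a *\<^sub>R prj a b c X"
proof -
  let ?Q = "X ** X - (b + c) *\<^sub>R X + (b * c) *\<^sub>R mat 1"
  have "X ** ?Q = a *\<^sub>R ?Q + cubic a b c X"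
    by (simp add: cubic_def matmul.add_right matmul.diff_right matmul.scaleR_right algebra_simps)
  moreover have "?Q ** X = X ** ?Q"
    by (simp add: matmul.add_right matmul.diff_right matmul.scaleR_right matmul.add_left matmul.diff_left matmul.scaleR_left matrix_mul_assoc)
  ultimately show "X ** prj a b c X = a *\<^sub>R prj a b c X" "prj a b c X ** X = a *\<^sub>R prj a b c X"
    unfolding prj_def matmul.scaleR_right matmul.scaleR_left assms by (simp_all add: mult.commute)
qed

lemma prj_sum:
  assumes ne: "a \<noteq> b" "a \<noteq> c" "b \<noteq> c"
  shows "prj a b c X + prj b a c X + prj c a b X = mat 1"
proof -
  define p q r where "p = 1 / ((a - b) * (a - c))" and "q = 1 / ((b - a) * (b - c))" and "r = 1 / ((c - a) * (c - b))"
  have n: "a - b \<noteq> 0" "a - c \<noteq> 0" "b - c \<noteq> 0" "b - a \<noteq> 0" "c - a \<noteq> 0" "c - b \<noteq> 0" using ne by simp_all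
  have "p + q + r = 0" "p * (b + c) + q * (a + c) + r * (a + b) = 0" "p * (b * c) + q * (a * c) + r * (a * b) = 1"
    unfolding p_def q_def r_def using n by (simp_all add: divide_simps) (simp_all add: algebra_simps)
  note e = this
  have "prj a b c X + prj b a c X + prj c a b X = (p + q + r) *\<^sub>R (X ** X)
      - (p * (b + c) + q * (a + c) + r * (a + b)) *\<^sub>R X + (p * (b * c) + q * (a * c) + r * (a * b)) *\<^sub>R mat 1"
    unfolding prj_def p_def[symmetric] q_def[symmetric] r_def[symmetric] by (simp add: algebra_simps)
  then show ?thesis unfolding e by simp
qed

text \<open>Between two copies of the projection P each X acts as a, so the linearized cubic becomes
  its scalar derivative (a - b)(a - c) at a, times P W P.\<close>

lemma prj_compress:
  assumes ne: "a \<noteq> b" "a \<noteq> c" and X: "cubic a b c X = 0" and W: "dcubic a b c X W = 0"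
  shows "prj a b c X ** (W ** prj a b c X) = 0"
proof -
  let ?P = "prj a b c X"
  note e = prj_eigen[OF X]
  have e': "X ** (?P ** Y) = a *\<^sub>R (?P ** Y)" "?P ** (X ** Y) = a *\<^sub>R (?P ** Y)" for Y :: mat3
    by (simp_all add: matrix_mul_assoc e matmul.scaleR_left)
  have "?P ** (dcubic a b c X W ** ?P) = (a * a + a * a + a * a - (a + b + c) * (a + a) + (a * b + a * c + b * c)) *\<^sub>R (?P ** (W ** ?P))"
    unfolding dcubic_def
    by (simp add: matmul.add_right matmul.diff_right matmul.scaleR_right matmul.add_left matmul.diff_left matmul.scaleR_left e e' matrix_mul_assoc[symmetric] algebra_simps)
  also have "a * a + a * a + a * a - (a + b + c) * (a + a) + (a * b + a * c + b * c) = (a - b) * (a - c)"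
    by (simp add: algebra_simps)
  finally show ?thesis using ne unfolding W by simp
qed

lemma mat_adjoint_prj: "hermitian X \<Longrightarrow> mat_adjoint (prj a b c X) = prj a b c X"
  by (simp add: prj_def hermitian_def mat_adjoint_linear mat_adjoint_mult mat_adjoint_one)

text \<open>Solves \<open>commutator A X = W\<close> block by block, dividing each off-diagonal
  block of W by a difference of eigenvalues. It replaces the existential in \<open>kks_form\<close>
  by an expression continuous in X and W.\<close>

definition sol :: "real \<Rightarrow> real \<Rightarrow> real \<Rightarrow> mat3 \<Rightarrow> mat3 \<Rightarrow> mat3" where
  "sol a b c X W =
     (1 / (b - a)) *\<^sub>R (prj a b c X ** (W ** prj b a c X) - prj b a c X ** (W ** prj a b c X)) +
     (1 / (c - a)) *\<^sub>R (prj a b c X ** (W ** prj c a b X) - prj c a b X ** (W ** prj a b c X)) +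
     (1 / (c - b)) *\<^sub>R (prj b a c X ** (W ** prj c a b X) - prj c a b X ** (W ** prj b a c X))"

lemma sol_skew:
  assumes "hermitian X" "hermitian W"
  shows "skew_hermitian (sol a b c X W)"
proof -
  have W: "mat_adjoint W = W" using assms(2) by (simp add: hermitian_def)
  show ?thesis
    unfolding skew_hermitian_def sol_def
    by (simp only: mat_adjoint_linear mat_adjoint_mult mat_adjoint_prj[OF assms(1)] W matrix_mul_assoc[symmetric])
      (simp add: algebra_simps)
qed

text \<open>On the blocks given by the spectral projections, the commutator with X multiplies by
  differences of eigenvalues. It cannot produce diagonal blocks, but those of W vanish by
  \<open>prj_compress\<close>.\<close>

lemma sol_commutator:
  assumes ne: "a \<noteq> b" "a \<noteq> c" "b \<noteq> c" and X: "cubic a b c X = 0" and W: "dcubic a b c X W = 0"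
  shows "commutator (sol a b c X W) X = W"
proof -
  let ?P = "prj a b c X" and ?Q = "prj b a c X" and ?R = "prj c a b X"
  note X2 = trans[OF cubic_perm(1) X] and X3 = trans[OF cubic_perm(2) X]
  note e = prj_eigen[OF X] prj_eigen[OF X2] prj_eigen[OF X3]
  have l: "X ** (?P ** Y) = a *\<^sub>R (?P ** Y)" "X ** (?Q ** Y) = b *\<^sub>R (?Q ** Y)" "X ** (?R ** Y) = c *\<^sub>R (?R ** Y)" for Y :: mat3
    by (simp_all add: matrix_mul_assoc e matmul.scaleR_left)
  have s: "(1 / (y - x)) *\<^sub>R (y *\<^sub>R A - x *\<^sub>R B) - (1 / (y - x)) *\<^sub>R (x *\<^sub>R A - y *\<^sub>R B) = A + B"
    if "x \<noteq> y" for x y and A B :: mat3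
  proof -
    have "(1 / (y - x)) *\<^sub>R (y *\<^sub>R A - x *\<^sub>R B) - (1 / (y - x)) *\<^sub>R (x *\<^sub>R A - y *\<^sub>R B)
        = (1 / (y - x)) *\<^sub>R ((y - x) *\<^sub>R (A + B))"
      unfolding scaleR_diff_right[symmetric] by (rule arg_cong) (simp add: algebra_simps)
    then show ?thesis using that by simp
  qed
  have "commutator (sol a b c X W) X =
     ((1 / (b - a)) *\<^sub>R (b *\<^sub>R (?P ** (W ** ?Q)) - a *\<^sub>R (?Q ** (W ** ?P))) +
      (1 / (c - a)) *\<^sub>R (c *\<^sub>R (?P ** (W ** ?R)) - a *\<^sub>R (?R ** (W ** ?P))) +
      (1 / (c - b)) *\<^sub>R (c *\<^sub>R (?Q ** (W ** ?R)) - b *\<^sub>R (?R ** (W ** ?Q)))) -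
     ((1 / (b - a)) *\<^sub>R (a *\<^sub>R (?P ** (W ** ?Q)) - b *\<^sub>R (?Q ** (W ** ?P))) +
      (1 / (c - a)) *\<^sub>R (a *\<^sub>R (?P ** (W ** ?R)) - c *\<^sub>R (?R ** (W ** ?P))) +
      (1 / (c - b)) *\<^sub>R (b *\<^sub>R (?Q ** (W ** ?R)) - c *\<^sub>R (?R ** (W ** ?Q))))"
    by (simp only: commutator_def sol_def matmul.add_right matmul.add_left matmul.diff_right matmul.diff_left matmul.scaleR_left matmul.scaleR_right
        matrix_mul_assoc[symmetric] l e)
  also have "\<dots> = (?P ** (W ** ?Q) + ?Q ** (W ** ?P)) + (?P ** (W ** ?R) + ?R ** (W ** ?P)) + (?Q ** (W ** ?R) + ?R ** (W ** ?Q))"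
    unfolding add_diff_add s[OF ne(1)] s[OF ne(2)] s[OF ne(3)] ..
  finally have "commutator (sol a b c X W) X =
      (?P ** (W ** ?Q) + ?Q ** (W ** ?P)) + (?P ** (W ** ?R) + ?R ** (W ** ?P)) + (?Q ** (W ** ?R) + ?R ** (W ** ?Q))" .
  moreover have "?P ** (W ** ?P) = 0" "?Q ** (W ** ?Q) = 0" "?R ** (W ** ?R) = 0"
    using prj_compress[OF ne(1,2) X W] prj_compress[OF _ _ X2 trans[OF dcubic_perm(1) W]]
      prj_compress[OF _ _ X3 trans[OF dcubic_perm(2) W]] ne by auto
  moreover have "W = (?P + ?Q + ?R) ** (W ** (?P + ?Q + ?R))"
    by (simp add: prj_sum[OF ne])
  then have "W = ?P ** (W ** ?P) + ?Q ** (W ** ?P) + ?R ** (W ** ?P) + (?P ** (W ** ?Q) + ?Q ** (W ** ?Q) + ?R ** (W ** ?Q))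
      + (?P ** (W ** ?R) + ?Q ** (W ** ?R) + ?R ** (W ** ?R))"
    by (simp only: matmul.add_right matmul.add_left)
  ultimately show ?thesis by (simp add: ac_simps)
qed

lemma linear_sol: "linear (sol a b c X)"
  by (rule linearI)
    (simp_all add: sol_def matmul.add_right matmul.add_left matmul.scaleR_right matmul.scaleR_left algebra_simps)

lemma continuous_on_sol:
  assumes "continuous_on S X" "continuous_on S W"
  shows "continuous_on S (\<lambda>s. sol a b c (X s) (W s))"
proof -
  have p: "continuous_on S (\<lambda>s. prj a b c (X s))" for a b c
    unfolding prj_def by (intro continuous_intros matmul.continuous_on assms)
  show ?thesis unfolding sol_def by (intro continuous_intros matmul.continuous_on p assms)
qed

lemma cubic_deriv:
  assumes "(g has_vector_derivative W) (at t)"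
  shows "((\<lambda>t. cubic a b c (g t)) has_vector_derivative dcubic a b c (g t) W) (at t)"
proof -
  note m = matmul.has_vector_derivative
  have "((\<lambda>t. cubic a b c (g t)) has_vector_derivative
     (g t ** (g t ** W + W ** g t) + W ** (g t ** g t)) - (a + b + c) *\<^sub>R (g t ** W + W ** g t) + (a * b + a * c + b * c) *\<^sub>R W - 0) (at t)"
    unfolding cubic_def
    by (intro has_vector_derivative_diff has_vector_derivative_add has_vector_derivative_const m assms
        bounded_linear.has_vector_derivative[OF bounded_linear_scaleR_right])
  then show ?thesis by (simp add: dcubic_def algebra_simps)
qed

section \<open>The form on the orbit and its pullbacks\<close>

context
  fixes l1 l2 l3 :: real
  assumes ne: "l1 \<noteq> l2" "l1 \<noteq> l3" "l2 \<noteq> l3"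
begin

lemma orbit_cubic: "X \<in> hermitian_orbit l1 l2 l3 \<Longrightarrow> cubic l1 l2 l3 X = 0"
  using has_spectrum_cubic[OF ne, of X] by (simp add: hermitian_orbit_def cubic_def)

text \<open>Being Hermitian and satisfying the cubic equation hold along the whole curve and can be
  differentiated at 0.\<close>

lemma orbit_velocity:
  assumes g: "(g has_vector_derivative W) (at 0)" and T: "open T" "0 \<in> T" "\<And>t. t \<in> T \<Longrightarrow> g t \<in> hermitian_orbit l1 l2 l3"
  shows "hermitian W" "dcubic l1 l2 l3 (g 0) W = 0"
proof -
  have "((\<lambda>t. mat_adjoint (g t)) has_vector_derivative mat_adjoint W) (at 0)"
    by (rule bounded_linear.has_vector_derivative[OF bounded_linear_mat_adjoint g])
  then have "(g has_vector_derivative mat_adjoint W) (at 0)"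
    by (rule has_vector_derivative_transform_within_open[OF _ T(1,2)]) (use T(3) in \<open>auto simp: hermitian_orbit_def hermitian_def\<close>)
  then show "hermitian W" using g vector_derivative_unique_at unfolding hermitian_def by blast
  have "((\<lambda>t. 0) has_vector_derivative dcubic l1 l2 l3 (g 0) W) (at 0)"
    by (rule has_vector_derivative_transform_within_open[OF cubic_deriv[OF g] T(1,2)]) (use T(3) orbit_cubic in auto)
  then show "dcubic l1 l2 l3 (g 0) W = 0" using vector_derivative_unique_at has_vector_derivative_const by blast
qed

lemma kks_form_sol:
  assumes "X \<in> hermitian_orbit l1 l2 l3" "hermitian U" "dcubic l1 l2 l3 X U = 0" "hermitian V" "dcubic l1 l2 l3 X V = 0"
  shows "kks_form X U V = Im (trace (U ** sol l1 l2 l3 X V))"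
proof -
  have "skew_hermitian (sol l1 l2 l3 X U)" "skew_hermitian (sol l1 l2 l3 X V)"
    using assms by (auto intro: sol_skew simp: hermitian_orbit_def)
  from kks_form_eq[OF this, of X] show ?thesis
    using sol_commutator[OF ne orbit_cubic[OF assms(1)]] assms by simp
qed

lemma kks_form_self:
  assumes "X \<in> hermitian_orbit l1 l2 l3" "hermitian U" "dcubic l1 l2 l3 X U = 0"
  shows "kks_form X U U = 0"
proof -
  let ?A = "sol l1 l2 l3 X U"
  have "kks_form X U U = Im (trace (commutator ?A X ** ?A))"
    using kks_form_sol[OF assms assms(2,3)] sol_commutator[OF ne orbit_cubic[OF assms(1)] assms(3)] by simp
  also have "trace (commutator ?A X ** ?A) = - trace (X ** commutator ?A ?A)" by (simp add: trace_commutator(1))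
  finally show ?thesis by (simp add: commutator_def trace_0[simplified])
qed

text \<open>A local smooth extension of \<open>f\<close> computes the differential and
  \<open>sol\<close> computes the form on velocities in the orbit; combined they give an extension
  whose continuity is visible.\<close>

lemma form_field_pullback_kks:
  fixes M :: "'a::euclidean_space set"
  assumes f: "smooth_map M (hermitian_orbit l1 l2 l3) f" and nd: "nondegenerate_two_form M (pullback_form M f kks_form)"
  shows "form_field M (pullback_form M f kks_form)"
proof -
  \<comment> \<open>Resolves the definite description in \<open>differential\<close>: whichever
    curve with velocity v is taken, the image curve has the velocity given by the derivative of
    \<open>F\<close>.\<close>
  have loc: "differential M f x v = frechet_derivative F (at x) v \<and> hermitian (differential M f x v) \<and>
      dcubic l1 l2 l3 (f x) (differential M f x v) = 0"
    if U: "open U" "x \<in> U" and F: "smooth_on U F" "\<forall>y\<in>M \<inter> U. F y = f y" and x: "x \<in> M" and v: "v \<in> tangent_space M x"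
    for U F x v
  proof -
    have "F differentiable (at x)" using F(1) U(2) C_k_on_SucD(1)[of 0] unfolding smooth_on_def by blast
    then have D: "(F has_derivative frechet_derivative F (at x)) (at x)" by (simp add: frechet_derivative_works)
    have curve: "((f \<circ> \<gamma>) has_vector_derivative frechet_derivative F (at x) v) (at 0) \<and>
        (\<exists>T. open T \<and> 0 \<in> T \<and> (\<forall>t\<in>T. \<gamma> t \<in> M))" if \<gamma>: "smooth_curve_at M x v \<gamma>" for \<gamma>
    proof -
      obtain \<epsilon> where \<epsilon>: "\<epsilon> > 0" "\<gamma> ` {-\<epsilon><..<\<epsilon>} \<subseteq> M" "\<gamma> 0 = x" "(\<gamma> has_vector_derivative v) (at 0)"
        using \<gamma> by (auto simp: smooth_curve_at_def)
      have "isCont \<gamma> 0" using \<epsilon>(4) by (rule has_vector_derivative_continuous)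
      then have "\<forall>\<^sub>F t in nhds 0. \<gamma> t \<in> U"
        using U \<epsilon>(3) by (simp add: isCont_def tendsto_def eventually_nhds_conv_at)
      moreover have "\<forall>\<^sub>F t in nhds 0. t \<in> {-\<epsilon><..<\<epsilon>}"
        using \<epsilon>(1) by (intro eventually_nhds_in_open) auto
      ultimately have "\<forall>\<^sub>F t in nhds 0. \<gamma> t \<in> U \<and> \<gamma> t \<in> M"
        by eventually_elim (use \<epsilon>(2) in auto)
      then obtain T where T: "open T" "0 \<in> T" "\<And>t. t \<in> T \<Longrightarrow> \<gamma> t \<in> U \<and> \<gamma> t \<in> M"
        by (auto simp: eventually_nhds)
      have "((F \<circ> \<gamma>) has_vector_derivative frechet_derivative F (at x) v) (at 0)"
        using vector_derivative_diff_chain_within[OF \<epsilon>(4), of F] has_derivative_at_withinI[OF D] \<epsilon>(3) by simp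
      then have "((f \<circ> \<gamma>) has_vector_derivative frechet_derivative F (at x) v) (at 0)"
        by (rule has_vector_derivative_transform_within_open[OF _ T(1,2)]) (use F(2) T(3) in auto)
      then show ?thesis using T by blast
    qed
    obtain \<gamma> where \<gamma>: "smooth_curve_at M x v \<gamma>" using v by (auto simp: tangent_space_def)
    have d: "differential M f x v = frechet_derivative F (at x) v"
      unfolding differential_def
      by (rule the_equality) (use curve \<gamma> vector_derivative_unique_at in blast)+
    obtain T where T: "open T" "0 \<in> T" "\<forall>t\<in>T. \<gamma> t \<in> M" using curve[OF \<gamma>] by blast
    have "(f \<circ> \<gamma>) t \<in> hermitian_orbit l1 l2 l3" if "t \<in> T" for t
      using T(3) that f by (auto simp: smooth_map_def)
    from orbit_velocity[OF conjunct1[OF curve[OF \<gamma>]] T(1,2) this]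
    show ?thesis using d \<gamma> by (simp add: smooth_curve_at_def)
  qed
  have fO: "f x \<in> hermitian_orbit l1 l2 l3" if "x \<in> M" for x using f that by (auto simp: smooth_map_def)
  show ?thesis
    unfolding form_field_def
  proof (intro conjI ballI nd)
    fix x assume x: "x \<in> M"
    then obtain U F where U: "open U" "x \<in> U" and F: "smooth_on U F" "\<forall>y\<in>M \<inter> U. F y = f y"
      using f unfolding smooth_map_def by blast
    show "pullback_form M f kks_form x u u = 0" if "u \<in> tangent_space M x" for u
      using kks_form_self[OF fO[OF x]] loc[OF U F x that] unfolding pullback_form_def by blast
    \<comment> \<open>\<open>kks_form\<close> is meaningful only on commutators with the base point.
      This expression is bilinear on all ambient vectors and agrees with the pulled back form on
      tangent ones.\<close>
    define \<Omega> where "\<Omega> y u v = Im (trace (frechet_derivative F (at y) u ** sol l1 l2 l3 (F y) (frechet_derivative F (at y) v)))" for y u v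
    have C1: "C_k_on (Suc 0) U F" using F(1) unfolding smooth_on_def by blast
    have "bilinear (\<Omega> y)" if "y \<in> M \<inter> U" for y
    proof -
      have "F differentiable (at y)" using C_k_on_SucD(1)[OF C1] that by blast
      then have D: "linear (frechet_derivative F (at y))" by (rule linear_frechet_derivative)
      show ?thesis
        unfolding bilinear_def \<Omega>_def
        by (intro conjI allI linearI)
          (simp_all add: linear_add[OF D] linear_cmul[OF D] linear_add[OF linear_sol] linear_cmul[OF linear_sol]
            matmul.add_left matmul.add_right matmul.scaleR_left matmul.scaleR_right trace_add,
            simp_all add: trace_def sum_3 algebra_simps)
    qed
    moreover have "continuous_on (M \<inter> U) (\<lambda>y. \<Omega> y u v)" for u v
    proof -
      have c: "continuous_on (M \<inter> U) F" "continuous_on (M \<inter> U) (\<lambda>y. frechet_derivative F (at y) w)" for w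
        using smooth_on_imp_continuous_on[OF F(1)] C_k_on_SucD(2)[OF C1, of w] by (auto intro: continuous_on_subset)
      show ?thesis
        unfolding \<Omega>_def trace_def by (intro continuous_intros matmul.continuous_on continuous_on_sol c)
    qed
    moreover have "\<Omega> y u v = pullback_form M f kks_form y u v"
      if y: "y \<in> M \<inter> U" and u: "u \<in> tangent_space M y" and v: "v \<in> tangent_space M y" for y u v
    proof -
      have yy: "y \<in> U" "y \<in> M" using y by auto
      note u = loc[OF U(1) yy(1) F yy(2) u] and v = loc[OF U(1) yy(1) F yy(2) v]
      have "kks_form (f y) (differential M f y u) (differential M f y v) =
          Im (trace (differential M f y u ** sol l1 l2 l3 (f y) (differential M f y v)))"
        by (rule kks_form_sol[OF fO[OF yy(2)]]) (use u v in blast)+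
      moreover have "F y = f y" using F(2) y by blast
      ultimately show ?thesis using u v by (simp add: \<Omega>_def pullback_form_def)
    qed
    ultimately show "\<exists>U \<Omega>. open U \<and> x \<in> U \<and> (\<forall>y\<in>M \<inter> U. bilinear (\<Omega> y)) \<and>
        (\<forall>u v. continuous_on (M \<inter> U) (\<lambda>y. \<Omega> y u v)) \<and>
        (\<forall>y\<in>M \<inter> U. \<forall>u\<in>tangent_space M y. \<forall>v\<in>tangent_space M y. \<Omega> y u v = pullback_form M f kks_form y u v)"
      using U by (intro exI[of _ U] exI[of _ \<Omega>] conjI ballI allI) auto
  qed
qed

end

text \<open>The ambient inner product need not be invariant under \<open>J\<close>, so the skew part
  of its pairing with \<open>J\<close> is taken. It is nondegenerate because testing u against J u
  gives |J u|^2 + |u|^2.\<close>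

lemma form_field_almost_complex:
  assumes "almost_complex_structure M J"
  shows "form_field M (\<lambda>x u v. J x u \<bullet> v - u \<bullet> J x v)"
  unfolding form_field_def nondegenerate_two_form_def
proof (intro conjI ballI impI)
  have J: "J x v \<in> tangent_space M x" "J x (J x v) = - v" if "x \<in> M" "v \<in> tangent_space M x" for x v
    using assms that by (auto simp: almost_complex_structure_def)
  fix x assume x: "x \<in> M"
  show "J x u \<bullet> u - u \<bullet> J x u = 0" for u by (simp add: inner_commute)
  show "u = 0" if u: "u \<in> tangent_space M x" and z: "\<forall>v\<in>tangent_space M x. J x u \<bullet> v - u \<bullet> J x v = 0" for u
  proof -
    have "J x u \<bullet> J x u + u \<bullet> u = 0" using z J[OF x u] by force
    then show ?thesis by (simp add: add_nonneg_eq_0_iff)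
  qed
  obtain U and K :: "'a \<Rightarrow> 'a \<Rightarrow>\<^sub>L 'a" where K: "open U" "x \<in> U" "smooth_on U K"
    "\<forall>y\<in>M \<inter> U. \<forall>v\<in>tangent_space M y. blinfun_apply (K y) v = J y v"
    using assms x unfolding almost_complex_structure_def by blast
  have c: "continuous_on (M \<inter> U) K" using smooth_on_imp_continuous_on[OF K(3)] by (rule continuous_on_subset) auto
  have "bilinear (\<lambda>u v. K y u \<bullet> v - u \<bullet> K y v)" for y
    unfolding bilinear_def
    by (intro conjI allI linearI) (simp_all add: blinfun.add_right blinfun.scaleR_right algebra_simps)
  moreover have "continuous_on (M \<inter> U) (\<lambda>y. K y u \<bullet> v - u \<bullet> K y v)" for u v
    by (intro continuous_intros c)
  ultimately show "\<exists>U \<Omega>. open U \<and> x \<in> U \<and> (\<forall>y\<in>M \<inter> U. bilinear (\<Omega> y)) \<and>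
      (\<forall>u v. continuous_on (M \<inter> U) (\<lambda>y. \<Omega> y u v)) \<and>
      (\<forall>y\<in>M \<inter> U. \<forall>u\<in>tangent_space M y. \<forall>v\<in>tangent_space M y. \<Omega> y u v = J y u \<bullet> v - u \<bullet> J y v)"
    using K(1,2,4) by (intro exI[of _ U] exI[of _ "\<lambda>y u v. K y u \<bullet> v - u \<bullet> K y v"]) auto
qed

lemma form_field_symplectic:
  assumes "symplectic_structure M \<omega>"
  shows "form_field M \<omega>"
  unfolding form_field_def
proof (intro conjI ballI)
  show "nondegenerate_two_form M \<omega>" using assms by (simp add: symplectic_structure_def)
  fix x assume x: "x \<in> M"
  obtain U and \<Omega> :: "'a \<Rightarrow> 'a \<Rightarrow>\<^sub>L 'a \<Rightarrow>\<^sub>L real" where O: "open U" "x \<in> U" "smooth_on U \<Omega>" "alternating_on U \<Omega>"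
    "\<forall>y\<in>M \<inter> U. \<forall>u\<in>tangent_space M y. \<forall>v\<in>tangent_space M y. \<Omega> y u v = \<omega> y u v"
    using assms x unfolding symplectic_structure_def closed_two_form_def by blast
  show "\<omega> x u u = 0" if "u \<in> tangent_space M x" for u
    using O x that by (metis IntI alternating_on_def)
  have c: "continuous_on (M \<inter> U) \<Omega>" using smooth_on_imp_continuous_on[OF O(3)] by (rule continuous_on_subset) auto
  have "bilinear (\<lambda>u v. \<Omega> y u v)" for y
    unfolding bilinear_def
    by (intro conjI allI linearI) (simp_all add: blinfun.add_right blinfun.scaleR_right blinfun.add_left blinfun.scaleR_left)
  moreover have "continuous_on (M \<inter> U) (\<lambda>y. \<Omega> y u v)" for u v
    by (intro continuous_intros c)
  ultimately show "\<exists>U \<Omega>. open U \<and> x \<in> U \<and> (\<forall>y\<in>M \<inter> U. bilinear (\<Omega> y)) \<and>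
      (\<forall>u v. continuous_on (M \<inter> U) (\<lambda>y. \<Omega> y u v)) \<and>
      (\<forall>y\<in>M \<inter> U. \<forall>u\<in>tangent_space M y. \<forall>v\<in>tangent_space M y. \<Omega> y u v = \<omega> y u v)"
    using O(1,2,5) by (intro exI[of _ U] exI[of _ "\<lambda>y u v. \<Omega> y u v"]) auto
qed

text \<open>The spectrum enters as a set, so the eigenvalues may be listed in the increasing order
  that the locale demands.\<close>

lemma no_form_field_hermitian_tomei_unordered:
  assumes "l1 \<noteq> l2" "l1 \<noteq> l3" "l2 \<noteq> l3"
  shows "\<not> form_field (hermitian_tomei l1 l2 l3) \<omega>"
proof -
  have perm: "hermitian_tomei l2 l1 l3 = hermitian_tomei l1 l2 l3" "hermitian_tomei l1 l3 l2 = hermitian_tomei l1 l2 l3" for l1 l2 l3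
    by (simp_all add: hermitian_tomei_def has_spectrum_def insert_commute)
  have no: "\<not> form_field (hermitian_tomei a b c) \<omega>" if "a < b" "b < c" for a b c
    by (rule spectrum.no_form_field_hermitian_tomei) (unfold_locales, fact+)
  consider "l1 < l2" "l2 < l3" | "l1 < l3" "l3 < l2" | "l2 < l1" "l1 < l3" | "l2 < l3" "l3 < l1" | "l3 < l1" "l1 < l2" | "l3 < l2" "l2 < l1"
    using assms by linarith
  then show ?thesis by cases (use no perm in metis)+
qed

theorem theorem7p4:
  fixes l1 l2 l3 :: real
  assumes "l1 \<noteq> l2" and "l1 \<noteq> l3" and "l2 \<noteq> l3"
  shows "(\<nexists>J. almost_complex_structure (hermitian_tomei l1 l2 l3) J) \<and>
         (\<nexists>\<omega>. symplectic_structure (hermitian_tomei l1 l2 l3) \<omega>) \<and>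
         (\<nexists>f. smooth_embedding (hermitian_tomei l1 l2 l3) (hermitian_orbit l1 l2 l3) f \<and>
              nondegenerate_two_form (hermitian_tomei l1 l2 l3)
                (pullback_form (hermitian_tomei l1 l2 l3) f kks_form))"
proof (intro conjI notI; elim exE conjE)
  note no = no_form_field_hermitian_tomei_unordered[OF assms]
  show False if "almost_complex_structure (hermitian_tomei l1 l2 l3) J" for J
    using no form_field_almost_complex[OF that] by blast
  show False if "symplectic_structure (hermitian_tomei l1 l2 l3) \<omega>" for \<omega>
    using no form_field_symplectic[OF that] by blast
  fix f
  assume "smooth_embedding (hermitian_tomei l1 l2 l3) (hermitian_orbit l1 l2 l3) f"
    and nd: "nondegenerate_two_form (hermitian_tomei l1 l2 l3) (pullback_form (hermitian_tomei l1 l2 l3) f kks_form)"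
  then have "smooth_map (hermitian_tomei l1 l2 l3) (hermitian_orbit l1 l2 l3) f" by (simp add: smooth_embedding_def)
  from form_field_pullback_kks[OF assms this nd] show False using no by blast
qed

end
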